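(* Let $\mathbf X_N=(X_1^{(N)},\ldots,X_p^{(N)})$ be a family of independent $N\times N$ heavy Wigner matrices, where $X_j^{(N)}$ has parameter $(a_{j,k})_{k\geq 1}$, and let $\mathbf Y_N=(Y_1^{(N)},\ldots,Y_q^{(N)})$ be a family of $N\times N$ random matrices, independent of $\mathbf X_N$, satisfying Assumptions 1, 2 and 3 (stated in the context). Then the joint family $(\mathbf X_N,\mathbf Y_N)$ has a limiting $^*$-distribution $\Phi$, that is, for every non commutative $^*$-polynomial $P$ the limit $$\Phi(P)=\lim_{N\to\infty}\mathbb E\Big[\tfrac1N \mathrm{Tr}\big[P(\mathbf X_N,\mathbf Y_N)\big]\Big]$$ exists. The limit is characterized by traffic-freeness: the $p+1$ families $(X_1^{(N)}),\ldots,(X_p^{(N)}),\mathbf Y_N$ are asymptotically traffic-free. Moreover $\Phi$ depends only on the parameters $(a_{j,k})_{k\ge1}$, $j=1,\ldots,p$, and on the limiting distribution of traffics of $\mathbf Y_N$ on cyclic $^*$-test graphs.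
   Context: All random matrices have complex entries with finite moments of all orders. $M(m,n)$ denotes the $(m,n)$ entry of $M$, $M^*$ its conjugate transpose. A $^*$-polynomial is a finite complex linear combination of words in indeterminates and their formal adjoints. Heavy Wigner matrices. A random $N\times N$ matrix $X_N$ (a sequence indexed by $N$) is a heavy Wigner matrix with parameter $(a_k)_{k\ge1}$ if: (i) almost surely $X_N=X_N^*$; (ii) the sub-diagonal entries of $X_N$ (diagonal included) are independent and centered; (iii) the diagonal entries of $\sqrt N X_N$ are distributed according to a measure $\nu_N$ on $\mathbb R$; (iv) the strictly sub-diagonal entries of $\sqrt N X_N$ are distributed according to a measure $\mu_N$ on $\mathbb C$ invariant under complex conjugation; (v) $\mu_N,\nu_N$ have all their moments and for every $k\ge1$, $N^{-(k-1)}\int|z|^{2k}d\mu_N(z)\to a_k$ and $N^{-(k-1)}\int t^{2k}d\nu_N(t)=O(1)$ as $N\to\infty$. Test graphs. A $^*$-test graph in variables $\mathbf y=(y_1,\ldots,y_q)$ is a finite connected oriented graph $T=(V,E)$ (multiple edges and loops allowed), each edge $e$ carrying a label $y_{\gamma(e)}^{\varepsilon(e)}$ with $\gamma(e)\in\{1,\ldots,q\}$, $\varepsilon(e)\in\{1,*\}$. It is cyclic if there is a closed walk traversing each edge exactly once in the sense of its orientation. For a family $\mathbf Y_N$ of $N\times N$ matrices, $$\tau_N[T(\mathbf Y_N)]=\frac1N\sum_{\phi:V\to\{1,\ldots,N\}}\prod_{e\in E}Y_{\gamma(e)}^{\varepsilon(e)}(\phi(e)),\qquad \phi(e)=(\phi(v),\phi(w))\text{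 for }e=(v,w),$$ and $\tau^0_N[T(\mathbf Y_N)]$ is the same sum restricted to injective $\phi$. Number of leaves $\mathfrak r(T)$. A cutting edge of $T$ is an edge whose removal disconnects $T$. The two-edge connected components of $T$ are its maximal connected subgraphs without cutting edges. The tree $\mathfrak T(T)$ has these components as vertices, two of them being linked by an edge if a cutting edge of $T$ joins them. $\mathfrak r(T)$ is the number of leaves (vertices of degree one) of $\mathfrak T(T)$, with $\mathfrak r(T)=2$ by convention if $\mathfrak T(T)$ has a single vertex. Assumption 1 (convergence): $\lim_N\mathbb E[\tau_N^0[T(\mathbf Y_N)]]$ exists for every cyclic $^*$-test graph $T$. (Equivalently with $\tau_N$; the limits $\tau[T]=\lim\mathbb E[\tau_N[T(\mathbf Y_N)]]$, $\tau^0[T]=\lim\mathbb E[\tau^0_N[T(\mathbf Y_N)]]$ form the limiting distribution of traffics of $\mathbf Y_N$ on cyclic $^*$-test graphs and its injective version; they determine each other.) Assumption 2 (concentration): for all cyclic $^*$-test graphs $T_1,\ldots,T_n$, $\mathbb E[\prod_{i=1}^n\tau_N^0[T_i(\mathbf Y_N)]]-\prod_{i=1}^n\mathbb E[\tau_N^0[T_i(\mathbf Y_N)]]\to0$. Assumption 3 (tightness): for all (not necessarily cyclic) $^*$-test graphs $T_1,\ldots,T_n$, $\mathbb E[\prod_{i=1}^n\tau_N^0[T_i(\mathbf Y_N)]]=O\big(N^{\sum_{i=1}^n(\mathfrak r(T_i)/2-1)}\big)$. Traffic-freeness. Let $\mathbf x_1,\ldots,\mathbf x_m$ be families of variables and $T$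 a $^*$-test graph in $(\mathbf x_1,\ldots,\mathbf x_m)$. Let $T_1,\ldots,T_K$ be the connected components of $T$ labelled by variables in a same family (the connected components of the subgraphs formed, for each $i$, by the edges labelled in $\mathbf x_i$ and their endpoints). Let $G_{red}(T)$ be the undirected graph whose vertices are $T_1,\ldots,T_K$ together with the vertices $v_1,\ldots,v_L$ of $T$ belonging to at least two of the $T_i$, with an edge between $T_i$ and $v_j$ iff $v_j$ is a vertex of $T_i$. $T$ is a free product in $\mathbf x_1,\ldots,\mathbf x_m$ if $G_{red}(T)$ is a tree. (The graph with one vertex and no edge is counted as a free product, with $\tau^0=1$.) Families $\mathbf A_1,\ldots,\mathbf A_m$ of $N\times N$ random matrices are asymptotically traffic-free if for every cyclic $^*$-test graph $T$ in $\mathbf x_1,\ldots,\mathbf x_m$ the limit $\tau^0[T]=\lim_N\mathbb E[\tau_N^0[T(\mathbf A_1,\ldots,\mathbf A_m)]]$ exists, $\tau^0[T]=\prod_{k=1}^K\tau^0[T_k]$ if $T$ is a free product, and $\tau^0[T]=0$ otherwise. *)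

theory Defs
  imports
    "HOL-Probability.Probability"
    "HOL-Library.Landau_Symbols"
    "HOL-Library.Poly_Mapping"
    "Jordan_Normal_Form.Schur_Decomposition"
    "Graph_Theory.Graph_Theory"
begin

text \<open>
  A sequence of random matrices is a function \<open>A\<close> of the size \<open>N\<close> and of the outcome. The
  matrices of size \<open>N\<close> live on their own probability space \<open>M N\<close>. The size \<open>N = 0\<close> is ignored
  throughout.
\<close>

type_synonym 'w rmat = "nat \<Rightarrow> 'w \<Rightarrow> complex mat"

definition random_matrix :: "(nat \<Rightarrow> 'w measure) \<Rightarrow> 'w rmat \<Rightarrow> bool" where
  "random_matrix M A \<longleftrightarrow>
     (\<forall>N>0. (\<forall>\<omega>\<in>space (M N). A N \<omega> \<in> carrier_mat N N) \<and>
        (\<forall>i<N. \<forall>j<N.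
           (\<lambda>\<omega>. A N \<omega> $$ (i, j)) \<in> borel_measurable (M N) \<and>
           (\<forall>k::nat. integrable (M N) (\<lambda>\<omega>. cmod (A N \<omega> $$ (i, j)) ^ k))))"

definition matrix_entries :: "nat \<Rightarrow> complex mat \<Rightarrow> nat \<times> nat \<Rightarrow> complex" where
  "matrix_entries N A = restrict (\<lambda>(i, j). A $$ (i, j)) ({..<N} \<times> {..<N})"

definition family_entries ::
    "nat \<Rightarrow> nat \<Rightarrow> (nat \<Rightarrow> complex mat) \<Rightarrow> nat \<times> nat \<times> nat \<Rightarrow> complex" where
  "family_entries n N A =
     restrict (\<lambda>(l, i, j). A l $$ (i, j)) ({..<n} \<times> {..<N} \<times> {..<N})"

definition heavy_wigner :: "(nat \<Rightarrow> 'w measure) \<Rightarrow> 'w rmat \<Rightarrow> (nat \<Rightarrow> real) \<Rightarrow> bool" where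
  "heavy_wigner M X a \<longleftrightarrow>
     random_matrix M X \<and>
     (\<forall>N>0. AE \<omega> in M N. mat_adjoint (X N \<omega>) = X N \<omega>) \<and>
     (\<forall>N>0. prob_space.indep_vars (M N) (\<lambda>_. borel) (\<lambda>(i, j) \<omega>. X N \<omega> $$ (i, j))
               {(i, j). j \<le> i \<and> i < N}) \<and>
     (\<forall>N>0. \<forall>i<N. \<forall>j\<le>i. (\<integral>\<omega>. X N \<omega> $$ (i, j) \<partial>M N) = 0) \<and>
     (\<exists>(\<mu> :: nat \<Rightarrow> complex measure) (\<nu> :: nat \<Rightarrow> real measure).
        (\<forall>N>0. prob_space (\<mu> N) \<and> sets (\<mu> N) = sets borel \<and>
               prob_space (\<nu> N) \<and> sets (\<nu> N) = sets borel \<and>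
               distr (\<mu> N) borel cnj = \<mu> N \<and>
               (\<forall>k::nat. integrable (\<mu> N) (\<lambda>z. cmod z ^ k) \<and>
                         integrable (\<nu> N) (\<lambda>t. t ^ k))) \<and>
        (\<forall>N>0. \<forall>i<N. distr (M N) borel (\<lambda>\<omega>. complex_of_real (sqrt (real N)) * X N \<omega> $$ (i, i))
                        = distr (\<nu> N) borel complex_of_real) \<and>
        (\<forall>N>0. \<forall>i<N. \<forall>j<i.
           distr (M N) borel (\<lambda>\<omega>. complex_of_real (sqrt (real N)) * X N \<omega> $$ (i, j)) = \<mu> N) \<and>
        (\<forall>k\<ge>1. (\<lambda>N. (\<integral>z. cmod z ^ (2 * k) \<partial>\<mu> N) / real N ^ (k - 1)) \<longlonglongrightarrow> a k) \<and>
        (\<forall>k\<ge>1. (\<lambda>N. (\<integral>t. t ^ (2 * k) \<partial>\<nu> N) / real N ^ (k - 1)) \<in> O(\<lambda>_. 1)))"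

text \<open>A letter \<open>(y, s)\<close> is the variable \<open>y\<close>, or its formal adjoint when \<open>s\<close> is true.\<close>

type_synonym 'y letter = "'y \<times> bool"

type_synonym 'y star_poly = "'y letter list \<Rightarrow>\<^sub>0 complex"

definition star_poly_in :: "'y set \<Rightarrow> 'y star_poly \<Rightarrow> bool" where
  "star_poly_in V P \<longleftrightarrow> (\<forall>w\<in>Poly_Mapping.keys P. fst ` set w \<subseteq> V)"

fun letter_mat :: "('y \<Rightarrow> complex mat) \<Rightarrow> 'y letter \<Rightarrow> complex mat" where
  "letter_mat A (y, s) = (if s then mat_adjoint (A y) else A y)"

definition word_mat :: "nat \<Rightarrow> ('y \<Rightarrow> complex mat) \<Rightarrow> 'y letter list \<Rightarrow> complex mat" where
  "word_mat N A w = foldr (\<lambda>l B. letter_mat A l * B) w (1\<^sub>m N)"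

definition star_poly_mat :: "nat \<Rightarrow> ('y \<Rightarrow> complex mat) \<Rightarrow> 'y star_poly \<Rightarrow> complex mat" where
  "star_poly_mat N A P =
     mat N N (\<lambda>(i, j). \<Sum>w\<in>Poly_Mapping.keys P. Poly_Mapping.lookup P w * word_mat N A w $$ (i, j))"

definition Tr :: "complex mat \<Rightarrow> complex" where
  "Tr A = (\<Sum>i<dim_row A. A $$ (i, i))"

definition mean_trace ::
    "(nat \<Rightarrow> 'w measure) \<Rightarrow> ('y \<Rightarrow> 'w rmat) \<Rightarrow> 'y star_poly \<Rightarrow> nat \<Rightarrow> complex" where
  "mean_trace M A P N =
     (\<integral>\<omega>. 1 / of_nat N * Tr (star_poly_mat N (\<lambda>y. A y N \<omega>) P) \<partial>M N)"

text \<open>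
  Vertices and arcs are natural numbers, which loses nothing since the graphs are finite. Only the
  labels of the arcs of \<open>shape T\<close> matter. The constant \<open>Digraph_Component.connected\<close> ignores the
  orientation and requires a vertex.
\<close>

record 'y test_graph =
  shape :: "(nat, nat) pre_digraph"
  lbl :: "nat \<Rightarrow> 'y letter"

definition test_graph_in :: "'y set \<Rightarrow> 'y test_graph \<Rightarrow> bool" where
  "test_graph_in V T \<longleftrightarrow>
     fin_digraph (shape T) \<and> Digraph_Component.connected (shape T) \<and>
     (\<forall>e\<in>arcs (shape T). fst (lbl T e) \<in> V)"

definition cyclic_in :: "'y set \<Rightarrow> 'y test_graph \<Rightarrow> bool" where
  "cyclic_in V T \<longleftrightarrow>
     test_graph_in V T \<and> (\<exists>u c. pre_digraph.euler_trail (shape T) u c u)"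

definition edge_weight ::
    "('y \<Rightarrow> complex mat) \<Rightarrow> 'y test_graph \<Rightarrow> (nat \<Rightarrow> nat) \<Rightarrow> complex" where
  "edge_weight A T \<phi> =
     (\<Prod>e\<in>arcs (shape T).
        letter_mat A (lbl T e) $$ (\<phi> (tail (shape T) e), \<phi> (head (shape T) e)))"

definition traffic :: "nat \<Rightarrow> ('y \<Rightarrow> complex mat) \<Rightarrow> 'y test_graph \<Rightarrow> complex" where
  "traffic N A T = 1 / of_nat N * (\<Sum>\<phi>\<in>verts (shape T) \<rightarrow>\<^sub>E {..<N}. edge_weight A T \<phi>)"

definition inj_traffic :: "nat \<Rightarrow> ('y \<Rightarrow> complex mat) \<Rightarrow> 'y test_graph \<Rightarrow> complex" where
  "inj_traffic N A T =
     1 / of_nat N *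
     (\<Sum>\<phi>\<in>{\<phi> \<in> verts (shape T) \<rightarrow>\<^sub>E {..<N}. inj_on \<phi> (verts (shape T))}. edge_weight A T \<phi>)"

definition mean_traffic ::
    "(nat \<Rightarrow> 'w measure) \<Rightarrow> ('y \<Rightarrow> 'w rmat) \<Rightarrow> 'y test_graph \<Rightarrow> nat \<Rightarrow> complex" where
  "mean_traffic M A T N = (\<integral>\<omega>. traffic N (\<lambda>y. A y N \<omega>) T \<partial>M N)"

definition mean_inj_traffic ::
    "(nat \<Rightarrow> 'w measure) \<Rightarrow> ('y \<Rightarrow> 'w rmat) \<Rightarrow> 'y test_graph \<Rightarrow> nat \<Rightarrow> complex" where
  "mean_inj_traffic M A T N = (\<integral>\<omega>. inj_traffic N (\<lambda>y. A y N \<omega>) T \<partial>M N)"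

definition mean_inj_traffic_prod ::
    "(nat \<Rightarrow> 'w measure) \<Rightarrow> ('y \<Rightarrow> 'w rmat) \<Rightarrow> 'y test_graph list \<Rightarrow> nat \<Rightarrow> complex" where
  "mean_inj_traffic_prod M A Ts N =
     (\<integral>\<omega>. (\<Prod>T\<leftarrow>Ts. inj_traffic N (\<lambda>y. A y N \<omega>) T) \<partial>M N)"

definition cutting_arc :: "('a, 'b) pre_digraph \<Rightarrow> 'b \<Rightarrow> bool" where
  "cutting_arc G e \<longleftrightarrow>
     e \<in> arcs G \<and> \<not> Digraph_Component.connected (pre_digraph.del_arc G e)"

definition two_edge_comps :: "('a, 'b) pre_digraph \<Rightarrow> ('a, 'b) pre_digraph set" where
  "two_edge_comps G =
     {H. pre_digraph.max_subgraph G
           (\<lambda>H. Digraph_Component.connected H \<and> (\<forall>e. \<not> cutting_arc H e)) H}"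

text \<open>
  Simple undirected graphs are symmetric digraphs, an undirected edge being a pair of opposite
  arcs. So the degree of a vertex is its out-degree.
\<close>

definition comp_tree :: "('a, 'b) pre_digraph \<Rightarrow> ('a, 'b) pre_digraph pair_pre_digraph" where
  "comp_tree G =
     \<lparr> pverts = two_edge_comps G,
       parcs = {(C, D). C \<in> two_edge_comps G \<and> D \<in> two_edge_comps G \<and> C \<noteq> D \<and>
                  (\<exists>e. cutting_arc G e \<and>
                     (tail G e \<in> verts C \<and> head G e \<in> verts D \<or>
                      tail G e \<in> verts D \<and> head G e \<in> verts C))} \<rparr>"

definition leaf_count :: "('a, 'b) pre_digraph \<Rightarrow> nat" where
  "leaf_count G =
     (if card (two_edge_comps G) = 1 then 2
      else card {C \<in> two_edge_comps G. out_degree (with_proj (comp_tree G)) C = 1})"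

definition traffic_convergence ::
    "(nat \<Rightarrow> 'w measure) \<Rightarrow> ('y \<Rightarrow> 'w rmat) \<Rightarrow> 'y set \<Rightarrow> bool" where
  "traffic_convergence M Y V \<longleftrightarrow>
     (\<forall>T. cyclic_in V T \<longrightarrow> convergent (mean_inj_traffic M Y T))"

definition traffic_concentration ::
    "(nat \<Rightarrow> 'w measure) \<Rightarrow> ('y \<Rightarrow> 'w rmat) \<Rightarrow> 'y set \<Rightarrow> bool" where
  "traffic_concentration M Y V \<longleftrightarrow>
     (\<forall>Ts. (\<forall>T\<in>set Ts. cyclic_in V T) \<longrightarrow>
        (\<lambda>N. mean_inj_traffic_prod M Y Ts N - (\<Prod>T\<leftarrow>Ts. mean_inj_traffic M Y T N)) \<longlonglongrightarrow> 0)"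

definition traffic_tightness ::
    "(nat \<Rightarrow> 'w measure) \<Rightarrow> ('y \<Rightarrow> 'w rmat) \<Rightarrow> 'y set \<Rightarrow> bool" where
  "traffic_tightness M Y V \<longleftrightarrow>
     (\<forall>Ts. (\<forall>T\<in>set Ts. test_graph_in V T) \<longrightarrow>
        (\<lambda>N. cmod (mean_inj_traffic_prod M Y Ts N))
          \<in> O(\<lambda>N. real N powr (\<Sum>T\<leftarrow>Ts. real (leaf_count (shape T)) / 2 - 1)))"

text \<open>
  A map \<open>fam\<close> from variables to indices partitions the variables into families.
\<close>

definition family_subgraph :: "('y \<Rightarrow> 'f) \<Rightarrow> 'y test_graph \<Rightarrow> 'f \<Rightarrow> (nat, nat) pre_digraph" where
  "family_subgraph fam T f =
     (let E = {e \<in> arcs (shape T). fam (fst (lbl T e)) = f} in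
      \<lparr> verts = tail (shape T) ` E \<union> head (shape T) ` E, arcs = E,
        tail = tail (shape T), head = head (shape T) \<rparr>)"

definition family_comps :: "('y \<Rightarrow> 'f) \<Rightarrow> 'y test_graph \<Rightarrow> (nat, nat) pre_digraph set" where
  "family_comps fam T =
     {H. \<exists>f. pre_digraph.max_subgraph (family_subgraph fam T f) Digraph_Component.connected H}"

definition shared_verts :: "('y \<Rightarrow> 'f) \<Rightarrow> 'y test_graph \<Rightarrow> nat set" where
  "shared_verts fam T =
     {v. \<exists>H\<in>family_comps fam T. \<exists>H'\<in>family_comps fam T.
           H \<noteq> H' \<and> v \<in> verts H \<and> v \<in> verts H'}"

definition reduced_graph ::
    "('y \<Rightarrow> 'f) \<Rightarrow> 'y test_graph \<Rightarrow> ((nat, nat) pre_digraph + nat) pair_pre_digraph" where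
  "reduced_graph fam T =
     (let E = {(Inl H, Inr v) | H v.
                 H \<in> family_comps fam T \<and> v \<in> shared_verts fam T \<and> v \<in> verts H} in
      \<lparr> pverts = Inl ` family_comps fam T \<union> Inr ` shared_verts fam T,
        parcs = E \<union> E\<inverse> \<rparr>)"

text \<open>
  The constant \<open>Digraph_Component.tree\<close> forbids directed cycles, in particular the
  walk \<open>a, b, a\<close> along an edge of a symmetric digraph. The cycles of a simple undirected graph are
  the directed cycles of length at least three.
\<close>

definition undirected_tree :: "'a pair_pre_digraph \<Rightarrow> bool" where
  "undirected_tree G \<longleftrightarrow>
     Digraph_Component.connected (with_proj G) \<and>
     \<not> (\<exists>c. pre_digraph.cycle (with_proj G) c \<and> 3 \<le> length c)"

text \<open>A connected graph without arcs is a single vertex, and then the reduced graph is empty.\<close>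

definition free_product :: "('y \<Rightarrow> 'f) \<Rightarrow> 'y test_graph \<Rightarrow> bool" where
  "free_product fam T \<longleftrightarrow> arcs (shape T) = {} \<or> undirected_tree (reduced_graph fam T)"

definition asymp_traffic_free ::
    "(nat \<Rightarrow> 'w measure) \<Rightarrow> ('y \<Rightarrow> 'w rmat) \<Rightarrow> 'y set \<Rightarrow> ('y \<Rightarrow> 'f) \<Rightarrow> bool" where
  "asymp_traffic_free M A V fam \<longleftrightarrow>
     (\<forall>T. cyclic_in V T \<longrightarrow>
        convergent (mean_inj_traffic M A T) \<and>
        lim (mean_inj_traffic M A T) =
          (if free_product fam T
           then \<Prod>H\<in>family_comps fam T. lim (mean_inj_traffic M A (T\<lparr>shape := H\<rparr>))
           else 0))"

definition heavy_wigner_model ::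
    "nat \<Rightarrow> nat \<Rightarrow> (nat \<Rightarrow> nat \<Rightarrow> real) \<Rightarrow> (nat \<Rightarrow> 'w measure) \<Rightarrow>
     (nat \<Rightarrow> 'w rmat) \<Rightarrow> (nat \<Rightarrow> 'w rmat) \<Rightarrow> bool" where
  "heavy_wigner_model p q a M X Y \<longleftrightarrow>
     (\<forall>N>0. prob_space (M N)) \<and>
     (\<forall>j<p. heavy_wigner M (X j) (a j)) \<and>
     (\<forall>N>0. prob_space.indep_vars (M N) (\<lambda>_. PiM ({..<N} \<times> {..<N}) (\<lambda>_. borel))
               (\<lambda>j \<omega>. matrix_entries N (X j N \<omega>)) {..<p}) \<and>
     (\<forall>l<q. random_matrix M (Y l)) \<and>
     (\<forall>N>0. prob_space.indep_var (M N)
               (PiM ({..<p} \<times> {..<N} \<times> {..<N}) (\<lambda>_. borel))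
               (\<lambda>\<omega>. family_entries p N (\<lambda>j. X j N \<omega>))
               (PiM ({..<q} \<times> {..<N} \<times> {..<N}) (\<lambda>_. borel))
               (\<lambda>\<omega>. family_entries q N (\<lambda>l. Y l N \<omega>))) \<and>
     traffic_convergence M Y {..<q} \<and>
     traffic_concentration M Y {..<q} \<and>
     traffic_tightness M Y {..<q}"

text \<open>
  The joint family \<open>case_sum X Y\<close> has the variables \<open>Inl j\<close> for \<open>X j\<close> and \<open>Inr l\<close> for \<open>Y l\<close>. Each
  \<open>X j\<close> is a family by itself, numbered \<open>j\<close>, and the variables of \<open>Y\<close> together form family \<open>p\<close>.
\<close>

definition joint_vars :: "nat \<Rightarrow> nat \<Rightarrow> (nat + nat) set" where
  "joint_vars p q = {..<p} <+> {..<q}"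

definition joint_fam :: "nat \<Rightarrow> nat + nat \<Rightarrow> nat" where
  "joint_fam p = case_sum (\<lambda>j. j) (\<lambda>_. p)"

end

theory Submission
  imports Defs
begin

text \<open>
  Group the arcs carrying a heavy Wigner variable by variable and unordered pair of end points. For
  injective labellings these groups see independent entries, and the expectation of a group does not
  depend on the labelling, since the law of the entries is invariant under conjugation; it is
  \<open>O(1 / N)\<close>, and \<open>N\<close> times it tends to \<open>a k\<close> if the group has \<open>k\<close> arcs in each direction. With \<open>g\<close>
  groups there remains \<open>N powr (- 1 - g)\<close> times the expectation of a sum over injective labellings of
  the \<open>n\<close> components left when these arcs are deleted.

  The product of the injective sums of the single components is the sum over all labellings that are
  injective on each component, hence a sum of injective sums over quotients gluing vertices of
  different components. A quotient has fewer components and the same \<open>g\<close>, so by induction on the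
  number of vertices it is enough to treat the product. Always \<open>n \<le> g + 1\<close>. If \<open>n = g + 1\<close>, then all groups are
  bridges, so by balance each has as many arcs in both directions and the components are cyclic;
  concentration gives the limit. If \<open>n \<le> g\<close>, then by balance every leaf of a component meets a group
  that is not a bridge; thus the leaf counts add up to at most \<open>2 g\<close> and tightness gives the limit \<open>0\<close>.

  Counting edges in the reduced graph, \<open>n = g + 1\<close> holds iff the reduced graph is a tree and the
  same equality holds for every component of a heavy Wigner variable. This is traffic-freeness.
\<close>

section \<open>Components, bridges and balance\<close>

text \<open>Convergence and concentration are given for cyclic graphs only, whereas the graphs left
  after deleting the heavy Wigner arcs need not be cyclic. There only tightness is available, and
  its bound may grow with \<open>N\<close>. So the leaf count has to be sharp: as soon as cyclicity
  can fail, the bound must gain a factor \<open>1 / N\<close>. Tightness and concentration speak of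
  products of injective traffics of connected graphs, which is why the injective sum of a
  disconnected graph is traded for such a product.

  The invariant behind all cut arguments is balance: as many arcs leave a vertex as enter it. For
  finite connected graphs it is equivalent to being cyclic, it can be summed over a set of vertices,
  and it survives the identification of vertices.

  The bound \<open>2 g\<close> has two sources. A component touched by no non-bridge group has leaf
  count at most 2; in any other component the leaf count is at most the number of ends of such
  groups in it. The untouched components are paid for by the bridges, which are at least as
  many.\<close>

definition conn :: "('b \<Rightarrow> 'a) \<Rightarrow> ('b \<Rightarrow> 'a) \<Rightarrow> 'b set \<Rightarrow> 'a rel" where
  "conn t h B = (\<Union>e\<in>B. {(t e, h e), (h e, t e)})\<^sup>*"

text \<open>Since \<open>V\<close> is given separately from \<open>B\<close>, a vertex without arcs
  is a component of its own. Such vertices enter the number of components of the \<open>Y\<close>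
  arcs.\<close>

definition comps :: "('b \<Rightarrow> 'a) \<Rightarrow> ('b \<Rightarrow> 'a) \<Rightarrow> 'a set \<Rightarrow> 'b set \<Rightarrow> 'a set set" where
  "comps t h V B = (\<lambda>v. conn t h B `` {v}) ` V"

lemma conn_refl [simp, intro]: "(x, x) \<in> conn t h B"
  by (simp add: conn_def)

lemma conn_sym: "(x, y) \<in> conn t h B \<Longrightarrow> (y, x) \<in> conn t h B"
proof -
  have "sym (conn t h B)"
    unfolding conn_def by (intro sym_rtrancl) (auto simp: sym_def)
  then show "(x, y) \<in> conn t h B \<Longrightarrow> (y, x) \<in> conn t h B"
    by (auto dest: symD)
qed

lemma conn_trans: "(x, y) \<in> conn t h B \<Longrightarrow> (y, z) \<in> conn t h B \<Longrightarrow> (x, z) \<in> conn t h B"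
  unfolding conn_def by (rule rtrancl_trans)

lemma conn_arc: "e \<in> B \<Longrightarrow> (t e, h e) \<in> conn t h B"
  unfolding conn_def by (rule r_into_rtrancl) auto

lemma conn_mono: "B \<subseteq> B' \<Longrightarrow> (x, y) \<in> conn t h B \<Longrightarrow> (x, y) \<in> conn t h B'"
  unfolding conn_def by (erule rtrancl_mono[THEN subsetD, rotated]) auto

text \<open>Stated with a map \<open>f\<close> so that it serves both for changing the arc set
  (\<open>f = id\<close>) and for passing to a quotient graph.\<close>

lemma conn_least:
  assumes "\<And>e. e \<in> B \<Longrightarrow> (f (t e), f (h e)) \<in> conn t' h' B'" and "(x, y) \<in> conn t h B"
  shows "(f x, f y) \<in> conn t' h' B'"
  using assms(2) unfolding conn_def[of t h]
proof (induction rule: rtrancl_induct)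
  case (step y z)
  then have "(f y, f z) \<in> conn t' h' B'"
    using assms(1) conn_sym by fastforce
  then show ?case
    using step.IH conn_trans by metis
qed simp

text \<open>The tool for proving that vertices are not joined, or that a property spreads along
  paths: it suffices to find a set that no arc crosses.\<close>

lemma conn_closed:
  assumes "\<And>e. e \<in> B \<Longrightarrow> t e \<in> S \<longleftrightarrow> h e \<in> S" and "(x, y) \<in> conn t h B"
  shows "x \<in> S \<longleftrightarrow> y \<in> S"
  using assms(2) unfolding conn_def
  by (induction rule: rtrancl_induct) (use assms(1) in auto)

lemma conn_empty: "(x, y) \<in> conn t h {} \<longleftrightarrow> x = y"
  by (simp add: conn_def)

lemma conn_in_verts:
  assumes "t ` B \<union> h ` B \<subseteq> V" "(x, y) \<in> conn t h B" "x \<in> V"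
  shows "y \<in> V"
  using conn_closed[of B t V h x y] assms by blast

lemma conn_insert_redundant:
  assumes "(t e, h e) \<in> conn t h B"
  shows "conn t h (insert e B) = conn t h B"
proof -
  have "(x, y) \<in> conn t h B" if "(x, y) \<in> conn t h (insert e B)" for x y
    using conn_least[of "insert e B" id t h t h B x y] that assms conn_arc[of _ B t h] by auto
  moreover have "(x, y) \<in> conn t h (insert e B)" if "(x, y) \<in> conn t h B" for x y
    using that by (rule conn_mono[rotated]) auto
  ultimately show ?thesis by auto
qed

lemma conn_insert:
  "(x, y) \<in> conn t h (insert e B) \<longleftrightarrow>
    (x, y) \<in> conn t h B \<or> (x, t e) \<in> conn t h B \<and> (h e, y) \<in> conn t h B \<or>
    (x, h e) \<in> conn t h B \<and> (t e, y) \<in> conn t h B" (is "?L \<longleftrightarrow> ?R")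
proof
  assume ?L
  then show ?R unfolding conn_def[of t h "insert e B"]
  proof (induction rule: rtrancl_induct)
    case (step y z)
    from step.hyps(2) consider "(y, z) \<in> conn t h B" | "y = t e" "z = h e" | "y = h e" "z = t e"
      using conn_arc[of _ B t h] conn_sym by fastforce
    then show ?case
      using step.IH by cases (metis conn_trans, metis conn_refl, metis conn_refl)
  qed simp
next
  assume ?R
  have *: "(u, v) \<in> conn t h (insert e B)" if "(u, v) \<in> conn t h B" for u v
    using that by (rule conn_mono[rotated]) auto
  have e: "(t e, h e) \<in> conn t h (insert e B)" "(h e, t e) \<in> conn t h (insert e B)"
    using conn_arc[of e "insert e B" t h] by (simp_all add: conn_sym)
  from \<open>?R\<close> show ?L
  proof (elim disjE conjE)
    show ?L if "(x, t e) \<in> conn t h B" "(h e, y) \<in> conn t h B"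
      using conn_trans[OF conn_trans[OF *[OF that(1)] e(1)] *[OF that(2)]] .
    show ?L if "(x, h e) \<in> conn t h B" "(t e, y) \<in> conn t h B"
      using conn_trans[OF conn_trans[OF *[OF that(1)] e(2)] *[OF that(2)]] .
  qed (rule *)
qed

lemma conn_class_eq: "conn t h B `` {x} = conn t h B `` {y} \<longleftrightarrow> (x, y) \<in> conn t h B"
  (is "?X = ?Y \<longleftrightarrow> _")
proof
  assume "?X = ?Y"
  moreover have "y \<in> ?Y" by simp
  ultimately show "(x, y) \<in> conn t h B" by blast
next
  assume "(x, y) \<in> conn t h B"
  then show "?X = ?Y"
    using conn_trans[of x y t h B] conn_trans[of y x t h B] conn_sym[of x y t h B] by blast
qed

lemma finite_comps [simp]: "finite V \<Longrightarrow> finite (comps t h V B)"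
  by (simp add: comps_def)

lemma comps_subset:
  assumes "t ` B \<union> h ` B \<subseteq> V" "C \<in> comps t h V B"
  shows "C \<subseteq> V"
  using conn_in_verts[OF assms(1)] assms(2) by (auto simp: comps_def)

lemma comps_nonempty: "C \<in> comps t h V B \<Longrightarrow> C \<noteq> {}"
  by (auto simp: comps_def)

lemma comps_eq_class: "C \<in> comps t h V B \<Longrightarrow> x \<in> C \<Longrightarrow> C = conn t h B `` {x}"
  by (auto simp: comps_def intro: conn_sym conn_trans)

lemma comps_disjoint: "disjoint (comps t h V B)"
proof (rule disjointI)
  fix C D assume CD: "C \<in> comps t h V B" "D \<in> comps t h V B" "C \<noteq> D"
  show "C \<inter> D = {}"
  proof (rule ccontr)
    assume "C \<inter> D \<noteq> {}"
    then obtain x where "x \<in> C" "x \<in> D" by auto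
    then have "C = conn t h B `` {x}" "D = conn t h B `` {x}"
      using comps_eq_class CD by metis+
    then show False using CD(3) by simp
  qed
qed

lemma comps_Union: 
  assumes "t ` B \<union> h ` B \<subseteq> V"
  shows "\<Union>(comps t h V B) = V"
proof
  show "\<Union>(comps t h V B) \<subseteq> V"
    using comps_subset[OF assms] by blast
  show "V \<subseteq> \<Union>(comps t h V B)"
  proof
    fix v assume "v \<in> V"
    then have "conn t h B `` {v} \<in> comps t h V B" by (simp add: comps_def)
    moreover have "v \<in> conn t h B `` {v}" by simp
    ultimately show "v \<in> \<Union>(comps t h V B)" by blast
  qed
qed

lemma comps_arc_iff:
  assumes "C \<in> comps t h V B" "e \<in> B"
  shows "t e \<in> C \<longleftrightarrow> h e \<in> C"
proof -
  obtain v where C: "C = conn t h B `` {v}" using assms(1) by (auto simp: comps_def)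
  have e: "(t e, h e) \<in> conn t h B" by (rule conn_arc[OF assms(2)])
  show ?thesis
    using conn_trans[OF _ e, of v] conn_trans[OF _ conn_sym[OF e], of v] unfolding C by blast
qed

lemma sum_card_comps:
  assumes "finite V" "t ` B \<union> h ` B \<subseteq> V"
  shows "(\<Sum>C\<in>comps t h V B. card C) = card V"
proof -
  have "card (\<Union>(comps t h V B)) = (\<Sum>C\<in>comps t h V B. card C)"
  proof (rule card_Union_disjoint)
    show "finite C" if "C \<in> comps t h V B" for C
      using comps_subset[OF assms(2) that] assms(1) by (rule finite_subset)
  qed (rule comps_disjoint)
  then show ?thesis using comps_Union[OF assms(2)] by simp
qed

lemma comps_empty: "comps t h V {} = (\<lambda>v. {v}) ` V"
  unfolding comps_def by (intro image_cong refl) (auto simp: conn_empty)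

lemma comps_connected:
  assumes "t ` B \<union> h ` B \<subseteq> V" "V \<noteq> {}" "\<And>u v. u \<in> V \<Longrightarrow> v \<in> V \<Longrightarrow> (u, v) \<in> conn t h B"
  shows "comps t h V B = {V}"
proof -
  have "conn t h B `` {u} = V" if "u \<in> V" for u
    using assms(3)[OF that] conn_in_verts[OF assms(1) _ that] by blast
  then show ?thesis
    unfolding comps_def using assms(2) by (simp add: image_constant_conv cong: image_cong_simp)
qed

section \<open>Counting components when arcs are added\<close>

lemma card_comps_insert:
  assumes "finite V" "t e \<in> V" "h e \<in> V"
  shows "card (comps t h V B) =
    card (comps t h V (insert e B)) + (if (t e, h e) \<in> conn t h B then 0 else 1)"
proof (cases "(t e, h e) \<in> conn t h B")
  case True
  then show ?thesis by (simp add: comps_def conn_insert_redundant)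
next
  case False
  \<comment> \<open>Only the classes of the two ends change. They are replaced by their union, which
    is not an old class because it would have to equal both.\<close>
  define a where "a = conn t h B `` {t e}"
  define b where "b = conn t h B `` {h e}"
  have ne: "a \<noteq> b" using False by (simp add: a_def b_def conn_class_eq)
  have ab: "a \<in> comps t h V B" "b \<in> comps t h V B"
    using assms by (auto simp: a_def b_def comps_def)
  have self: "x \<in> conn t h B `` {x}" for x by simp
  have cb: "conn t h B `` {x} = a \<or> conn t h B `` {x} = b" if "x \<in> a \<union> b" for x
    using that comps_eq_class[OF ab(1), of x] comps_eq_class[OF ab(2), of x] by blast
  have ins: "conn t h (insert e B) `` {x} =
      conn t h B `` {x} \<union> (if (x, t e) \<in> conn t h B then b else {}) \<union>
      (if (x, h e) \<in> conn t h B then a else {})" for x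
    by (simp add: set_eq_iff conn_insert a_def b_def)
  have mem: "x \<in> a \<longleftrightarrow> (x, t e) \<in> conn t h B" "x \<in> b \<longleftrightarrow> (x, h e) \<in> conn t h B" for x
    using conn_sym[of x "t e" t h B] conn_sym[of "t e" x t h B]
      conn_sym[of x "h e" t h B] conn_sym[of "h e" x t h B]
    by (auto simp only: a_def b_def Image_singleton_iff)
  have cl: "conn t h (insert e B) `` {x} = (if x \<in> a \<union> b then a \<union> b else conn t h B `` {x})" for x
    using comps_eq_class[OF ab(1), of x] comps_eq_class[OF ab(2), of x]
    by (simp add: ins mem[symmetric]) blast
  have nab: "conn t h B `` {x} \<noteq> a \<and> conn t h B `` {x} \<noteq> b" if "x \<notin> a \<union> b" for x
    using that self[of x] by auto
  have "comps t h V (insert e B) = insert (a \<union> b) (comps t h V B - {a, b})"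
  proof (rule Set.set_eqI)
    fix C
    show "C \<in> comps t h V (insert e B) \<longleftrightarrow> C \<in> insert (a \<union> b) (comps t h V B - {a, b})"
    proof
      assume "C \<in> comps t h V (insert e B)"
      then obtain x where x: "x \<in> V" "C = conn t h (insert e B) `` {x}" by (auto simp: comps_def)
      show "C \<in> insert (a \<union> b) (comps t h V B - {a, b})"
        using x cl[of x] nab[of x] by (auto simp: comps_def split: if_splits)
    next
      assume "C \<in> insert (a \<union> b) (comps t h V B - {a, b})"
      then consider "C = a \<union> b" | x where "x \<in> V" "C = conn t h B `` {x}" "C \<noteq> a" "C \<noteq> b"
        by (auto simp: comps_def)
      then show "C \<in> comps t h V (insert e B)"
      proof cases
        case 1
        have "t e \<in> a \<union> b" by (simp add: a_def)
        then show ?thesis using 1 cl[of "t e"] assms by (auto simp: comps_def)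
      next
        case 2
        then have "x \<notin> a \<union> b" using cb by blast
        then show ?thesis using 2 cl[of x] by (auto simp: comps_def)
      qed
    qed
  qed
  moreover have "a \<union> b \<notin> comps t h V B"
  proof
    assume "a \<union> b \<in> comps t h V B"
    moreover have "t e \<in> a \<union> b" "h e \<in> a \<union> b" by (simp_all add: a_def b_def)
    ultimately have "a \<union> b = a" "a \<union> b = b"
      unfolding a_def b_def by (metis comps_eq_class)+
    then show False using ne by simp
  qed
  ultimately have "card (comps t h V (insert e B)) = Suc (card (comps t h V B - {a, b}))"
    using assms by simp
  moreover have "card (comps t h V B - {a, b}) = card (comps t h V B) - card {a, b}"
    using ab by (intro card_Diff_subset) auto
  moreover have "card {a, b} \<le> card (comps t h V B)"
    using ab assms by (intro card_mono) auto
  ultimately show ?thesis using ne False by simp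
qed

text \<open>Each added arc merges at most two components.\<close>

lemma card_comps_Un_le:
  assumes "finite V" "finite F" "t ` F \<union> h ` F \<subseteq> V"
  shows "card (comps t h V R) \<le> card (comps t h V (R \<union> F)) + card F"
  using assms(2,3)
proof (induction F rule: finite_induct)
  case (insert f F)
  have "card (comps t h V (R \<union> F)) \<le> card (comps t h V (insert f (R \<union> F))) + 1"
    using card_comps_insert[of V t f h "R \<union> F"] assms(1) insert.prems
    by (cases "(t f, h f) \<in> conn t h (R \<union> F)") simp_all
  moreover have "card (comps t h V R) \<le> card (comps t h V (R \<union> F)) + card F"
    using insert.IH insert.prems by blast
  ultimately show ?case using insert.hyps by simp
qed simp

text \<open>When the arcs of \<open>F\<close> are added to \<open>R\<close> one at a time, each
  merges two components, since its ends are not joined even by all the other arcs.\<close>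

lemma card_comps_independent:
  assumes "finite V" "finite F" "t ` F \<union> h ` F \<subseteq> V" "R \<inter> F = {}"
    and "\<And>f. f \<in> F \<Longrightarrow> (t f, h f) \<notin> conn t h (R \<union> F - {f})"
  shows "card (comps t h V R) = card (comps t h V (R \<union> F)) + card F"
  using assms(2-)
proof (induction F rule: finite_induct)
  case (insert f F)
  have "(t g, h g) \<notin> conn t h (R \<union> F - {g})" if "g \<in> F" for g
  proof
    assume "(t g, h g) \<in> conn t h (R \<union> F - {g})"
    then have "(t g, h g) \<in> conn t h (R \<union> insert f F - {g})"
      by (rule conn_mono[rotated]) auto
    then show False using insert.prems(3)[of g] that by simp
  qed
  then have "card (comps t h V R) = card (comps t h V (R \<union> F)) + card F"
    using insert.IH insert.prems by blast
  moreover have "R \<union> insert f F - {f} = R \<union> F" using insert.hyps insert.prems by blast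
  then have "(t f, h f) \<notin> conn t h (R \<union> F)" using insert.prems(3)[of f] by simp
  then have "card (comps t h V (R \<union> F)) = card (comps t h V (insert f (R \<union> F))) + 1"
    using card_comps_insert[of V t f h "R \<union> F"] assms(1) insert.prems by simp
  ultimately show ?case using insert.hyps by simp
qed simp

text \<open>An arc whose ends are joined by the others can be added last without merging anything,
  which leaves at most \<open>card F - 1\<close> mergers.\<close>

lemma independent_if_card_comps:
  assumes "finite V" "finite F" "t ` F \<union> h ` F \<subseteq> V" "R \<inter> F = {}"
    and "card (comps t h V R) = card (comps t h V (R \<union> F)) + card F" "f \<in> F"
  shows "(t f, h f) \<notin> conn t h (R \<union> F - {f})"
proof
  assume c: "(t f, h f) \<in> conn t h (R \<union> F - {f})"
  have eq: "insert f (R \<union> F - {f}) = R \<union> F" "R \<union> F - {f} = R \<union> (F - {f})" using assms by auto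
  have "conn t h (R \<union> F) = conn t h (R \<union> (F - {f}))"
    using conn_insert_redundant[OF c] eq by simp
  then have "card (comps t h V (R \<union> F)) = card (comps t h V (R \<union> (F - {f})))"
    by (simp add: comps_def)
  moreover have "card (comps t h V R) \<le> card (comps t h V (R \<union> (F - {f}))) + card (F - {f})"
    using assms by (intro card_comps_Un_le) auto
  moreover have "card (F - {f}) < card F" using assms by (intro card_Diff1_less) auto
  ultimately show False using assms by simp
qed

text \<open>The arcs of \<open>F\<close> that are not bridges of \<open>R \<union> F\<close>. Only
  arcs of \<open>F\<close> are tested; \<open>R\<close> is a fixed background, namely the
  \<open>Y\<close> arcs, or \<open>{}\<close> when the cutting arcs of a whole graph are
  wanted.\<close>

definition nonbridges :: "('b \<Rightarrow> 'a) \<Rightarrow> ('b \<Rightarrow> 'a) \<Rightarrow> 'b set \<Rightarrow> 'b set \<Rightarrow> 'b set" where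
  "nonbridges t h R F = {f \<in> F. (t f, h f) \<in> conn t h (R \<union> F - {f})}"

text \<open>The bridges are independent over \<open>R\<close> together with the nonbridges, so each
  of them accounts for one component.\<close>

lemma card_comps_nonbridges:
  assumes "finite V" "finite F" "t ` F \<union> h ` F \<subseteq> V" "R \<inter> F = {}"
  shows "card (comps t h V (R \<union> nonbridges t h R F)) =
    card (comps t h V (R \<union> F)) + card (F - nonbridges t h R F)"
proof -
  have "R \<union> nonbridges t h R F \<union> (F - nonbridges t h R F) = R \<union> F"
    by (auto simp: nonbridges_def)
  moreover have "card (comps t h V (R \<union> nonbridges t h R F)) =
      card (comps t h V (R \<union> nonbridges t h R F \<union> (F - nonbridges t h R F))) + card (F - nonbridges t h R F)"
  proof (rule card_comps_independent)
    show "(t f, h f) \<notin> conn t h (R \<union> nonbridges t h R F \<union> (F - nonbridges t h R F) - {f})"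
      if "f \<in> F - nonbridges t h R F" for f
      using that calculation by (simp add: nonbridges_def)
    show "(R \<union> nonbridges t h R F) \<inter> (F - nonbridges t h R F) = {}"
      using assms(4) by blast
  qed (use assms in auto)
  ultimately show ?thesis by simp
qed

text \<open>Deleting the bridges raises the number of components by their number, with or without \<open>f\<close>.\<close>

lemma nonbridge_stays:
  assumes "finite V" "finite F" "t ` F \<union> h ` F \<subseteq> V" "R \<inter> F = {}" "f \<in> nonbridges t h R F"
  shows "(t f, h f) \<in> conn t h (R \<union> (nonbridges t h R F - {f}))"
proof -
  let ?N = "nonbridges t h R F"
  have f: "f \<in> F" "(t f, h f) \<in> conn t h (R \<union> F - {f})" using assms(5) by (auto simp: nonbridges_def)
  have sub: "?N \<subseteq> F" by (auto simp: nonbridges_def)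
  have "card (comps t h V (R \<union> (?N - {f}))) \<le>
      card (comps t h V (R \<union> (?N - {f}) \<union> (F - ?N))) + card (F - ?N)"
    using assms by (intro card_comps_Un_le) auto
  also have "R \<union> (?N - {f}) \<union> (F - ?N) = R \<union> F - {f}"
    using assms(4,5) f sub by auto
  also have "card (comps t h V (R \<union> F - {f})) = card (comps t h V (R \<union> F))"
  proof -
    have "insert f (R \<union> F - {f}) = R \<union> F" using f by auto
    then have "conn t h (R \<union> F - {f}) = conn t h (R \<union> F)"
      using conn_insert_redundant[OF f(2)] by simp
    then show ?thesis by (simp add: comps_def)
  qed
  also have "\<dots> + card (F - ?N) = card (comps t h V (R \<union> ?N))"
    using card_comps_nonbridges[OF assms(1-4)] by simp
  also have "R \<union> ?N = insert f (R \<union> (?N - {f}))" using assms(5) by auto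
  finally have le: "card (comps t h V (R \<union> (?N - {f}))) \<le>
      card (comps t h V (insert f (R \<union> (?N - {f}))))" .
  have "t f \<in> V" "h f \<in> V" using assms(3) f by auto
  from card_comps_insert[of V t f h "R \<union> (?N - {f})", OF assms(1) this] le show ?thesis
    by (cases "(t f, h f) \<in> conn t h (R \<union> (?N - {f}))") simp_all
qed

section \<open>Balanced vertices and cuts\<close>

definition balanced_at :: "('b \<Rightarrow> 'a) \<Rightarrow> ('b \<Rightarrow> 'a) \<Rightarrow> 'b set \<Rightarrow> 'a \<Rightarrow> bool" where
  "balanced_at t h B v \<longleftrightarrow> card {e \<in> B. t e = v} = card {e \<in> B. h e = v}"

lemma card_vimage_sum:
  assumes "finite B" "finite S"
  shows "card {e \<in> B. t e \<in> S} = (\<Sum>v\<in>S. card {e \<in> B. t e = v})"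
proof -
  have "{e \<in> B. t e \<in> S} = (\<Union>v\<in>S. {e \<in> B. t e = v})" by auto
  then show ?thesis using assms by (simp only:) (intro card_UN_disjoint, auto)
qed

text \<open>Sum the balance over \<open>S\<close> and cancel the arcs inside
  \<open>S\<close>.\<close>

lemma cut_balance:
  assumes "finite B" "finite S" "\<And>v. v \<in> S \<Longrightarrow> balanced_at t h B v"
  shows "card {e \<in> B. t e \<in> S \<and> h e \<notin> S} = card {e \<in> B. h e \<in> S \<and> t e \<notin> S}"
proof -
  have split: "card {e \<in> B. t e \<in> S} = card {e \<in> B. t e \<in> S \<and> h e \<in> S} + card {e \<in> B. t e \<in> S \<and> h e \<notin> S}"
    for t h :: "'a \<Rightarrow> 'b"
    using assms(1) by (subst card_Un_disjoint[symmetric]) (auto intro: arg_cong[where f=card])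
  have "card {e \<in> B. t e \<in> S} = card {e \<in> B. h e \<in> S}"
    using card_vimage_sum[OF assms(1,2)] assms(3) by (simp add: balanced_at_def)
  moreover have "{e \<in> B. h e \<in> S \<and> t e \<in> S} = {e \<in> B. t e \<in> S \<and> h e \<in> S}" by auto
  ultimately show ?thesis using split[of t h] split[of h t] by simp
qed

section \<open>Components as subgraphs of digraphs\<close>

abbreviation gconn :: "('a, 'b) pre_digraph \<Rightarrow> 'b set \<Rightarrow> 'a rel" where
  "gconn G \<equiv> conn (tail G) (head G)"

abbreviation gcomps :: "('a, 'b) pre_digraph \<Rightarrow> 'b set \<Rightarrow> 'a set set" where
  "gcomps G \<equiv> comps (tail G) (head G) (verts G)"

text \<open>Testing the tail is enough, since for a component of \<open>B\<close> the head lies in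
  the same class. The end maps of \<open>G\<close> are kept unchanged, so that maximal subgraphs are
  equal to these graphs as records.\<close>

definition comp_graph :: "('a, 'b) pre_digraph \<Rightarrow> 'b set \<Rightarrow> 'a set \<Rightarrow> ('a, 'b) pre_digraph" where
  "comp_graph G B C = \<lparr>verts = C, arcs = {e \<in> B. tail G e \<in> C}, tail = tail G, head = head G\<rparr>"

lemma comp_graph_simps [simp]:
  "verts (comp_graph G B C) = C" "arcs (comp_graph G B C) = {e \<in> B. tail G e \<in> C}"
  "tail (comp_graph G B C) = tail G" "head (comp_graph G B C) = head G"
  by (simp_all add: comp_graph_def)

text \<open>\<open>Digraph_Component.connected\<close> is strong connectedness of the symmetric
  closure, with paths confined to the vertex set. All arcs end in the vertex set, so the confinement
  changes nothing for paths that start there.\<close>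

lemma connected_iff_conn:
  assumes "wf_digraph G"
  shows "Digraph_Component.connected G \<longleftrightarrow>
    verts G \<noteq> {} \<and> (\<forall>u\<in>verts G. \<forall>v\<in>verts G. (u, v) \<in> gconn G (arcs G))"
proof -
  interpret wf_digraph G by fact
  let ?R = "\<Union>e\<in>arcs G. {(tail G e, head G e), (head G e, tail G e)}"
  have ends: "arcs_ends (with_proj (mk_symmetric G)) = ?R"
    by (simp add: mk_symmetric_def arcs_ends_def arc_to_ends_def)
  have R: "?R \<subseteq> verts G \<times> verts G" by auto
  have "(u, v) \<in> rtrancl_on (verts G) ?R \<longleftrightarrow> (u, v) \<in> ?R\<^sup>*" if "u \<in> verts G" for u v
  proof
    assume "(u, v) \<in> rtrancl_on (verts G) ?R"
    then show "(u, v) \<in> ?R\<^sup>*" by (rule rtrancl_on_rtranclI)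
  next
    assume "(u, v) \<in> ?R\<^sup>*"
    then show "(u, v) \<in> rtrancl_on (verts G) ?R"
    proof (induction rule: rtrancl_induct)
      case base
      show ?case using that by (rule rtrancl_on_refl)
    next
      case (step y z)
      have "y \<in> verts G" "z \<in> verts G" using R step.hyps(2) by blast+
      then show ?case using step by (blast intro: rtrancl_on_into_rtrancl_on)
    qed
  qed
  moreover have "verts (with_proj (mk_symmetric G)) = verts G"
    by (simp add: mk_symmetric_def)
  ultimately show ?thesis
    unfolding Digraph_Component.connected_def strongly_connected_def reachable_def ends conn_def
    by auto
qed

lemma wf_ends_subset: "wf_digraph G \<Longrightarrow> B \<subseteq> arcs G \<Longrightarrow> tail G ` B \<union> head G ` B \<subseteq> verts G"
  by (auto dest: wf_digraph.wellformed)

lemma conn_restrict: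
  assumes "(x, y) \<in> conn t h B" "x \<in> C" "\<And>e. e \<in> B \<Longrightarrow> t e \<in> C \<longleftrightarrow> h e \<in> C"
  shows "(x, y) \<in> conn t h {e \<in> B. t e \<in> C}"
proof -
  have "(x, y) \<in> conn t h {e \<in> B. t e \<in> C} \<and> y \<in> C"
    using assms(1) unfolding conn_def[of t h B]
  proof (induction rule: rtrancl_induct)
    case base
    show ?case using assms(2) by simp
  next
    case (step y z)
    from step.hyps(2) obtain e where e: "e \<in> B" "(y, z) = (t e, h e) \<or> (y, z) = (h e, t e)"
      by auto
    with step.IH assms(3)[OF e(1)] have "t e \<in> C" "z \<in> C" by auto
    with e have "(y, z) \<in> conn t h {e \<in> B. t e \<in> C}"
      using conn_arc[of e "{e \<in> B. t e \<in> C}" t h] conn_sym[of "t e" "h e" t h] by auto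
    then show ?case using conn_trans[OF conjunct1[OF step.IH]] \<open>z \<in> C\<close> by blast
  qed
  then show ?thesis ..
qed

lemma wf_comp_graph:
  assumes "wf_digraph G" "B \<subseteq> arcs G" "C \<in> gcomps G B"
  shows "wf_digraph (comp_graph G B C)"
  using comps_arc_iff[OF assms(3)] by unfold_locales auto

lemma fin_comp_graph:
  assumes "fin_digraph G" "B \<subseteq> arcs G" "C \<in> gcomps G B"
  shows "fin_digraph (comp_graph G B C)"
proof -
  interpret fin_digraph G by fact
  interpret C: wf_digraph "comp_graph G B C"
    using assms wf_digraph_axioms by (intro wf_comp_graph) auto
  show ?thesis
    using comps_subset[OF wf_ends_subset[OF wf_digraph_axioms assms(2)] assms(3)]
      finite_subset[OF assms(2)] finite_arcs finite_verts
    by unfold_locales (auto intro: finite_subset)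
qed

lemma connected_comp_graph:
  assumes "wf_digraph G" "B \<subseteq> arcs G" "C \<in> gcomps G B"
  shows "Digraph_Component.connected (comp_graph G B C)"
  unfolding connected_iff_conn[OF wf_comp_graph[OF assms]] comp_graph_simps
proof (intro conjI ballI)
  show "C \<noteq> {}" using comps_nonempty[OF assms(3)] .
  fix u v assume uv: "u \<in> C" "v \<in> C"
  then have "(u, v) \<in> gconn G B"
    using comps_eq_class[OF assms(3) uv(1)] by blast
  then show "(u, v) \<in> gconn G {e \<in> B. tail G e \<in> C}"
    using uv(1) comps_arc_iff[OF assms(3)] by (rule conn_restrict)
qed

lemma subgraph_comp_graph:
  assumes "wf_digraph G" "B \<subseteq> arcs G" "C \<in> gcomps G B"
  shows "subgraph (comp_graph G B C) G"
  using comps_subset[OF wf_ends_subset[OF assms(1,2)] assms(3)] wf_comp_graph[OF assms] assms(1,2)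
  by (auto simp: subgraph_def compatible_def)

lemma subgraph_some_comp_graph:
  assumes "wf_digraph G" "B \<subseteq> arcs G" "subgraph H G" "Digraph_Component.connected H" "arcs H \<subseteq> B"
  shows "\<exists>C\<in>gcomps G B. subgraph H (comp_graph G B C)"
proof -
  have H: "wf_digraph H" "tail H = tail G" "head H = head G" "verts H \<subseteq> verts G"
    using assms(3) by (auto simp: subgraph_def compatible_def)
  obtain u where u: "u \<in> verts H" using assms(4) connected_iff_conn[OF H(1)] by auto
  let ?C = "gconn G B `` {u}"
  have C: "?C \<in> gcomps G B" using u H(4) by (auto simp: comps_def)
  have "verts H \<subseteq> ?C"
  proof
    fix v assume "v \<in> verts H"
    then have "(u, v) \<in> gconn G (arcs H)"
      using assms(4) u connected_iff_conn[OF H(1)] H by auto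
    then have "(u, v) \<in> gconn G B" using assms(5) by (rule conn_mono[rotated])
    then show "v \<in> ?C" by blast
  qed
  moreover have "arcs H \<subseteq> {e \<in> B. tail G e \<in> ?C}"
  proof
    fix e assume e: "e \<in> arcs H"
    then have "tail G e \<in> verts H" using wf_digraph.tail_in_verts[OF H(1), of e] H(2) by simp
    with e assms(5) \<open>verts H \<subseteq> ?C\<close> show "e \<in> {e \<in> B. tail G e \<in> ?C}" by blast
  qed
  ultimately have "subgraph H (comp_graph G B ?C)"
    using H wf_comp_graph[OF assms(1,2) C] by (simp add: subgraph_def compatible_def)
  with C show ?thesis by blast
qed

text \<open>Used for connectedness and for connectedness without cutting arcs. Every subgraph with
  \<open>P\<close> lies in one component graph, and the component graphs have \<open>P\<close>; two
  nested ones share a vertex and so coincide.\<close>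

lemma max_subgraph_comps:
  assumes wf: "wf_digraph G" and B: "B \<subseteq> arcs G"
    and P: "\<And>C. C \<in> gcomps G B \<Longrightarrow> P (comp_graph G B C)"
    and sub: "\<And>H. subgraph H G \<Longrightarrow> P H \<Longrightarrow> Digraph_Component.connected H \<and> arcs H \<subseteq> B"
  shows "{H. pre_digraph.max_subgraph G P H} = comp_graph G B ` gcomps G B"
proof (intro Set.set_eqI iffI)
  fix H assume "H \<in> {H. pre_digraph.max_subgraph G P H}"
  then have H: "subgraph H G" "P H" and
    max: "\<And>H'. H' \<noteq> H \<Longrightarrow> subgraph H H' \<Longrightarrow> \<not> (subgraph H' G \<and> P H')"
    by (auto simp: pre_digraph.max_subgraph_def)
  obtain C where C: "C \<in> gcomps G B" "subgraph H (comp_graph G B C)"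
    using subgraph_some_comp_graph[OF wf B H(1)] sub[OF H] by blast
  have "comp_graph G B C = H"
    using max[OF _ C(2)] P[OF C(1)] subgraph_comp_graph[OF wf B C(1)] by blast
  with C show "H \<in> comp_graph G B ` gcomps G B" by blast
next
  fix H assume "H \<in> comp_graph G B ` gcomps G B"
  then obtain C where C: "C \<in> gcomps G B" and H: "H = comp_graph G B C" by blast
  have "\<not> (subgraph H' G \<and> P H')" if H': "H' \<noteq> H" "subgraph H H'" for H'
  proof
    assume *: "subgraph H' G \<and> P H'"
    then obtain D where D: "D \<in> gcomps G B" "subgraph H' (comp_graph G B D)"
      using subgraph_some_comp_graph[OF wf B, of H'] sub[of H'] by blast
    have s1: "verts H \<subseteq> verts H'" "arcs H \<subseteq> arcs H'" "tail H' = tail H" "head H' = head H"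
      using H'(2) by (auto simp: subgraph_def compatible_def)
    have s2: "verts H' \<subseteq> D" "arcs H' \<subseteq> {e \<in> B. tail G e \<in> D}"
      using D(2) by (auto simp: subgraph_def compatible_def)
    have "C \<subseteq> D" using s1 s2 H by auto
    moreover obtain x where "x \<in> C" using comps_nonempty[OF C] by blast
    ultimately have "C = D"
      using comps_eq_class[OF C] comps_eq_class[OF D(1)] by blast
    then have "H' = H" using s1 s2 H by (intro pre_digraph.equality) auto
    with H'(1) show False by simp
  qed
  then show "H \<in> {H. pre_digraph.max_subgraph G P H}"
    using subgraph_comp_graph[OF wf B C] P[OF C] H by (auto simp: pre_digraph.max_subgraph_def)
qed

lemma max_connected_subgraphs:
  assumes "wf_digraph G"
  shows "{H. pre_digraph.max_subgraph G Digraph_Component.connected H} =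
    comp_graph G (arcs G) ` gcomps G (arcs G)"
  using assms by (intro max_subgraph_comps connected_comp_graph) (auto simp: subgraph_def)

section \<open>Cutting arcs, two-edge connected components and leaves\<close>

lemma cutting_arc_iff:
  assumes "wf_digraph G" "Digraph_Component.connected G"
  shows "cutting_arc G e \<longleftrightarrow> e \<in> arcs G \<and> (tail G e, head G e) \<notin> gconn G (arcs G - {e})"
proof (cases "e \<in> arcs G")
  case True
  interpret wf_digraph G by fact
  have wf: "wf_digraph (del_arc e)" by (rule wf_digraph_del_arc)
  have "Digraph_Component.connected (del_arc e) \<longleftrightarrow>
      (\<forall>u\<in>verts G. \<forall>v\<in>verts G. (u, v) \<in> gconn G (arcs G - {e}))"
    using assms(2) unfolding connected_iff_conn[OF wf] connected_iff_conn[OF assms(1)]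
    by (simp add: del_arc_def)
  also have "\<dots> \<longleftrightarrow> (tail G e, head G e) \<in> gconn G (arcs G - {e})"
  proof
    assume c: "(tail G e, head G e) \<in> gconn G (arcs G - {e})"
    have "gconn G (arcs G) = gconn G (arcs G - {e})"
      using conn_insert_redundant[OF c] True by (simp add: insert_absorb)
    then show "\<forall>u\<in>verts G. \<forall>v\<in>verts G. (u, v) \<in> gconn G (arcs G - {e})"
      using assms(2) connected_iff_conn[OF assms(1)] by simp
  qed (use True in auto)
  finally show ?thesis using True by (simp add: cutting_arc_def)
qed (simp add: cutting_arc_def)

lemma cutting_arc_iff_nonbridge:
  assumes "wf_digraph G" "Digraph_Component.connected G"
  shows "cutting_arc G e \<longleftrightarrow> e \<in> arcs G - nonbridges (tail G) (head G) {} (arcs G)"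
  by (auto simp: cutting_arc_iff[OF assms] nonbridges_def)

text \<open>Deleting all bridges at once creates no new ones (\<open>nonbridge_stays\<close>), so a
  component of the nonbridges has no cutting arc. Conversely, an arc that is not cutting in a
  connected subgraph cannot be a bridge of \<open>G\<close>.\<close>

lemma two_edge_comps_eq:
  assumes "fin_digraph G" "Digraph_Component.connected G"
  defines "N \<equiv> nonbridges (tail G) (head G) {} (arcs G)"
  shows "two_edge_comps G = comp_graph G N ` gcomps G N"
  unfolding two_edge_comps_def
proof (rule max_subgraph_comps)
  interpret fin_digraph G by fact
  show wf: "wf_digraph G" ..
  show N: "N \<subseteq> arcs G" by (auto simp: N_def nonbridges_def)
  show "Digraph_Component.connected (comp_graph G N C) \<and> (\<forall>e. \<not> cutting_arc (comp_graph G N C) e)"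
    if C: "C \<in> gcomps G N" for C
  proof (intro conjI allI)
    show con: "Digraph_Component.connected (comp_graph G N C)"
      by (rule connected_comp_graph[OF wf N C])
    fix e
    show "\<not> cutting_arc (comp_graph G N C) e"
    proof
      assume "cutting_arc (comp_graph G N C) e"
      then have e: "e \<in> N" "tail G e \<in> C"
        "(tail G e, head G e) \<notin> gconn G ({e \<in> N. tail G e \<in> C} - {e})"
        by (auto simp: cutting_arc_iff[OF wf_comp_graph[OF wf N C] con])
      have "(tail G e, head G e) \<in> gconn G ({} \<union> (N - {e}))"
        unfolding N_def by (rule nonbridge_stays[of "verts G"]) (use e(1) N_def in auto)
      then have "(tail G e, head G e) \<in> gconn G (N - {e})" by simp
      then have "(tail G e, head G e) \<in> gconn G {e' \<in> N - {e}. tail G e' \<in> C}"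
        by (rule conn_restrict) (use e(2) comps_arc_iff[OF C] in auto)
      moreover have "{e' \<in> N - {e}. tail G e' \<in> C} = {e \<in> N. tail G e \<in> C} - {e}" by auto
      ultimately show False using e(3) by simp
    qed
  qed
  show "Digraph_Component.connected H \<and> arcs H \<subseteq> N"
    if H: "subgraph H G" and P: "Digraph_Component.connected H \<and> (\<forall>e. \<not> cutting_arc H e)" for H
  proof (intro conjI subsetI)
    show "Digraph_Component.connected H" using P by simp
    have Hs: "wf_digraph H" "tail H = tail G" "head H = head G" "arcs H \<subseteq> arcs G"
      using H by (auto simp: subgraph_def compatible_def)
    fix e assume e: "e \<in> arcs H"
    then have "(tail G e, head G e) \<in> gconn G (arcs H - {e})"
      using P cutting_arc_iff[OF Hs(1), of e] Hs by auto
    then have "(tail G e, head G e) \<in> gconn G (arcs G - {e})"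
      by (rule conn_mono[rotated]) (use Hs in auto)
    then show "e \<in> N" using e Hs by (auto simp: N_def nonbridges_def)
  qed
qed

text \<open>
  Two cutting arcs between the same components would not be cutting, so a leaf is left by one arc only.
\<close>

lemma leaf_count_le:
  assumes "fin_digraph G" "Digraph_Component.connected G" "finite S"
    and touch: "\<And>C e. C \<subseteq> verts G \<Longrightarrow> {e \<in> arcs G. (tail G e \<in> C) \<noteq> (head G e \<in> C)} = {e} \<Longrightarrow> C \<inter> S \<noteq> {}"
  shows "leaf_count G \<le> max 2 (card S)"
\<comment> \<open>The conventional value 2 for a single component is the reason for the maximum in
  the bound.\<close>
proof (cases "card (two_edge_comps G) = 1")
  case False
  interpret fin_digraph G by fact
  define N where "N = nonbridges (tail G) (head G) {} (arcs G)"
  have N: "N \<subseteq> arcs G" by (auto simp: N_def nonbridges_def)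
  have tec: "two_edge_comps G = comp_graph G N ` gcomps G N"
    unfolding N_def by (rule two_edge_comps_eq[OF assms(1,2)])
  have cut: "cutting_arc G e \<longleftrightarrow> e \<in> arcs G - N" for e
    unfolding N_def by (rule cutting_arc_iff_nonbridge[OF wf_digraph_axioms assms(2)])
  define L where "L = {C \<in> two_edge_comps G. out_degree (with_proj (comp_tree G)) C = 1}"
  have "verts H \<inter> S \<noteq> {}" if H: "H \<in> L" for H
  proof -
    obtain C where C: "C \<in> gcomps G N" "H = comp_graph G N C"
      using H tec by (auto simp: L_def)
    have "card (out_arcs (with_proj (comp_tree G)) H) = 1"
      using H by (simp add: L_def out_degree_def)
    then obtain a where a: "out_arcs (with_proj (comp_tree G)) H = {a}"
      by (auto simp: card_1_singleton_iff)
    have oa: "out_arcs (with_proj (comp_tree G)) H = {(H, D) | D. (H, D) \<in> parcs (comp_tree G)}"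
      by (auto simp: out_arcs_def)
    obtain D where D: "{D. (H, D) \<in> parcs (comp_tree G)} = {D}"
    proof (rule that)
      have eq: "{(H, D) | D. (H, D) \<in> parcs (comp_tree G)} = {a}" using a oa by simp
      have only: "D = snd a" if "(H, D) \<in> parcs (comp_tree G)" for D
      proof -
        have "(H, D) \<in> {a}" unfolding eq[symmetric] using that by blast
        then show ?thesis by auto
      qed
      have "a \<in> {(H, D) | D. (H, D) \<in> parcs (comp_tree G)}" unfolding eq by simp
      then obtain D0 where D0: "a = (H, D0)" "(H, D0) \<in> parcs (comp_tree G)" by blast
      show "{D. (H, D) \<in> parcs (comp_tree G)} = {snd a}"
      proof (intro Set.set_eqI iffI)
        fix D assume "D \<in> {D. (H, D) \<in> parcs (comp_tree G)}"
        then show "D \<in> {snd a}" using only by blast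
      next
        fix D assume "D \<in> {snd a}"
        then show "D \<in> {D. (H, D) \<in> parcs (comp_tree G)}" using D0 by simp
      qed
    qed
    then have "(H, D) \<in> parcs (comp_tree G)" by blast
    then obtain e where e: "D \<in> two_edge_comps G" "H \<noteq> D" "cutting_arc G e"
      "tail G e \<in> C \<and> head G e \<in> verts D \<or> tail G e \<in> verts D \<and> head G e \<in> C"
      using C by (auto simp: comp_tree_def)
    obtain D' where D': "D' \<in> gcomps G N" "D = comp_graph G N D'" using e(1) tec by auto
    have disj: "C \<inter> D' = {}"
      using comps_disjoint C D' e(2) by (metis disjointD)
    have uniq: "e' = e" if e': "e' \<in> arcs G" "(tail G e' \<in> C) \<noteq> (head G e' \<in> C)" for e'
    proof (rule ccontr)
      assume ne: "e' \<noteq> e"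
      have "e' \<notin> N" using comps_arc_iff[OF C(1)] e'(2) by blast
      then have c': "cutting_arc G e'" using cut e'(1) by blast
      \<comment> \<open>\<open>x\<close> is the outer end of the second crossing arc. Its component
        is a neighbour of the leaf, hence equal to \<open>D\<close>. So \<open>e'\<close> also joins
        \<open>C\<close> to \<open>D\<close>, and a path through it shows that \<open>e\<close> is
        not cutting.\<close>
      define x where "x = (if tail G e' \<in> C then head G e' else tail G e')"
      have x: "x \<in> verts G" "x \<notin> C" using e' by (auto simp: x_def)
      let ?E = "gconn G N `` {x}"
      have E: "?E \<in> gcomps G N" using x by (auto simp: comps_def)
      have "?E \<noteq> C" using x by auto
      then have "comp_graph G N ?E \<noteq> H" using C(2) by (auto simp: comp_graph_def)
      then have "(H, comp_graph G N ?E) \<in> parcs (comp_tree G)"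
        using C E tec c' e'(2) by (auto simp: comp_tree_def x_def intro!: exI[of _ e'])
      then have "comp_graph G N ?E = D" using D by auto
      then have "x \<in> D'" using D'(2) by (auto simp: comp_graph_def)
      have inE: "(u, v) \<in> gconn G (arcs G - {e})" if "u \<in> K" "v \<in> K" "K \<in> gcomps G N" for u v K
      proof -
        have "(u, v) \<in> gconn G N" using comps_eq_class[OF that(3,1)] that(2) by blast
        then show ?thesis by (rule conn_mono[rotated]) (use N e(3) cut in auto)
      qed
      have ee': "(tail G e', head G e') \<in> gconn G (arcs G - {e})"
        using e'(1) ne by (intro conn_arc) auto
      obtain y z where yz: "{y, z} = {tail G e', head G e'}" "y \<in> C" "z \<in> D'"
        using e'(2) \<open>x \<in> D'\<close> x_def by (metis insert_commute)
      obtain u v where uv: "{u, v} = {tail G e, head G e}" "u \<in> C" "v \<in> D'"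
        using e(4) D'(2) by (metis comp_graph_simps(1) insert_commute)
      have "(y, z) \<in> gconn G (arcs G - {e})"
        using yz(1) ee' conn_sym[OF ee'] by (auto simp: doubleton_eq_iff)
      then have "(u, v) \<in> gconn G (arcs G - {e})"
        using conn_trans[OF conn_trans[OF inE[OF uv(2) yz(2) C(1)]] inE[OF yz(3) uv(3) D'(1)]] by blast
      then have "(tail G e, head G e) \<in> gconn G (arcs G - {e})"
        using uv(1) conn_sym[of u v "tail G" "head G"] by (auto simp: doubleton_eq_iff)
      then show False using e(3) cutting_arc_iff[OF wf_digraph_axioms assms(2)] by blast
    qed
    have cross: "(tail G e \<in> C) \<noteq> (head G e \<in> C)" using e(4) disj D'(2) by auto
    have "{e \<in> arcs G. (tail G e \<in> C) \<noteq> (head G e \<in> C)} = {e}"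
      using uniq cross e(3) cut by blast
    moreover have "C \<subseteq> verts G"
      using comps_subset[OF wf_ends_subset[OF wf_digraph_axioms N] C(1)] .
    ultimately show ?thesis using touch C(2) by simp
  qed
  then have "\<forall>H\<in>L. \<exists>x. x \<in> verts H \<inter> S" by blast
  \<comment> \<open>One vertex of \<open>S\<close> is chosen in each leaf. Different leaves are
    disjoint, so the choice is injective.\<close>
  then obtain s where s: "\<And>H. H \<in> L \<Longrightarrow> s H \<in> verts H \<inter> S" by metis
  have "inj_on s L"
  proof (rule inj_onI)
    fix H K assume HK: "H \<in> L" "K \<in> L" "s H = s K"
    obtain C D where CD: "C \<in> gcomps G N" "H = comp_graph G N C" "D \<in> gcomps G N" "K = comp_graph G N D"
      using HK tec by (auto simp: L_def)
    have "s H \<in> C \<inter> D" using s[OF HK(1)] s[OF HK(2)] HK(3) CD by simp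
    then have "C = D" using comps_eq_class[OF CD(1), of "s H"] comps_eq_class[OF CD(3), of "s H"] by blast
    then show "H = K" using CD by simp
  qed
  then have "card L \<le> card S"
    using s assms(3) by (intro card_inj_on_le[of s]) auto
  then show ?thesis using False by (simp add: leaf_count_def L_def)
qed (simp add: leaf_count_def)

text \<open>Euler's theorem for directed graphs. From here on balance replaces closed
  trails.\<close>

lemma cyclic_in_iff:
  "cyclic_in V T \<longleftrightarrow> test_graph_in V T \<and>
    (\<forall>v\<in>verts (shape T). balanced_at (tail (shape T)) (head (shape T)) (arcs (shape T)) v)"
proof (cases "test_graph_in V T")
  case True
  then interpret fin_digraph "shape T" by (simp add: test_graph_in_def)
  have "in_degree (shape T) v = out_degree (shape T) v \<longleftrightarrow>
      balanced_at (tail (shape T)) (head (shape T)) (arcs (shape T)) v" for v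
    by (auto simp: in_degree_def out_degree_def in_arcs_def out_arcs_def balanced_at_def)
  then show ?thesis
    using True closed_euler by (simp add: cyclic_in_def test_graph_in_def)
qed (simp add: cyclic_in_def)

text \<open>
  The arcs outside \<open>YA\<close> carry the independent entries. Arcs with the same key see the same entry, so
  each key contributes one factor of order \<open>1 / N\<close>. The key is a parameter since identifying
  vertices may make arcs of different keys parallel, but must not merge their keys.
\<close>

locale keyed_graph = fin_digraph G for G :: "('a, 'b) pre_digraph" +
  fixes YA :: "'b set" and key :: "'b \<Rightarrow> 'k"
  assumes con: "Digraph_Component.connected G"
    and YA: "YA \<subseteq> arcs G"
    and key: "\<And>e e'. e \<in> arcs G - YA \<Longrightarrow> e' \<in> arcs G - YA \<Longrightarrow> key e = key e' \<Longrightarrow>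
      {tail G e, head G e} = {tail G e', head G e'}"
begin

definition XA where "XA = arcs G - YA"
text \<open>One representative arc for each key. If all arcs were kept, parallel arcs of one group
  would make each other nonbridges. So \<open>F - NB\<close> stands for the groups that are bridges
  and \<open>NB\<close> for the others.\<close>

definition F where "F = inv_into XA key ` key ` XA"
definition grp where "grp f = {e \<in> XA. key e = key f}"
definition NB where "NB = nonbridges (tail G) (head G) YA F"

lemma F: "F \<subseteq> XA" "finite F" "card F = card (key ` XA)" "tail G ` F \<union> head G ` F \<subseteq> verts G" "YA \<inter> F = {}"
proof -
  show s: "F \<subseteq> XA" by (auto simp: F_def inv_into_into)
  show "finite F" using s by (rule finite_subset) (simp add: XA_def)
  show "card F = card (key ` XA)"
    unfolding F_def by (intro card_image inj_on_inv_into) simp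
  show "tail G ` F \<union> head G ` F \<subseteq> verts G" using s by (auto simp: XA_def)
  show "YA \<inter> F = {}" using s by (auto simp: XA_def)
qed

lemma rep: "e \<in> XA \<Longrightarrow> \<exists>f\<in>F. key f = key e"
  by (auto simp: F_def f_inv_into_f intro!: bexI[of _ "inv_into XA key (key e)"])

lemma key_inj: "f \<in> F \<Longrightarrow> f' \<in> F \<Longrightarrow> key f = key f' \<Longrightarrow> f = f'"
  by (auto simp: F_def f_inv_into_f)

lemma same_ends: "e \<in> XA \<Longrightarrow> e' \<in> XA \<Longrightarrow> key e = key e' \<Longrightarrow> {tail G e, head G e} = {tail G e', head G e'}"
  unfolding XA_def by (rule key)

lemma finite_XA [simp]: "finite XA" and finite_YA [simp]: "finite YA"
  using YA finite_subset[OF YA] by (auto simp: XA_def)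

lemma arcs_split: "arcs G = YA \<union> XA" "YA \<inter> XA = {}"
  using YA by (auto simp: XA_def)

lemma conn_reps: "(u, v) \<in> gconn G (YA \<union> F) \<longleftrightarrow> (u, v) \<in> gconn G (arcs G)"
proof
  show "(u, v) \<in> gconn G (arcs G)" if "(u, v) \<in> gconn G (YA \<union> F)"
    using that by (rule conn_mono[rotated]) (use F arcs_split in auto)
  show "(u, v) \<in> gconn G (YA \<union> F)" if uv: "(u, v) \<in> gconn G (arcs G)"
  proof -
    have "(id (tail G e), id (head G e)) \<in> gconn G (YA \<union> F)" if "e \<in> arcs G" for e
    proof (cases "e \<in> YA")
      case True
      then show ?thesis using conn_arc[of e "YA \<union> F" "tail G" "head G"] by simp
    next
      case False
      then have e: "e \<in> XA" using that by (simp add: XA_def)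
      obtain f where f: "f \<in> F" "key f = key e" using rep[OF e] by blast
      have "{tail G e, head G e} = {tail G f, head G f}" using same_ends[OF e, of f] F(1) f by auto
      moreover have "(tail G f, head G f) \<in> gconn G (YA \<union> F)" using f by (intro conn_arc) simp
      ultimately show ?thesis
        using conn_sym[of "tail G f" "head G f" "tail G" "head G"] by (auto simp: doubleton_eq_iff)
    qed
    then have "(id u, id v) \<in> gconn G (YA \<union> F)" using uv by (rule conn_least)
    then show ?thesis by simp
  qed
qed

lemma card_comps_all: "card (gcomps G (YA \<union> F)) = 1"
proof -
  have "verts G \<noteq> {}" "\<And>u v. u \<in> verts G \<Longrightarrow> v \<in> verts G \<Longrightarrow> (u, v) \<in> gconn G (YA \<union> F)"
    using con unfolding connected_iff_conn[OF wf_digraph_axioms] by (simp_all add: conn_reps)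
  moreover have "tail G ` (YA \<union> F) \<union> head G ` (YA \<union> F) \<subseteq> verts G" using F(4) YA by auto
  ultimately show ?thesis by (simp add: comps_connected)
qed

text \<open>Each representative merges at most two components, and one component is left in the
  end.\<close>

lemma card_comps_YA_le: "card (gcomps G YA) \<le> card (key ` XA) + 1"
  using card_comps_Un_le[OF finite_verts F(2,4), of YA] card_comps_all F(3) by simp

lemma NB: "NB \<subseteq> F"
  by (auto simp: NB_def nonbridges_def)

text \<open>Together with \<open>YA\<close> the representatives connect the graph. Deleting them one
  after the other gives one component more than there are keys exactly if each deletion splits a
  component.\<close>

lemma NB_empty_iff: "NB = {} \<longleftrightarrow> card (gcomps G YA) = card (key ` XA) + 1"
proof
  assume "NB = {}"
  then show "card (gcomps G YA) = card (key ` XA) + 1"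
    using card_comps_nonbridges[OF finite_verts F(2,4,5)] card_comps_all F(3) by (simp add: NB_def)
next
  assume *: "card (gcomps G YA) = card (key ` XA) + 1"
  have "f \<notin> NB" for f
    using independent_if_card_comps[OF finite_verts F(2,4,5), of f] * card_comps_all F(3)
    by (auto simp: NB_def nonbridges_def)
  then show "NB = {}" by blast
qed

end

text \<open>Balance is kept apart from \<open>keyed_graph\<close> because the bound
  \<open>card_comps_YA_le\<close> is also applied to pieces of a graph before their balance is
  available (\<open>keyed_card_verts_le\<close>).\<close>

locale grouped_graph = keyed_graph +
  assumes bal: "\<And>v. v \<in> verts G \<Longrightarrow> balanced_at (tail G) (head G) (arcs G) v"
begin

text \<open>Deleting a bridge leaves two sides, and only arcs of its group cross from one to the
  other. So \<open>cut_balance\<close> compares the two directions within the group.\<close>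

lemma bridge_group:
  assumes "f \<in> F - NB"
  shows "tail G f \<noteq> head G f" "card {e \<in> grp f. tail G e = tail G f} = card {e \<in> grp f. head G e = tail G f}"
proof -
  have f: "f \<in> F" "f \<in> XA" "(tail G f, head G f) \<notin> gconn G (YA \<union> F - {f})"
    using assms F(1) by (auto simp: NB_def nonbridges_def)
  show ne: "tail G f \<noteq> head G f" using f(3) by auto
  define S where "S = gconn G (YA \<union> F - {f}) `` {tail G f}"
  have S: "tail G f \<in> S" "head G f \<notin> S" using f(3) by (auto simp: S_def)
  have "S \<subseteq> verts G"
    using conn_in_verts[of "tail G" "YA \<union> F - {f}" "head G" "verts G"] F YA f
    by (fastforce simp: S_def XA_def)
  have Sin: "S \<in> gcomps G (YA \<union> F - {f})" using f(2) by (auto simp: S_def comps_def XA_def)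
  have nocross: "tail G e \<in> S \<longleftrightarrow> head G e \<in> S" if "e \<in> arcs G" "e \<notin> grp f" for e
  proof (cases "e \<in> YA")
    case True
    then have "e \<in> YA \<union> F - {f}" using F(5) f by auto
    then show ?thesis by (rule comps_arc_iff[OF Sin])
  next
    case False
    then have e: "e \<in> XA" using that by (simp add: XA_def)
    obtain r where r: "r \<in> F" "key r = key e" using rep[OF e] by blast
    have "r \<noteq> f" using that e r by (auto simp: grp_def)
    then have "tail G r \<in> S \<longleftrightarrow> head G r \<in> S" using r by (intro comps_arc_iff[OF Sin]) simp
    moreover have "{tail G e, head G e} = {tail G r, head G r}" using same_ends[OF e, of r] r F(1) by auto
    ultimately show ?thesis by (auto simp: doubleton_eq_iff)
  qed
  have ends: "tail G e = tail G f \<and> head G e = head G f \<or> tail G e = head G f \<and> head G e = tail G f"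
    if "e \<in> grp f" for e
    using same_ends[of e f] that f(2) by (auto simp: grp_def doubleton_eq_iff)
  have grp: "grp f \<subseteq> arcs G" by (auto simp: grp_def XA_def)
  have "{e \<in> arcs G. tail G e \<in> S \<and> head G e \<notin> S} = {e \<in> grp f. tail G e = tail G f}"
    using nocross ends S grp ne by force
  moreover have "{e \<in> arcs G. head G e \<in> S \<and> tail G e \<notin> S} = {e \<in> grp f. head G e = tail G f}"
    using nocross ends S grp ne by force
  moreover have "card {e \<in> arcs G. tail G e \<in> S \<and> head G e \<notin> S} = card {e \<in> arcs G. head G e \<in> S \<and> tail G e \<notin> S}"
    using \<open>S \<subseteq> verts G\<close> by (intro cut_balance finite_arcs bal) (auto intro: finite_subset)
  ultimately show "card {e \<in> grp f. tail G e = tail G f} = card {e \<in> grp f. head G e = tail G f}" by simp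
qed

lemma bridge_group_balanced_at:
  assumes "f \<in> F - NB"
  shows "card {e \<in> grp f. tail G e = v} = card {e \<in> grp f. head G e = v}"
proof -
  have ends: "tail G e = tail G f \<and> head G e = head G f \<or> tail G e = head G f \<and> head G e = tail G f"
    if "e \<in> grp f" for e
    using same_ends[of e f] that assms F(1) by (auto simp: grp_def doubleton_eq_iff)
  consider "v = tail G f" | "v = head G f" | "v \<noteq> tail G f" "v \<noteq> head G f" by blast
  then show ?thesis
  proof cases
    case 1
    then show ?thesis using bridge_group(2)[OF assms] by simp
  next
    case 2
    have "{e \<in> grp f. tail G e = v} = {e \<in> grp f. head G e = tail G f}"
      "{e \<in> grp f. head G e = v} = {e \<in> grp f. tail G e = tail G f}"
      using ends 2 bridge_group(1)[OF assms] by force+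
    then show ?thesis using bridge_group(2)[OF assms] by simp
  next
    case 3
    then have "{e \<in> grp f. tail G e = v} = {}" "{e \<in> grp f. head G e = v} = {}"
      using ends by force+
    then show ?thesis by (simp only: card.empty)
  qed
qed

text \<open>Applied to the arcs of one component of a heavy Wigner variable. In the tree case all
  groups are bridges and hence balanced, which makes this component cyclic.\<close>

lemma group_union_balanced:
  assumes "NB = {}" "U \<subseteq> XA" "\<And>e e'. e \<in> U \<Longrightarrow> e' \<in> XA \<Longrightarrow> key e = key e' \<Longrightarrow> e' \<in> U"
  shows "balanced_at (tail G) (head G) U v"
proof -
  have eq: "card {e \<in> U. t e = v} = (\<Sum>f\<in>F \<inter> U. card {e \<in> grp f. t e = v})" for t :: "'b \<Rightarrow> 'a"
  proof -
    have "{e \<in> U. t e = v} = (\<Union>f\<in>F \<inter> U. {e \<in> grp f. t e = v})"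
    proof (intro Set.set_eqI iffI)
      fix e assume e: "e \<in> {e \<in> U. t e = v}"
      then have "e \<in> XA" using assms(2) by blast
      with rep obtain f where f: "f \<in> F" "key f = key e" by blast
      then have "f \<in> U" using assms(3)[of e f] e F(1) by auto
      then have "f \<in> F \<inter> U" "e \<in> {e \<in> grp f. t e = v}"
        using f e \<open>e \<in> XA\<close> by (simp_all add: grp_def)
      then show "e \<in> (\<Union>f\<in>F \<inter> U. {e \<in> grp f. t e = v})" by blast
    next
      fix e assume "e \<in> (\<Union>f\<in>F \<inter> U. {e \<in> grp f. t e = v})"
      then obtain f where f: "f \<in> U" "e \<in> XA" "key e = key f" "t e = v" by (auto simp: grp_def)
      then show "e \<in> {e \<in> U. t e = v}" using assms(3)[of f e] by simp
    qed
    moreover have "card (\<Union>f\<in>F \<inter> U. {e \<in> grp f. t e = v}) = (\<Sum>f\<in>F \<inter> U. card {e \<in> grp f. t e = v})"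
      using F(2) key_inj by (intro card_UN_disjoint) (auto simp: grp_def)
    ultimately show ?thesis by simp
  qed
  have "(\<Sum>f\<in>F \<inter> U. card {e \<in> grp f. tail G e = v}) = (\<Sum>f\<in>F \<inter> U. card {e \<in> grp f. head G e = v})"
    using assms(1) by (intro sum.cong refl bridge_group_balanced_at) auto
  then show ?thesis by (simp only: balanced_at_def eq)
qed

text \<open>The graph without its bridge groups. These are balanced by themselves, so the rest
  remains balanced; if there are no nonbridges, it is just \<open>YA\<close>.\<close>

definition core where "core = YA \<union> {e \<in> XA. key e \<in> key ` NB}"

lemma core_balanced:
  assumes "v \<in> verts G"
  shows "balanced_at (tail G) (head G) core v"
proof -
  have U: "{e \<in> arcs G. t e = v} = {e \<in> core. t e = v} \<union> (\<Union>f\<in>F - NB. {e \<in> grp f. t e = v})"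
    for t :: "'b \<Rightarrow> 'a"
  proof (intro Set.set_eqI iffI)
    fix e assume e: "e \<in> {e \<in> arcs G. t e = v}"
    show "e \<in> {e \<in> core. t e = v} \<union> (\<Union>f\<in>F - NB. {e \<in> grp f. t e = v})"
    proof (cases "e \<in> core")
      case False
      then have "e \<in> XA" using e arcs_split(1) by (auto simp: core_def)
      with rep obtain f where f: "f \<in> F" "key f = key e" by blast
      then have "f \<notin> NB" using False \<open>e \<in> XA\<close> by (auto simp: core_def image_iff)
      then have "f \<in> F - NB" "e \<in> {e \<in> grp f. t e = v}"
        using f e \<open>e \<in> XA\<close> by (simp_all add: grp_def)
      then show ?thesis by blast
    qed (use e in simp)
  next
    fix e assume "e \<in> {e \<in> core. t e = v} \<union> (\<Union>f\<in>F - NB. {e \<in> grp f. t e = v})"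
    then show "e \<in> {e \<in> arcs G. t e = v}" using arcs_split(1) by (auto simp: core_def grp_def)
  qed
  have D: "{e \<in> core. t e = v} \<inter> (\<Union>f\<in>F - NB. {e \<in> grp f. t e = v}) = {}" for t :: "'b \<Rightarrow> 'a"
  proof (rule ccontr)
    assume "\<not> ?thesis"
    then obtain e f where e: "e \<in> core" "f \<in> F - NB" "e \<in> XA" "key e = key f"
      by (auto simp: grp_def)
    then obtain f' where "f' \<in> NB" "key f = key f'" using arcs_split(2) by (auto simp: core_def)
    then show False using key_inj[of f f'] e(2) NB by auto
  qed
  have fin: "finite core" "finite (grp f)" for f
    by (auto simp: core_def grp_def)
  have c: "card {e \<in> arcs G. t e = v} = card {e \<in> core. t e = v} + (\<Sum>f\<in>F - NB. card {e \<in> grp f. t e = v})"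
    for t :: "'b \<Rightarrow> 'a"
  proof -
    have "card (\<Union>f\<in>F - NB. {e \<in> grp f. t e = v}) = (\<Sum>f\<in>F - NB. card {e \<in> grp f. t e = v})"
      using F(2) fin key_inj by (intro card_UN_disjoint) (auto simp: grp_def)
    moreover have "finite (\<Union>f\<in>F - NB. {e \<in> grp f. t e = v})" using F(2) fin by auto
    ultimately show ?thesis
      unfolding U[of t] using fin D[of t] by (subst card_Un_disjoint) auto
  qed
  show ?thesis
    using bal[OF assms] c[of "tail G"] c[of "head G"] bridge_group_balanced_at
    by (simp add: balanced_at_def)
qed

lemma YA_balanced:
  assumes "card (gcomps G YA) = card (key ` XA) + 1" "v \<in> verts G"
  shows "balanced_at (tail G) (head G) YA v"
  using core_balanced[OF assms(2)] NB_empty_iff assms(1) by (simp add: core_def)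

text \<open>Suppose that a single \<open>YA\<close> arc of the component crosses a set
  \<open>D\<close>. By balance of \<open>core\<close>, an arc of \<open>core\<close> crosses
  \<open>D\<close> in the opposite direction. It is not in \<open>YA\<close>, so it belongs to a
  nonbridge group, and its end in \<open>D\<close> is an end of a representative.\<close>

lemma leaf_count_YA_comp:
  assumes C: "C \<in> gcomps G YA"
  shows "leaf_count (comp_graph G YA C) \<le> max 2 (card {v \<in> C. v \<in> tail G ` NB \<union> head G ` NB})"
proof (rule leaf_count_le)
  show "fin_digraph (comp_graph G YA C)" "Digraph_Component.connected (comp_graph G YA C)"
    using fin_comp_graph[OF fin_digraph_axioms YA C] connected_comp_graph[OF wf_digraph_axioms YA C] .
  have "finite NB" using NB F(2) by (rule finite_subset)
  then show "finite {v \<in> C. v \<in> tail G ` NB \<union> head G ` NB}" by auto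
  fix D e0
  assume D: "D \<subseteq> verts (comp_graph G YA C)"
    and e0: "{e \<in> arcs (comp_graph G YA C).
      (tail (comp_graph G YA C) e \<in> D) \<noteq> (head (comp_graph G YA C) e \<in> D)} = {e0}"
  have DC: "D \<subseteq> C" "D \<subseteq> verts G"
    using D comps_subset[OF wf_ends_subset[OF wf_digraph_axioms YA] C] by auto
  have cross: "e = e0" if e: "e \<in> core" "(tail G e \<in> D) \<noteq> (head G e \<in> D)"
    and nt: "D \<inter> {v \<in> C. v \<in> tail G ` NB \<union> head G ` NB} = {}" for e
  proof -
    have "e \<in> YA"
    proof (rule ccontr)
      assume "e \<notin> YA"
      then obtain f where f: "e \<in> XA" "f \<in> NB" "key e = key f" using e(1) by (auto simp: core_def)
      then have "{tail G e, head G e} = {tail G f, head G f}"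
        using same_ends[of e f] NB F(1) by auto
      then have "tail G f \<in> D \<or> head G f \<in> D" using e(2) by (auto simp: doubleton_eq_iff)
      then show False using nt f(2) DC by auto
    qed
    moreover have "tail G e \<in> C"
      using e(2) DC comps_arc_iff[OF C \<open>e \<in> YA\<close>] by blast
    ultimately have "e \<in> {e0}" using e(2) unfolding e0[symmetric] by simp
    then show ?thesis by simp
  qed
  show "D \<inter> {v \<in> C. v \<in> tail G ` NB \<union> head G ` NB} \<noteq> {}"
  proof
    assume nt: "D \<inter> {v \<in> C. v \<in> tail G ` NB \<union> head G ` NB} = {}"
    have "e0 \<in> {e \<in> arcs (comp_graph G YA C).
      (tail (comp_graph G YA C) e \<in> D) \<noteq> (head (comp_graph G YA C) e \<in> D)}" unfolding e0 by simp
    then have c0: "e0 \<in> core" "(tail G e0 \<in> D) \<noteq> (head G e0 \<in> D)" by (auto simp: core_def)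
    have eq: "card {e \<in> core. tail G e \<in> D \<and> head G e \<notin> D} = card {e \<in> core. head G e \<in> D \<and> tail G e \<notin> D}"
      using DC(2) core_balanced by (intro cut_balance) (auto simp: core_def intro: finite_subset)
    show False
    proof (cases "tail G e0 \<in> D")
      case True
      then have "{e \<in> core. tail G e \<in> D \<and> head G e \<notin> D} = {e0}"
        "{e \<in> core. head G e \<in> D \<and> tail G e \<notin> D} = {}"
        using c0 cross[OF _ _ nt] by blast+
      then have "card {e0} = card ({} :: 'b set)" using eq by (simp only:)
      then show False by simp
    next
      case False
      then have "{e \<in> core. tail G e \<in> D \<and> head G e \<notin> D} = {}"
        "{e \<in> core. head G e \<in> D \<and> tail G e \<notin> D} = {e0}"
        using c0 cross[OF _ _ nt] by blast+
      then have "card {e0} = card ({} :: 'b set)" using eq by (simp only:)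
      then show False by simp
    qed
  qed
qed

lemma sum_leaf_count_le:
  assumes "card (gcomps G YA) \<noteq> card (key ` XA) + 1"
  shows "(\<Sum>C\<in>gcomps G YA. leaf_count (comp_graph G YA C)) \<le> 2 * card (key ` XA)"
proof -
  \<comment> \<open>\<open>d C\<close> counts the ends of nonbridge representatives in
    \<open>C\<close>, with loops counted twice. \<open>Z\<close> consists of the components without
    such ends.\<close>
  define d where "d C = card {f \<in> NB. tail G f \<in> C} + card {f \<in> NB. head G f \<in> C}" for C
  define Z where "Z = {C \<in> gcomps G YA. d C = 0}"
  have fNB: "finite NB" using NB F(2) by (rule finite_subset)
  have fY: "finite (gcomps G YA)" by simp
  have NBv: "tail G f \<in> verts G" "head G f \<in> verts G" if "f \<in> NB" for f
    using that NB F(4) by auto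
  \<comment> \<open>A single end in \<open>C\<close> would be separated from the other end by
    deleting its arc, against \<open>nonbridge_stays\<close>. So \<open>max 2 (d C)\<close> is
    \<open>d C\<close> outside \<open>Z\<close>.\<close>
  have one: "d C \<noteq> 1" if C: "C \<in> gcomps G YA" for C
  proof
    assume d1: "d C = 1"
    obtain f where f: "f \<in> NB" "tail G f \<in> C \<or> head G f \<in> C"
      using d1 by (cases "{f \<in> NB. tail G f \<in> C} = {}") (auto simp: d_def card_1_singleton_iff)
    have "card {f \<in> NB. tail G f \<in> C} \<le> 1" "card {f \<in> NB. head G f \<in> C} \<le> 1"
      "card {f \<in> NB. tail G f \<in> C} = 0 \<or> card {f \<in> NB. head G f \<in> C} = 0"
      using d1 unfolding d_def by linarith+
    then have only: "f' = f \<and> (tail G f \<in> C) \<noteq> (head G f \<in> C)"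
      if "f' \<in> NB" "tail G f' \<in> C \<or> head G f' \<in> C" for f'
      using f that fNB by (auto simp: card_le_Suc0_iff_eq)
    have "(tail G f, head G f) \<in> gconn G (YA \<union> (NB - {f}))"
      unfolding NB_def by (rule nonbridge_stays[OF finite_verts F(2,4,5)]) (use f NB_def in simp)
    then have "tail G f \<in> C \<longleftrightarrow> head G f \<in> C"
      by (rule conn_closed[rotated]) (use only comps_arc_iff[OF C] in blast)
    then show False using only[OF f] by blast
  qed
  have le: "leaf_count (comp_graph G YA C) \<le> (if C \<in> Z then 2 else 0) + d C" if C: "C \<in> gcomps G YA" for C
  proof -
    have "{v \<in> C. v \<in> tail G ` NB \<union> head G ` NB} =
        tail G ` {f \<in> NB. tail G f \<in> C} \<union> head G ` {f \<in> NB. head G f \<in> C}" by auto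
    then have "card {v \<in> C. v \<in> tail G ` NB \<union> head G ` NB} \<le> d C"
      unfolding d_def using fNB
      by (auto intro!: order_trans[OF card_Un_le] add_mono card_image_le)
    then show ?thesis
      using leaf_count_YA_comp[OF C] one[OF C] C by (auto simp: Z_def max_def split: if_splits)
  qed
  have sumd: "(\<Sum>C\<in>gcomps G YA. card {f \<in> NB. t f \<in> C}) = card NB"
    if t: "t ` NB \<subseteq> verts G" for t :: "'b \<Rightarrow> 'a"
  proof -
    have "card NB = card (\<Union>C\<in>gcomps G YA. {f \<in> NB. t f \<in> C})"
      using t comps_Union[OF wf_ends_subset[OF wf_digraph_axioms YA]]
      by (intro arg_cong[where f = card]) blast
    also have "\<dots> = (\<Sum>C\<in>gcomps G YA. card {f \<in> NB. t f \<in> C})"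
      using fNB comps_disjoint[of "tail G" "head G" "verts G" YA]
      by (intro card_UN_disjoint) (auto simp: disjoint_def pairwise_def disjnt_def)
    finally show ?thesis by simp
  qed
  have "(\<Sum>C\<in>gcomps G YA. leaf_count (comp_graph G YA C)) \<le> (\<Sum>C\<in>gcomps G YA. (if C \<in> Z then 2 else 0) + d C)"
    by (intro sum_mono le)
  also have "\<dots> = 2 * card Z + 2 * card NB"
  proof -
    have "(\<Sum>C\<in>gcomps G YA. if C \<in> Z then 2 else 0) = 2 * card Z"
      using fY by (subst sum.If_cases) (auto simp: Z_def Int_def)
    moreover have "(\<Sum>C\<in>gcomps G YA. d C) = 2 * card NB"
      unfolding d_def sum.distrib using sumd[of "tail G"] sumd[of "head G"] NBv by (simp add: image_subset_iff)
    ultimately show ?thesis by (simp add: sum.distrib)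
  qed
  finally have "(\<Sum>C\<in>gcomps G YA. leaf_count (comp_graph G YA C)) \<le> 2 * card Z + 2 * card NB" .
  \<comment> \<open>Adding \<open>NB\<close> to \<open>YA\<close> leaves the components in
    \<open>Z\<close> as they are, and there is at least one further component, that of
    \<open>f0\<close>, which exists because the tree equality fails. There are
    \<open>1 + card (F - NB)\<close> components in all, so \<open>Z\<close> is no larger than the
    set of bridges.\<close>
  moreover have "card Z + card NB \<le> card F"
  proof -
    obtain f0 where f0: "f0 \<in> NB" using NB_empty_iff assms by blast
    let ?K = "gconn G (YA \<union> NB) `` {tail G f0}"
    have "C \<in> gcomps G (YA \<union> NB)" if "C \<in> Z" for C
    proof -
      have C: "C \<in> gcomps G YA" "tail G f \<notin> C" "head G f \<notin> C" if "f \<in> NB" for f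
        using \<open>C \<in> Z\<close> that fNB by (auto simp: Z_def d_def)
      obtain x where x: "x \<in> verts G" "C = gconn G YA `` {x}" using C(1)[OF f0] by (auto simp: comps_def)
      have "gconn G (YA \<union> NB) `` {x} = C"
      proof (intro Set.set_eqI iffI)
        fix y assume "y \<in> gconn G (YA \<union> NB) `` {x}"
        then have "(x, y) \<in> gconn G (YA \<union> NB)" by simp
        then have "x \<in> C \<longleftrightarrow> y \<in> C"
          by (rule conn_closed[rotated]) (use C comps_arc_iff[OF C(1)[OF f0]] in blast)
        then show "y \<in> C" using x(2) by simp
      next
        fix y assume "y \<in> C"
        then have "(x, y) \<in> gconn G YA" using x(2) by simp
        then have "(x, y) \<in> gconn G (YA \<union> NB)" by (rule conn_mono[rotated]) simp
        then show "y \<in> gconn G (YA \<union> NB) `` {x}" by simp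
      qed
      then show ?thesis using x(1) by (auto simp: comps_def)
    qed
    moreover have "?K \<in> gcomps G (YA \<union> NB)" using NBv[OF f0] by (auto simp: comps_def)
    moreover have "?K \<notin> Z" using f0 fNB by (auto simp: Z_def d_def)
    ultimately have "card (insert ?K Z) \<le> card (gcomps G (YA \<union> NB))"
      by (intro card_mono) auto
    moreover have "card (insert ?K Z) = Suc (card Z)"
      using \<open>?K \<notin> Z\<close> fY by (intro card_insert_disjoint) (auto simp: Z_def)
    moreover have "card (gcomps G (YA \<union> NB)) = 1 + card (F - NB)"
      using card_comps_nonbridges[OF finite_verts F(2,4,5)] card_comps_all by (simp add: NB_def)
    moreover have "card (F - NB) = card F - card NB" using NB fNB by (rule card_Diff_subset[rotated])
    moreover have "card NB \<le> card F" using NB F(2) by (rule card_mono[rotated])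
    ultimately show ?thesis by linarith
  qed
  ultimately show ?thesis using F(3) by linarith
qed

lemma YA_comp_balanced:
  assumes "card (gcomps G YA) = card (key ` XA) + 1" "C \<in> gcomps G YA" "v \<in> C"
  shows "balanced_at (tail G) (head G) {e \<in> YA. tail G e \<in> C} v"
proof -
  have "v \<in> verts G"
    using comps_subset[OF wf_ends_subset[OF wf_digraph_axioms YA] assms(2)] assms(3) by blast
  moreover have "{e \<in> {e \<in> YA. tail G e \<in> C}. tail G e = v} = {e \<in> YA. tail G e = v}"
    "{e \<in> {e \<in> YA. tail G e \<in> C}. head G e = v} = {e \<in> YA. head G e = v}"
    using comps_arc_iff[OF assms(2)] assms(3) by auto
  ultimately show ?thesis using YA_balanced[OF assms(1)] by (simp only: balanced_at_def)
qed

end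

lemma test_graph_in_YA_comp:
  assumes "grouped_graph G YA key" "C \<in> gcomps G YA" "\<And>e. e \<in> YA \<Longrightarrow> fst (l e) \<in> V"
  shows "test_graph_in V \<lparr>shape = comp_graph G YA C, lbl = l\<rparr>"
proof -
  interpret grouped_graph G YA key by fact
  show ?thesis
    using fin_comp_graph[OF fin_digraph_axioms YA assms(2)] connected_comp_graph[OF wf_digraph_axioms YA assms(2)]
      assms(3) by (auto simp: test_graph_in_def)
qed

lemma cyclic_in_YA_comp:
  assumes "grouped_graph G YA key" "C \<in> gcomps G YA" "\<And>e. e \<in> YA \<Longrightarrow> fst (l e) \<in> V"
    and "card (gcomps G YA) = card (key ` (arcs G - YA)) + 1"
  shows "cyclic_in V \<lparr>shape = comp_graph G YA C, lbl = l\<rparr>"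
proof -
  interpret grouped_graph G YA key by fact
  show ?thesis
    using YA_comp_balanced[OF _ assms(2)] assms(4) test_graph_in_YA_comp[OF assms(1-3)]
    by (simp add: cyclic_in_iff XA_def)
qed

section \<open>Sums over labelled vertices\<close>

definition injmaps :: "nat set \<Rightarrow> nat \<Rightarrow> (nat \<Rightarrow> nat) set" where
  "injmaps V N = {\<phi> \<in> V \<rightarrow>\<^sub>E {..<N}. inj_on \<phi> V}"

text \<open>The sum of an injective traffic without the factor \<open>1 / N\<close>. Vertices, end
  maps and arcs are separate arguments, so that quotients and the restriction to \<open>Y\<close>
  arcs are instances.\<close>

definition isum :: "nat \<Rightarrow> nat set \<Rightarrow> ('b \<Rightarrow> nat) \<Rightarrow> ('b \<Rightarrow> nat) \<Rightarrow> 'b set \<Rightarrow>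
    ('b \<Rightarrow> nat \<Rightarrow> nat \<Rightarrow> complex) \<Rightarrow> complex" where
  "isum N V t h B w = (\<Sum>\<phi>\<in>injmaps V N. \<Prod>e\<in>B. w e (\<phi> (t e)) (\<phi> (h e)))"

text \<open>A partition of \<open>V\<close> is encoded by the map sending a vertex to the least vertex of its block.\<close>

definition canon :: "nat set \<Rightarrow> (nat \<Rightarrow> nat) set" where
  "canon V = {r \<in> V \<rightarrow>\<^sub>E V. \<forall>v\<in>V. r (r v) = r v \<and> r v \<le> v}"

definition ker_rep :: "nat set \<Rightarrow> (nat \<Rightarrow> nat) \<Rightarrow> nat \<Rightarrow> nat" where
  "ker_rep V \<phi> = restrict (\<lambda>v. Min {w \<in> V. \<phi> w = \<phi> v}) V"

lemma finite_injmaps [simp]: "finite V \<Longrightarrow> finite (injmaps V N)"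
  by (rule finite_subset[of _ "V \<rightarrow>\<^sub>E {..<N}"]) (auto simp: injmaps_def intro: finite_PiE)

lemma finite_canon [simp]: "finite V \<Longrightarrow> finite (canon V)"
  by (rule finite_subset[of _ "V \<rightarrow>\<^sub>E V"]) (auto simp: canon_def intro: finite_PiE)

lemma ker_rep:
  assumes "finite V" "v \<in> V"
  shows "ker_rep V \<phi> v \<in> V" "\<phi> (ker_rep V \<phi> v) = \<phi> v" "ker_rep V \<phi> v \<le> v"
proof -
  have "Min {w \<in> V. \<phi> w = \<phi> v} \<in> {w \<in> V. \<phi> w = \<phi> v}"
    using assms by (intro Min_in) auto
  then show "ker_rep V \<phi> v \<in> V" "\<phi> (ker_rep V \<phi> v) = \<phi> v"
    using assms(2) by (auto simp: ker_rep_def)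
  show "ker_rep V \<phi> v \<le> v" using assms by (auto simp: ker_rep_def)
qed

lemma ker_rep_eq_iff:
  assumes "finite V" "v \<in> V" "w \<in> V"
  shows "ker_rep V \<phi> v = ker_rep V \<phi> w \<longleftrightarrow> \<phi> v = \<phi> w"
proof
  assume "ker_rep V \<phi> v = ker_rep V \<phi> w"
  then show "\<phi> v = \<phi> w" using ker_rep(2)[OF assms(1,2)] ker_rep(2)[OF assms(1,3)] by metis
qed (use assms in \<open>simp add: ker_rep_def\<close>)

lemma ker_rep_canon: "finite V \<Longrightarrow> ker_rep V \<phi> \<in> canon V"
  using ker_rep[of V _ \<phi>] ker_rep_eq_iff[of V _ _ \<phi>]
  by (auto simp: canon_def ker_rep_def extensional_def)

lemma canon_nontrivial:
  assumes "r \<in> canon V" "r \<noteq> restrict (\<lambda>v. v) V"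
  obtains v where "v \<in> V" "r v \<noteq> v" "r v \<in> V" "r (r v) = r v"
proof -
  have "\<not> (\<forall>v\<in>V. r v = v)"
  proof
    assume "\<forall>v\<in>V. r v = v"
    then have "r = restrict (\<lambda>v. v) V"
      using assms(1) by (intro ext) (auto simp: canon_def PiE_def extensional_def)
    then show False using assms(2) by simp
  qed
  then show ?thesis using that assms(1) by (auto simp: canon_def)
qed

lemma canon_card_less:
  assumes "finite V" "r \<in> canon V" "r \<noteq> restrict (\<lambda>v. v) V"
  shows "card (r ` V) < card V"
proof -
  obtain v where "v \<in> V" "r v \<noteq> v" "r v \<in> V" "r (r v) = r v"
    using canon_nontrivial[OF assms(2,3)] .
  then have "\<not> inj_on r V" by (auto dest: inj_onD)
  then show ?thesis
    using card_image_le[OF assms(1), of r] eq_card_imp_inj_on[OF assms(1), of r] by fastforce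
qed

lemma ker_rep_comp:
  assumes "finite V" "r \<in> canon V" "inj_on \<psi> (r ` V)"
  shows "ker_rep V (restrict (\<psi> \<circ> r) V) = r"
proof
  fix v
  show "ker_rep V (restrict (\<psi> \<circ> r) V) v = r v"
  proof (cases "v \<in> V")
    case True
    have "{w \<in> V. restrict (\<psi> \<circ> r) V w = restrict (\<psi> \<circ> r) V v} = {w \<in> V. r w = r v}"
      using True assms(3) by (auto dest: inj_onD)
    moreover have "Min {w \<in> V. r w = r v} = r v"
      using True assms(1,2) by (intro Min_eqI) (auto simp: canon_def)
    ultimately show ?thesis using True by (simp add: ker_rep_def)
  next
    case False
    then show ?thesis using assms(2) by (auto simp: canon_def ker_rep_def PiE_def extensional_def)
  qed
qed

text \<open>Every map factors uniquely as a canonical representative map \<open>r\<close> followed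
  by a map that is injective on the image of \<open>r\<close>.\<close>

lemma sum_maps_by_kernel:
  fixes g :: "(nat \<Rightarrow> nat) \<Rightarrow> 'c::comm_monoid_add"
  assumes V: "finite V"
  shows "(\<Sum>\<phi> | \<phi> \<in> V \<rightarrow>\<^sub>E {..<N} \<and> P (ker_rep V \<phi>). g \<phi>) =
    (\<Sum>r | r \<in> canon V \<and> P r. \<Sum>\<psi>\<in>injmaps (r ` V) N. g (restrict (\<psi> \<circ> r) V))"
proof -
  let ?S = "Sigma {r. r \<in> canon V \<and> P r} (\<lambda>r. injmaps (r ` V) N)"
  let ?T = "{\<phi>. \<phi> \<in> V \<rightarrow>\<^sub>E {..<N} \<and> P (ker_rep V \<phi>)}"
  have "bij_betw (\<lambda>(r, \<psi>). restrict (\<psi> \<circ> r) V) ?S ?T"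
  proof (rule bij_betw_byWitness[where f' = "\<lambda>\<phi>. (ker_rep V \<phi>, restrict \<phi> (ker_rep V \<phi> ` V))"])
    show "\<forall>x\<in>?S. (\<lambda>\<phi>. (ker_rep V \<phi>, restrict \<phi> (ker_rep V \<phi> ` V))) ((\<lambda>(r, \<psi>). restrict (\<psi> \<circ> r) V) x) = x"
    proof
      fix x assume "x \<in> ?S"
      then obtain r \<psi> where x: "x = (r, \<psi>)" and r: "r \<in> canon V" and \<psi>: "\<psi> \<in> injmaps (r ` V) N" by blast
      then have inj: "inj_on \<psi> (r ` V)" by (simp add: injmaps_def)
      have "restrict (restrict (\<psi> \<circ> r) V) (r ` V) = \<psi>"
      proof
        fix x
        show "restrict (restrict (\<psi> \<circ> r) V) (r ` V) x = \<psi> x"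
          using r \<psi> by (cases "x \<in> r ` V") (auto simp: canon_def injmaps_def PiE_def extensional_def)
      qed
      then show "(\<lambda>\<phi>. (ker_rep V \<phi>, restrict \<phi> (ker_rep V \<phi> ` V))) ((\<lambda>(r, \<psi>). restrict (\<psi> \<circ> r) V) x) = x"
        by (simp add: x ker_rep_comp[OF V r inj] del: restrict_apply)
    qed
    show "\<forall>\<phi>\<in>?T. (\<lambda>(r, \<psi>). restrict (\<psi> \<circ> r) V) (ker_rep V \<phi>, restrict \<phi> (ker_rep V \<phi> ` V)) = \<phi>"
    proof
      fix \<phi> assume "\<phi> \<in> ?T"
      then have \<phi>: "\<phi> \<in> V \<rightarrow>\<^sub>E {..<N}" by simp
      have "restrict (restrict \<phi> (ker_rep V \<phi> ` V) \<circ> ker_rep V \<phi>) V = \<phi>"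
      proof
        fix x
        show "restrict (restrict \<phi> (ker_rep V \<phi> ` V) \<circ> ker_rep V \<phi>) V x = \<phi> x"
          using ker_rep(2)[OF V, of x \<phi>] \<phi> by (cases "x \<in> V") (auto simp: PiE_def extensional_def)
      qed
      then show "(\<lambda>(r, \<psi>). restrict (\<psi> \<circ> r) V) (ker_rep V \<phi>, restrict \<phi> (ker_rep V \<phi> ` V)) = \<phi>"
        by simp
    qed
    show "(\<lambda>(r, \<psi>). restrict (\<psi> \<circ> r) V) ` ?S \<subseteq> ?T"
    proof (rule image_subsetI)
      fix x assume "x \<in> ?S"
      then obtain r \<psi> where x: "x = (r, \<psi>)" and r: "r \<in> canon V" "P r" and \<psi>: "\<psi> \<in> injmaps (r ` V) N"
        by blast
      then have inj: "inj_on \<psi> (r ` V)" by (simp add: injmaps_def)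
      have "restrict (\<psi> \<circ> r) V \<in> V \<rightarrow>\<^sub>E {..<N}"
        using \<psi> by (auto simp: injmaps_def)
      then show "(\<lambda>(r, \<psi>). restrict (\<psi> \<circ> r) V) x \<in> ?T"
        using r(2) by (simp add: x ker_rep_comp[OF V r(1) inj] del: restrict_apply)
    qed
    show "(\<lambda>\<phi>. (ker_rep V \<phi>, restrict \<phi> (ker_rep V \<phi> ` V))) ` ?T \<subseteq> ?S"
    proof (rule image_subsetI)
      fix \<phi> assume T: "\<phi> \<in> ?T"
      then have \<phi>: "\<phi> \<in> V \<rightarrow>\<^sub>E {..<N}" by simp
      have "restrict \<phi> (ker_rep V \<phi> ` V) \<in> injmaps (ker_rep V \<phi> ` V) N"
        unfolding injmaps_def
      proof (intro CollectI conjI inj_onI)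
        have "ker_rep V \<phi> ` V \<subseteq> V" using ker_rep(1)[OF V] by blast
        then show "restrict \<phi> (ker_rep V \<phi> ` V) \<in> ker_rep V \<phi> ` V \<rightarrow>\<^sub>E {..<N}"
          using \<phi> by (intro restrict_PiE_iff[THEN iffD2]) (auto intro: PiE_mem)
        fix x y assume xy: "x \<in> ker_rep V \<phi> ` V" "y \<in> ker_rep V \<phi> ` V"
          "restrict \<phi> (ker_rep V \<phi> ` V) x = restrict \<phi> (ker_rep V \<phi> ` V) y"
        then obtain v u where vu: "v \<in> V" "x = ker_rep V \<phi> v" "u \<in> V" "y = ker_rep V \<phi> u" by blast
        then have "\<phi> v = \<phi> u" using xy(3) ker_rep(2)[OF V, of _ \<phi>] by simp
        then show "x = y" using vu ker_rep_eq_iff[OF V, of v u \<phi>] by simp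
      qed
      then show "(ker_rep V \<phi>, restrict \<phi> (ker_rep V \<phi> ` V)) \<in> ?S"
        using T ker_rep_canon[OF V] by simp
    qed
  qed
  from sum.reindex_bij_betw[OF this, of g] show ?thesis
    using V by (subst sum.Sigma) (auto simp: case_prod_unfold)
qed

lemma isum_by_kernel:
  assumes V: "finite V" "t ` B \<union> h ` B \<subseteq> V"
  shows "(\<Sum>\<phi> | \<phi> \<in> V \<rightarrow>\<^sub>E {..<N} \<and> P (ker_rep V \<phi>). \<Prod>e\<in>B. w e (\<phi> (t e)) (\<phi> (h e))) =
    (\<Sum>r | r \<in> canon V \<and> P r. isum N (r ` V) (r \<circ> t) (r \<circ> h) B w)"
  unfolding sum_maps_by_kernel[OF V(1)] isum_def
  using V(2) by (intro sum.cong prod.cong refl) auto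

lemma inj_on_ker_rep:
  assumes "finite V" "C \<subseteq> V"
  shows "inj_on (ker_rep V \<phi>) C \<longleftrightarrow> inj_on \<phi> C"
proof -
  have "ker_rep V \<phi> x = ker_rep V \<phi> y \<longleftrightarrow> \<phi> x = \<phi> y" if "x \<in> C" "y \<in> C" for x y
    using that assms by (intro ker_rep_eq_iff) auto
  then show ?thesis by (auto simp: inj_on_def)
qed

text \<open>A family of injective maps, one on each component, amounts to one map on
  \<open>V\<close> that is injective on each component. Values may still collide across components.
  Gluing and restricting are the two directions of this identification.\<close>

lemma prod_isum_comps:
  assumes V: "finite V" "finite B" "t ` B \<union> h ` B \<subseteq> V"
  shows "(\<Prod>C\<in>comps t h V B. isum N C t h {e \<in> B. t e \<in> C} w) =
    (\<Sum>\<phi> | \<phi> \<in> V \<rightarrow>\<^sub>E {..<N} \<and> (\<forall>C\<in>comps t h V B. inj_on \<phi> C). \<Prod>e\<in>B. w e (\<phi> (t e)) (\<phi> (h e)))"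
proof -
  let ?K = "comps t h V B"
  let ?cls = "\<lambda>v. conn t h B `` {v}"
  let ?I = "\<lambda>C. injmaps C N"
  let ?p = "\<lambda>C \<phi>. \<Prod>e\<in>{e \<in> B. t e \<in> C}. w e (\<phi> (t e)) (\<phi> (h e))"
  have sub: "C \<subseteq> V" "finite C" if "C \<in> ?K" for C
    using comps_subset[OF V(3) that] finite_subset[OF comps_subset[OF V(3) that] V(1)] .
  have cls: "?cls v = C" if "C \<in> ?K" "v \<in> C" for C v
    using comps_eq_class[OF that] by blast
  have clsK: "?cls v \<in> ?K" if "v \<in> V" for v using that by (auto simp: comps_def)
  have glue: "restrict (\<lambda>v. g (?cls v) v) V v = g C v" if "C \<in> ?K" "v \<in> C" for g v C
    using cls[OF that] sub(1)[OF that(1)] that(2) by auto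
  have "(\<Prod>C\<in>?K. isum N C t h {e \<in> B. t e \<in> C} w) = (\<Sum>g\<in>PiE ?K ?I. \<Prod>C\<in>?K. ?p C (g C))"
    unfolding isum_def by (intro prod_sum_PiE finite_comps V finite_injmaps sub(2))
  also have "\<dots> = (\<Sum>\<phi> | \<phi> \<in> V \<rightarrow>\<^sub>E {..<N} \<and> (\<forall>C\<in>?K. inj_on \<phi> C). \<Prod>C\<in>?K. ?p C \<phi>)"
  proof (rule sum.reindex_bij_witness[where j = "\<lambda>g. restrict (\<lambda>v. g (?cls v) v) V"
        and i = "\<lambda>\<phi>. restrict (\<lambda>C. restrict \<phi> C) ?K"])
    fix g assume g: "g \<in> PiE ?K ?I"
    show "restrict (\<lambda>C. restrict (restrict (\<lambda>v. g (?cls v) v) V) C) ?K = g"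
    proof
      fix C
      show "restrict (\<lambda>C. restrict (restrict (\<lambda>v. g (?cls v) v) V) C) ?K C = g C"
      proof (cases "C \<in> ?K")
        case True
        then have "g C \<in> extensional C" using g by (auto simp: injmaps_def PiE_def Pi_def)
        have "restrict (restrict (\<lambda>v. g (?cls v) v) V) C x = g C x" for x
          using glue[OF True, of x g] \<open>g C \<in> extensional C\<close> by (cases "x \<in> C") (auto simp: extensional_def)
        then show ?thesis using True by auto
      next
        case False
        then show ?thesis using g by (auto simp: PiE_def extensional_def)
      qed
    qed
    have gC: "g C \<in> C \<rightarrow>\<^sub>E {..<N}" "inj_on (g C) C" if "C \<in> ?K" for C
      using g that by (auto simp: injmaps_def PiE_def Pi_def)
    show "restrict (\<lambda>v. g (?cls v) v) V \<in> {\<phi>. \<phi> \<in> V \<rightarrow>\<^sub>E {..<N} \<and> (\<forall>C\<in>?K. inj_on \<phi> C)}"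
    proof (intro CollectI conjI ballI)
      have "g (?cls v) v \<in> {..<N}" if "v \<in> V" for v
        using gC(1)[OF clsK[OF that]] by (rule PiE_mem) simp
      then show "restrict (\<lambda>v. g (?cls v) v) V \<in> V \<rightarrow>\<^sub>E {..<N}"
        by (intro restrict_PiE_iff[THEN iffD2] ballI)
      fix C assume C: "C \<in> ?K"
      have "inj_on (restrict (\<lambda>v. g (?cls v) v) V) C \<longleftrightarrow> inj_on (g C) C"
        by (rule inj_on_cong) (rule glue[OF C])
      then show "inj_on (restrict (\<lambda>v. g (?cls v) v) V) C" using gC(2)[OF C] by simp
    qed
    show "(\<Prod>C\<in>?K. ?p C (restrict (\<lambda>v. g (?cls v) v) V)) = (\<Prod>C\<in>?K. ?p C (g C))"
    proof (intro prod.cong refl)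
      fix C e assume C: "C \<in> ?K" and e: "e \<in> {e \<in> B. t e \<in> C}"
      then have "h e \<in> C" using comps_arc_iff[OF C, of e] by simp
      then show "w e (restrict (\<lambda>v. g (?cls v) v) V (t e)) (restrict (\<lambda>v. g (?cls v) v) V (h e)) =
          w e (g C (t e)) (g C (h e))"
        using e glue[OF C, of _ g] by simp
    qed
  next
    fix \<phi> assume \<phi>: "\<phi> \<in> {\<phi>. \<phi> \<in> V \<rightarrow>\<^sub>E {..<N} \<and> (\<forall>C\<in>?K. inj_on \<phi> C)}"
    show "restrict (\<lambda>v. restrict (\<lambda>C. restrict \<phi> C) ?K (?cls v) v) V = \<phi>"
    proof
      fix x
      show "restrict (\<lambda>v. restrict (\<lambda>C. restrict \<phi> C) ?K (?cls v) v) V x = \<phi> x"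
        using \<phi> clsK[of x] by (cases "x \<in> V") (simp_all add: PiE_def extensional_def)
    qed
    show "restrict (\<lambda>C. restrict \<phi> C) ?K \<in> PiE ?K ?I"
    proof (intro restrict_PiE_iff[THEN iffD2] ballI)
      fix C assume C: "C \<in> ?K"
      have "restrict \<phi> C \<in> C \<rightarrow>\<^sub>E {..<N}"
        using \<phi> sub(1)[OF C] by (intro restrict_PiE_iff[THEN iffD2]) (auto intro: PiE_mem)
      then show "restrict \<phi> C \<in> injmaps C N"
        using \<phi> C by (auto simp: injmaps_def)
    qed
  qed
  also have "\<dots> = (\<Sum>\<phi> | \<phi> \<in> V \<rightarrow>\<^sub>E {..<N} \<and> (\<forall>C\<in>?K. inj_on \<phi> C). \<Prod>e\<in>B. w e (\<phi> (t e)) (\<phi> (h e)))"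
  proof (rule sum.cong[OF refl])
    fix \<phi>
    have U: "B = (\<Union>C\<in>?K. {e \<in> B. t e \<in> C})"
      using V(3) comps_Union[OF V(3)] by blast
    have "(\<Prod>e\<in>(\<Union>C\<in>?K. {e \<in> B. t e \<in> C}). w e (\<phi> (t e)) (\<phi> (h e))) = (\<Prod>C\<in>?K. ?p C \<phi>)"
    proof (rule prod.UNION_disjoint)
      show "\<forall>C\<in>?K. \<forall>D\<in>?K. C \<noteq> D \<longrightarrow> {e \<in> B. t e \<in> C} \<inter> {e \<in> B. t e \<in> D} = {}"
        using cls by blast
    qed (use V in auto)
    then show "(\<Prod>C\<in>?K. ?p C \<phi>) = (\<Prod>e\<in>B. w e (\<phi> (t e)) (\<phi> (h e)))"
      using U by simp
  qed
  finally show ?thesis .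
qed

text \<open>Injectivity on the components depends only on the kernel of a map, so the maps can be
  sorted by kernel. The trivial kernel gives the injective sum of the whole graph, the others give
  those of its quotients.\<close>

lemma prod_isum_comps_expand:
  assumes V: "finite V" "finite B" "t ` B \<union> h ` B \<subseteq> V"
  shows "(\<Prod>C\<in>comps t h V B. isum N C t h {e \<in> B. t e \<in> C} w) =
    (\<Sum>r | r \<in> canon V \<and> (\<forall>C\<in>comps t h V B. inj_on r C). isum N (r ` V) (r \<circ> t) (r \<circ> h) B w)"
proof -
  have eq: "(\<forall>C\<in>comps t h V B. inj_on \<phi> C) \<longleftrightarrow> (\<forall>C\<in>comps t h V B. inj_on (ker_rep V \<phi>) C)" for \<phi>
    by (intro ball_cong refl inj_on_ker_rep[OF V(1), symmetric] comps_subset[OF V(3)])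
  have "{\<phi>. \<phi> \<in> V \<rightarrow>\<^sub>E {..<N} \<and> (\<forall>C\<in>comps t h V B. inj_on \<phi> C)} =
      {\<phi>. \<phi> \<in> V \<rightarrow>\<^sub>E {..<N} \<and> (\<forall>C\<in>comps t h V B. inj_on (ker_rep V \<phi>) C)}"
    using eq by blast
  then show ?thesis
    unfolding prod_isum_comps[OF V]
    using isum_by_kernel[OF V(1,3), where P = "\<lambda>r. \<forall>C\<in>comps t h V B. inj_on r C"] by simp
qed

lemma isum_id:
  assumes "t ` B \<union> h ` B \<subseteq> V"
  shows "isum N (restrict (\<lambda>v. v) V ` V) (restrict (\<lambda>v. v) V \<circ> t) (restrict (\<lambda>v. v) V \<circ> h) B w = isum N V t h B w"
proof -
  have "restrict (\<lambda>v. v) V ` V = V" by auto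
  then show ?thesis
    unfolding isum_def using assms by (intro sum.cong prod.cong) auto
qed

section \<open>Quotients by identification of vertices\<close>

definition quot :: "(nat, 'b) pre_digraph \<Rightarrow> (nat \<Rightarrow> nat) \<Rightarrow> (nat, 'b) pre_digraph" where
  "quot G r = \<lparr>verts = r ` verts G, arcs = arcs G, tail = r \<circ> tail G, head = r \<circ> head G\<rparr>"

lemma quot_simps [simp]:
  "verts (quot G r) = r ` verts G" "arcs (quot G r) = arcs G"
  "tail (quot G r) = r \<circ> tail G" "head (quot G r) = r \<circ> head G"
  by (simp_all add: quot_def)

lemma fin_digraph_quot: "fin_digraph G \<Longrightarrow> fin_digraph (quot G r)"
proof -
  assume "fin_digraph G"
  then interpret fin_digraph G .
  show ?thesis by unfold_locales auto
qed

lemma conn_quot: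
  assumes "(u, v) \<in> gconn G B"
  shows "(r u, r v) \<in> gconn (quot G r) B"
proof (rule conn_least[OF _ assms])
  fix e assume "e \<in> B"
  then show "(r (tail G e), r (head G e)) \<in> gconn (quot G r) B"
    using conn_arc[of e B "tail (quot G r)" "head (quot G r)"] by simp
qed

lemma connected_quot:
  assumes "fin_digraph G" "Digraph_Component.connected G"
  shows "Digraph_Component.connected (quot G r)"
proof -
  interpret fin_digraph G by fact
  interpret Q: fin_digraph "quot G r" by (rule fin_digraph_quot) fact
  show ?thesis
    using assms(2) conn_quot[of _ _ G "arcs G" r]
    unfolding connected_iff_conn[OF wf_digraph_axioms] connected_iff_conn[OF Q.wf_digraph_axioms]
    by auto
qed

text \<open>The degrees at a vertex of the quotient are the sums of the degrees over its
  fibre.\<close>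

lemma balanced_quot:
  assumes "fin_digraph G" "\<And>v. v \<in> verts G \<Longrightarrow> balanced_at (tail G) (head G) (arcs G) v"
  shows "balanced_at (tail (quot G r)) (head (quot G r)) (arcs (quot G r)) v"
proof -
  interpret fin_digraph G by fact
  let ?S = "{u \<in> verts G. r u = v}"
  have "card {e \<in> arcs G. tail G e \<in> ?S} = card {e \<in> arcs G. head G e \<in> ?S}"
  proof -
    have S: "finite ?S" by simp
    show ?thesis
      unfolding card_vimage_sum[OF finite_arcs S]
      using assms(2) by (intro sum.cong refl) (simp add: balanced_at_def)
  qed
  moreover have "{e \<in> arcs G. tail G e \<in> ?S} = {e \<in> arcs G. r (tail G e) = v}"
    "{e \<in> arcs G. head G e \<in> ?S} = {e \<in> arcs G. r (head G e) = v}" by auto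
  ultimately show ?thesis by (simp add: balanced_at_def)
qed

text \<open>Arcs keep their names in a quotient, so \<open>YA\<close>, \<open>key\<close> and hence
  the number of groups do not change, even where arcs of different keys become parallel.\<close>

lemma grouped_graph_quot:
  assumes "grouped_graph G YA key"
  shows "grouped_graph (quot G r) YA key"
proof -
  interpret grouped_graph G YA key by fact
  interpret Q: fin_digraph "quot G r" by (rule fin_digraph_quot) (rule fin_digraph_axioms)
  show ?thesis
  proof unfold_locales
    show "Digraph_Component.connected (quot G r)" by (rule connected_quot[OF fin_digraph_axioms con])
    show "balanced_at (tail (quot G r)) (head (quot G r)) (arcs (quot G r)) v" for v
      by (rule balanced_quot[OF fin_digraph_axioms bal])
    show "YA \<subseteq> arcs (quot G r)" using YA by simp
    fix e e' assume "e \<in> arcs (quot G r) - YA" "e' \<in> arcs (quot G r) - YA" "key e = key e'"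
    then have "{tail G e, head G e} = {tail G e', head G e'}" by (intro key) simp_all
    then have "r ` {tail G e, head G e} = r ` {tail G e', head G e'}" by simp
    then show "{tail (quot G r) e, head (quot G r) e} = {tail (quot G r) e', head (quot G r) e'}" by simp
  qed
qed

text \<open>The components of the quotient come from those of \<open>G\<close> by the surjection
  \<open>q\<close>. A nontrivial \<open>r\<close> identifies some \<open>v\<close> with
  \<open>r v\<close>; being injective on components, it does so across two of them, which
  \<open>q\<close> then merges.\<close>

lemma card_comps_quot_less:
  assumes "finite (verts G)" "tail G ` B \<union> head G ` B \<subseteq> verts G" "r \<in> canon (verts G)"
    and inj: "\<And>C. C \<in> gcomps G B \<Longrightarrow> inj_on r C" and ne: "r \<noteq> restrict (\<lambda>v. v) (verts G)"
  shows "card (gcomps (quot G r) B) < card (gcomps G B)"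
proof -
  define q where "q C = gconn (quot G r) B `` (r ` C)" for C
  have q: "q (gconn G B `` {v}) = gconn (quot G r) B `` {r v}" for v
  proof
    show "q (gconn G B `` {v}) \<subseteq> gconn (quot G r) B `` {r v}"
      unfolding q_def using conn_quot[of v _ G B r]
        conn_trans[of "r v" _ "tail (quot G r)" "head (quot G r)" B] by blast
    show "gconn (quot G r) B `` {r v} \<subseteq> q (gconn G B `` {v})"
      unfolding q_def by blast
  qed
  have im: "gcomps (quot G r) B = q ` gcomps G B"
    unfolding comps_def[of "tail (quot G r)"] comps_def[of "tail G"] by (simp add: image_image q)
  obtain v where v: "v \<in> verts G" "r v \<noteq> v" "r v \<in> verts G" "r (r v) = r v"
    using canon_nontrivial[OF assms(3) ne] .
  let ?C = "gconn G B `` {v}" and ?D = "gconn G B `` {r v}"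
  have CD: "?C \<in> gcomps G B" "?D \<in> gcomps G B" using v by (auto simp: comps_def)
  have "?C \<noteq> ?D"
  proof
    assume "?C = ?D"
    then have "r v \<in> ?C" "v \<in> ?C" by auto
    then show False using inj[OF CD(1)] v(2,4) by (auto dest: inj_onD)
  qed
  moreover have "q ?C = q ?D" using v(4) by (simp only: q)
  ultimately have "\<not> inj_on q (gcomps G B)" using CD by (auto dest: inj_onD)
  then have "card (q ` gcomps G B) \<noteq> card (gcomps G B)"
    using assms(1) eq_card_imp_inj_on[of "gcomps G B" q] by auto
  then show ?thesis
    unfolding im using card_image_le[of "gcomps G B" q] assms(1) by simp
qed

section \<open>The part of the traffic carried by the arbitrary matrices\<close>

text \<open>The class of variables with all moments is closed under sums, products and conjugation,
  so every polynomial in the matrix entries is integrable at once.\<close>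

definition has_moments :: "'w measure \<Rightarrow> ('w \<Rightarrow> complex) \<Rightarrow> bool" where
  "has_moments M f \<longleftrightarrow> f \<in> borel_measurable M \<and> (\<forall>k::nat. integrable M (\<lambda>\<omega>. cmod (f \<omega>) ^ k))"

lemma has_moments_integrable: "has_moments M f \<Longrightarrow> integrable M f"
proof -
  assume f: "has_moments M f"
  then have "\<forall>k. integrable M (\<lambda>\<omega>. cmod (f \<omega>) ^ k)" by (simp add: has_moments_def)
  then have "integrable M (\<lambda>\<omega>. cmod (f \<omega>) ^ 1)" by (rule spec)
  then have "integrable M (\<lambda>\<omega>. norm (f \<omega>))" by (simp only: power_one_right)
  moreover have "f \<in> borel_measurable M" using f unfolding has_moments_def by (rule conjunct1)
  ultimately show ?thesis by (rule integrable_norm_cancel)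
qed

lemma has_moments_cong:
  "(\<And>\<omega>. \<omega> \<in> space M \<Longrightarrow> f \<omega> = g \<omega>) \<Longrightarrow> has_moments M f \<longleftrightarrow> has_moments M g"
  unfolding has_moments_def
  by (intro conj_cong measurable_cong all_cong1 Bochner_Integration.integrable_cong) auto

lemma has_moments_const: "finite_measure M \<Longrightarrow> has_moments M (\<lambda>_. c)"
  by (simp add: has_moments_def finite_measure.integrable_const)

lemma has_moments_cnj: "has_moments M f \<Longrightarrow> has_moments M (\<lambda>\<omega>. cnj (f \<omega>))"
  unfolding has_moments_def
  using measurable_compose[OF _ borel_measurable_continuous_onI[OF continuous_on_cnj[OF continuous_on_id]], of f M]
  by auto

lemma has_moments_mult:
  assumes "has_moments M f" "has_moments M g"
  shows "has_moments M (\<lambda>\<omega>. f \<omega> * g \<omega>)"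
proof -
  have m: "f \<in> borel_measurable M" "g \<in> borel_measurable M"
    and i: "integrable M (\<lambda>\<omega>. cmod (f \<omega>) ^ k)" "integrable M (\<lambda>\<omega>. cmod (g \<omega>) ^ k)" for k
    using assms by (auto simp: has_moments_def)
  have "integrable M (\<lambda>\<omega>. cmod (f \<omega> * g \<omega>) ^ k)" for k
  proof (rule Bochner_Integration.integrable_bound)
    show "integrable M (\<lambda>\<omega>. cmod (f \<omega>) ^ (k + k) + cmod (g \<omega>) ^ (k + k))"
      by (intro Bochner_Integration.integrable_add i)
    show "AE \<omega> in M. norm (cmod (f \<omega> * g \<omega>) ^ k) \<le> norm (cmod (f \<omega>) ^ (k + k) + cmod (g \<omega>) ^ (k + k))"
    proof (rule AE_I2)
      fix \<omega>
      let ?a = "cmod (f \<omega>) ^ k" and ?b = "cmod (g \<omega>) ^ k"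
      have "2 * (?a * ?b) \<le> ?a * ?a + ?b * ?b"
        using sum_squares_bound[of ?a ?b] by (simp add: power2_eq_square mult.assoc)
      moreover have "0 \<le> ?a * ?b" by simp
      ultimately have "?a * ?b \<le> ?a * ?a + ?b * ?b" by linarith
      then show "norm (cmod (f \<omega> * g \<omega>) ^ k) \<le> norm (cmod (f \<omega>) ^ (k + k) + cmod (g \<omega>) ^ (k + k))"
        by (simp add: norm_mult power_mult_distrib power_add)
    qed
    show "(\<lambda>\<omega>. cmod (f \<omega> * g \<omega>) ^ k) \<in> borel_measurable M" using m by measurable
  qed
  then show ?thesis using m by (auto simp: has_moments_def)
qed

lemma has_moments_add:
  assumes "has_moments M f" "has_moments M g"
  shows "has_moments M (\<lambda>\<omega>. f \<omega> + g \<omega>)"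
proof -
  have m: "f \<in> borel_measurable M" "g \<in> borel_measurable M"
    and i: "integrable M (\<lambda>\<omega>. cmod (f \<omega>) ^ k)" "integrable M (\<lambda>\<omega>. cmod (g \<omega>) ^ k)" for k
    using assms by (auto simp: has_moments_def)
  have "integrable M (\<lambda>\<omega>. cmod (f \<omega> + g \<omega>) ^ k)" for k
  proof (rule Bochner_Integration.integrable_bound)
    show "integrable M (\<lambda>\<omega>. 2 ^ k * (cmod (f \<omega>) ^ k + cmod (g \<omega>) ^ k))"
      by (intro Bochner_Integration.integrable_add integrable_mult_right i)
    show "AE \<omega> in M. norm (cmod (f \<omega> + g \<omega>) ^ k) \<le> norm (2 ^ k * (cmod (f \<omega>) ^ k + cmod (g \<omega>) ^ k))"
    proof (rule AE_I2)
      fix \<omega>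
      let ?m = "max (cmod (f \<omega>)) (cmod (g \<omega>))"
      have "cmod (f \<omega> + g \<omega>) \<le> 2 * ?m"
        using norm_triangle_ineq[of "f \<omega>" "g \<omega>"] by (simp add: max_def)
      then have "cmod (f \<omega> + g \<omega>) ^ k \<le> (2 * ?m) ^ k" by (rule power_mono) simp
      also have "\<dots> = 2 ^ k * ?m ^ k" by (rule power_mult_distrib)
      also have "?m ^ k \<le> cmod (f \<omega>) ^ k + cmod (g \<omega>) ^ k" by (simp add: max_def)
      finally show "norm (cmod (f \<omega> + g \<omega>) ^ k) \<le> norm (2 ^ k * (cmod (f \<omega>) ^ k + cmod (g \<omega>) ^ k))"
        by simp
    qed
    show "(\<lambda>\<omega>. cmod (f \<omega> + g \<omega>) ^ k) \<in> borel_measurable M" using m by measurable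
  qed
  then show ?thesis using m by (auto simp: has_moments_def)
qed

lemma has_moments_sum:
  assumes "finite_measure M" "\<And>i. i \<in> I \<Longrightarrow> has_moments M (f i)"
  shows "has_moments M (\<lambda>\<omega>. \<Sum>i\<in>I. f i \<omega>)"
  using assms(2)
  by (induction I rule: infinite_finite_induct)
    (auto simp: has_moments_const[OF assms(1)] intro: has_moments_add)

lemma has_moments_prod:
  assumes "finite_measure M" "\<And>i. i \<in> I \<Longrightarrow> has_moments M (f i)"
  shows "has_moments M (\<lambda>\<omega>. \<Prod>i\<in>I. f i \<omega>)"
  using assms(2)
  by (induction I rule: infinite_finite_induct)
    (auto simp: has_moments_const[OF assms(1)] intro: has_moments_mult)

definition ew :: "('y \<Rightarrow> complex mat) \<Rightarrow> (nat \<Rightarrow> 'y letter) \<Rightarrow> nat \<Rightarrow> nat \<Rightarrow> nat \<Rightarrow> complex" where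
  "ew A l e i j = letter_mat A (l e) $$ (i, j)"

lemma mat_adjoint_entry:
  assumes "A \<in> carrier_mat N N" "i < N" "j < N"
  shows "mat_adjoint A $$ (i, j) = cnj (A $$ (j, i))"
  using assms by (simp add: mat_adjoint_def mat_of_rows_def conjugate_complex_def)

lemma has_moments_ew:
  assumes "random_matrix M (A (fst (l e)))" "N > 0" "i < N" "j < N"
  shows "has_moments (M N) (\<lambda>\<omega>. ew (\<lambda>y. A y N \<omega>) l e i j)"
proof -
  obtain y s where l: "l e = (y, s)" by fastforce
  have carrier: "A y N \<omega> \<in> carrier_mat N N" if "\<omega> \<in> space (M N)" for \<omega>
    using assms that l by (auto simp: random_matrix_def)
  have ent: "has_moments (M N) (\<lambda>\<omega>. A y N \<omega> $$ (i, j))" if "i < N" "j < N" for i j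
    using assms that l by (auto simp: random_matrix_def has_moments_def)
  show ?thesis
  proof (cases s)
    case True
    have "has_moments (M N) (\<lambda>\<omega>. cnj (A y N \<omega> $$ (j, i)))"
      using assms by (intro has_moments_cnj ent)
    moreover have "ew (\<lambda>y. A y N \<omega>) l e i j = cnj (A y N \<omega> $$ (j, i))" if "\<omega> \<in> space (M N)" for \<omega>
      using True assms mat_adjoint_entry[OF carrier[OF that]] by (simp add: ew_def l)
    ultimately show ?thesis by (subst has_moments_cong) auto
  next
    case False
    then show ?thesis using ent[OF assms(3,4)] by (simp add: ew_def l)
  qed
qed

lemma has_moments_prod_ew:
  assumes "prob_space (M N)" "\<And>e. e \<in> B \<Longrightarrow> random_matrix M (A (fst (l e)))" "N > 0"
    and "\<And>e. e \<in> B \<Longrightarrow> \<phi> (t e) < N \<and> \<phi> (h e) < N"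
  shows "has_moments (M N) (\<lambda>\<omega>. \<Prod>e\<in>B. ew (\<lambda>y. A y N \<omega>) l e (\<phi> (t e)) (\<phi> (h e)))"
  using assms by (intro has_moments_prod prob_space.finite_measure has_moments_ew) auto

lemma has_moments_isum:
  assumes "prob_space (M N)" "\<And>e. e \<in> B \<Longrightarrow> random_matrix M (A (fst (l e)))" "N > 0"
    and "t ` B \<union> h ` B \<subseteq> V"
  shows "has_moments (M N) (\<lambda>\<omega>. isum N V t h B (ew (\<lambda>y. A y N \<omega>) l))"
  unfolding isum_def
proof (intro has_moments_sum prob_space.finite_measure assms(1))
  fix \<phi> assume "\<phi> \<in> injmaps V N"
  then have "\<phi> v < N" if "v \<in> V" for v using that by (auto simp: injmaps_def)
  then show "has_moments (M N) (\<lambda>\<omega>. \<Prod>e\<in>B. ew (\<lambda>y. A y N \<omega>) l e (\<phi> (t e)) (\<phi> (h e)))"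
    using assms by (intro has_moments_prod_ew) auto
qed

lemma inj_traffic_isum:
  "inj_traffic N A T = 1 / of_nat N *
    isum N (verts (shape T)) (tail (shape T)) (head (shape T)) (arcs (shape T)) (ew A (lbl T))"
  by (simp add: inj_traffic_def isum_def injmaps_def edge_weight_def ew_def)

lemma tendsto_prod_list_mean:
  assumes "\<And>T. T \<in> set Ts \<Longrightarrow> f T \<longlonglongrightarrow> g T"
  shows "(\<lambda>N. \<Prod>T\<leftarrow>Ts. f T N) \<longlonglongrightarrow> (\<Prod>T\<leftarrow>Ts. g T :: complex)"
  using assms by (induction Ts) (auto intro!: tendsto_mult)

lemma prod_list_map_distinct: "distinct xs \<Longrightarrow> (\<Prod>x\<leftarrow>xs. f x) = (\<Prod>x\<in>set xs. f x :: 'a :: comm_monoid_mult)"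
  by (induction xs) auto

lemma sum_list_map_distinct: "distinct xs \<Longrightarrow> (\<Sum>x\<leftarrow>xs. f x) = (\<Sum>x\<in>set xs. f x :: 'a :: comm_monoid_add)"
  by (induction xs) auto

definition comp_test :: "(nat, nat) pre_digraph \<Rightarrow> nat set \<Rightarrow> (nat \<Rightarrow> 'y letter) \<Rightarrow> nat set \<Rightarrow> 'y test_graph" where
  "comp_test G B l C = \<lparr>shape = comp_graph G B C, lbl = l\<rparr>"

section \<open>Expansion over quotients and the limit of the \<open>Y\<close> part\<close>

locale traffic_family =
  fixes M :: "nat \<Rightarrow> 'w measure" and Y :: "'y \<Rightarrow> 'w rmat" and V :: "'y set"
  assumes prob: "\<And>N. N > 0 \<Longrightarrow> prob_space (M N)"
    and rm: "\<And>y. y \<in> V \<Longrightarrow> random_matrix M (Y y)"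
    and conv: "traffic_convergence M Y V"
    and conc: "traffic_concentration M Y V"
    and tight: "traffic_tightness M Y V"
begin

definition mean_isum :: "(nat, nat) pre_digraph \<Rightarrow> nat set \<Rightarrow> (nat \<Rightarrow> 'y letter) \<Rightarrow> nat \<Rightarrow> complex" where
  "mean_isum G YA l N = (\<integral>\<omega>. isum N (verts G) (tail G) (head G) YA (ew (\<lambda>y. Y y N \<omega>) l) \<partial>M N)"

text \<open>The power of \<open>N\<close> undoes the factor \<open>1 / N\<close> of each single
  traffic, so \<open>prod_isum_comps_expand\<close> applies outcome by outcome. The term of the
  trivial kernel is isolated, since its limit is the one sought.\<close>

lemma mean_prod_comps:
  assumes "grouped_graph G YA key" "\<And>e. e \<in> YA \<Longrightarrow> fst (l e) \<in> V" "N > 0"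
    and Cs: "set Cs = gcomps G YA" "distinct Cs"
  shows "of_nat N ^ card (gcomps G YA) * mean_inj_traffic_prod M Y (map (comp_test G YA l) Cs) N =
    mean_isum G YA l N + (\<Sum>r | r \<in> canon (verts G) \<and> (\<forall>C\<in>gcomps G YA. inj_on r C) \<and>
      r \<noteq> restrict (\<lambda>v. v) (verts G). mean_isum (quot G r) YA l N)"
proof -
  interpret grouped_graph G YA key by fact
  let ?R = "{r. r \<in> canon (verts G) \<and> (\<forall>C\<in>gcomps G YA. inj_on r C)}"
  let ?id = "restrict (\<lambda>v. v) (verts G)"
  let ?w = "\<lambda>\<omega>. ew (\<lambda>y. Y y N \<omega>) l"
  have sub: "tail G ` YA \<union> head G ` YA \<subseteq> verts G" by (rule wf_ends_subset[OF wf_digraph_axioms YA])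
  have fR: "finite ?R" by (rule finite_subset[OF _ finite_canon[OF finite_verts]]) blast
  have id: "?id \<in> ?R"
    using comps_subset[OF sub] by (auto simp: canon_def inj_on_def subset_iff)
  have "of_nat N ^ card (gcomps G YA) * (\<Prod>T\<leftarrow>map (comp_test G YA l) Cs. inj_traffic N (\<lambda>y. Y y N \<omega>) T) =
      (\<Sum>r\<in>?R. isum N (r ` verts G) (r \<circ> tail G) (r \<circ> head G) YA (?w \<omega>))" for \<omega>
  proof -
    have "(\<Prod>T\<leftarrow>map (comp_test G YA l) Cs. inj_traffic N (\<lambda>y. Y y N \<omega>) T) =
        (\<Prod>C\<in>gcomps G YA. inj_traffic N (\<lambda>y. Y y N \<omega>) (comp_test G YA l C))"
      using prod_list_map_distinct[OF Cs(2), of "\<lambda>C. inj_traffic N (\<lambda>y. Y y N \<omega>) (comp_test G YA l C)"] Cs(1)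
      by (simp add: comp_def)
    then have "of_nat N ^ card (gcomps G YA) * (\<Prod>T\<leftarrow>map (comp_test G YA l) Cs. inj_traffic N (\<lambda>y. Y y N \<omega>) T) =
        (\<Prod>C\<in>gcomps G YA. of_nat N * inj_traffic N (\<lambda>y. Y y N \<omega>) (comp_test G YA l C))"
      by (simp add: prod.distrib)
    also have "\<dots> = (\<Prod>C\<in>gcomps G YA. isum N C (tail G) (head G) {e \<in> YA. tail G e \<in> C} (?w \<omega>))"
      using assms(3) by (simp add: inj_traffic_isum comp_test_def)
    also have "\<dots> = (\<Sum>r\<in>?R. isum N (r ` verts G) (r \<circ> tail G) (r \<circ> head G) YA (?w \<omega>))"
      by (rule prod_isum_comps_expand[OF finite_verts finite_YA sub])
    finally show ?thesis .
  qed
  then have "of_nat N ^ card (gcomps G YA) * mean_inj_traffic_prod M Y (map (comp_test G YA l) Cs) N =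
      (\<integral>\<omega>. (\<Sum>r\<in>?R. isum N (r ` verts G) (r \<circ> tail G) (r \<circ> head G) YA (?w \<omega>)) \<partial>M N)"
    unfolding mean_inj_traffic_prod_def by (simp flip: integral_mult_right_zero)
  also have "\<dots> = (\<Sum>r\<in>?R. mean_isum (quot G r) YA l N)"
    unfolding mean_isum_def quot_simps
  proof (rule Bochner_Integration.integral_sum)
    show "integrable (M N) (\<lambda>\<omega>. isum N (r ` verts G) (r \<circ> tail G) (r \<circ> head G) YA (?w \<omega>))" for r
      using sub by (intro has_moments_integrable has_moments_isum prob rm assms(2,3)) auto
  qed
  also have "\<dots> = mean_isum (quot G ?id) YA l N + (\<Sum>r\<in>?R - {?id}. mean_isum (quot G r) YA l N)"
    by (rule sum.remove[OF fR id])
  also have "mean_isum (quot G ?id) YA l N = mean_isum G YA l N"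
    unfolding mean_isum_def quot_simps by (simp only: isum_id[OF sub])
  also have "?R - {?id} = {r. r \<in> canon (verts G) \<and> (\<forall>C\<in>gcomps G YA. inj_on r C) \<and> r \<noteq> ?id}" by blast
  finally show ?thesis .
qed

lemma mean_inj_traffic_lim:
  "cyclic_in V T \<Longrightarrow> mean_inj_traffic M Y T \<longlonglongrightarrow> lim (mean_inj_traffic M Y T)"
  using conv by (auto simp: traffic_convergence_def convergent_LIMSEQ_iff)

lemma mean_prod_tree:
  assumes "\<forall>T\<in>set Ts. cyclic_in V T"
  shows "mean_inj_traffic_prod M Y Ts \<longlonglongrightarrow> (\<Prod>T\<leftarrow>Ts. lim (mean_inj_traffic M Y T))"
proof -
  have "(\<lambda>N. (mean_inj_traffic_prod M Y Ts N - (\<Prod>T\<leftarrow>Ts. mean_inj_traffic M Y T N)) +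
      (\<Prod>T\<leftarrow>Ts. mean_inj_traffic M Y T N)) \<longlonglongrightarrow> 0 + (\<Prod>T\<leftarrow>Ts. lim (mean_inj_traffic M Y T))"
    using conc assms
    by (intro tendsto_add tendsto_prod_list_mean mean_inj_traffic_lim) (auto simp: traffic_concentration_def)
  then show ?thesis by simp
qed

text \<open>With \<open>n\<close> components and \<open>g\<close> groups, the bound
  \<open>2 * g\<close> on the leaf counts turns tightness into \<open>O(N powr (g - n))\<close>. The
  factor \<open>N ^ n\<close> cancels \<open>- n\<close>, and division by \<open>N ^ (1 + g)\<close>
  leaves \<open>1 / N\<close>.\<close>

lemma mean_prod_nontree:
  assumes "grouped_graph G YA key" "\<And>e. e \<in> YA \<Longrightarrow> fst (l e) \<in> V"
    and Cs: "set Cs = gcomps G YA" "distinct Cs"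
    and nt: "card (gcomps G YA) \<noteq> card (key ` (arcs G - YA)) + 1"
  shows "(\<lambda>N. of_nat N ^ card (gcomps G YA) * mean_inj_traffic_prod M Y (map (comp_test G YA l) Cs) N /
    of_nat N ^ (1 + card (key ` (arcs G - YA)))) \<longlonglongrightarrow> 0"
proof -
  interpret grouped_graph G YA key by fact
  let ?Ts = "map (comp_test G YA l) Cs"
  let ?n = "card (gcomps G YA)" and ?g = "card (key ` (arcs G - YA))"
  let ?s = "\<Sum>T\<leftarrow>?Ts. real (leaf_count (shape T)) / 2 - 1"
  have "\<forall>T\<in>set ?Ts. test_graph_in V T"
    using test_graph_in_YA_comp[OF assms(1) _ assms(2)] Cs(1) by (auto simp: comp_test_def)
  then have "(\<lambda>N. cmod (mean_inj_traffic_prod M Y ?Ts N)) \<in> O(\<lambda>N. real N powr ?s)"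
    using tight unfolding traffic_tightness_def by blast
  then obtain c where c: "c > 0"
    "eventually (\<lambda>N. norm (cmod (mean_inj_traffic_prod M Y ?Ts N)) \<le> c * norm (real N powr ?s)) at_top"
    by (elim landau_o.bigE)
  have "?s = (\<Sum>C\<in>gcomps G YA. real (leaf_count (comp_graph G YA C)) / 2 - 1)"
    using sum_list_map_distinct[OF Cs(2), of "\<lambda>C. real (leaf_count (comp_graph G YA C)) / 2 - 1"] Cs(1)
    by (simp add: comp_test_def comp_def)
  also have "\<dots> = real (\<Sum>C\<in>gcomps G YA. leaf_count (comp_graph G YA C)) / 2 - ?n"
    by (simp add: sum_subtractf sum_divide_distrib)
  also have "\<dots> \<le> real ?g - real ?n"
  proof -
    have "real (\<Sum>C\<in>gcomps G YA. leaf_count (comp_graph G YA C)) \<le> real (2 * ?g)"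
      using sum_leaf_count_le nt unfolding XA_def of_nat_le_iff by blast
    also have "\<dots> = 2 * real ?g" by simp
    finally show ?thesis by linarith
  qed
  finally have s: "?s \<le> real ?g - real ?n" .
  have ev: "eventually (\<lambda>N. cmod (of_nat N ^ ?n * mean_inj_traffic_prod M Y ?Ts N / of_nat N ^ (1 + ?g))
      \<le> c * inverse (real N)) at_top"
    using c(2) eventually_gt_at_top[of 0]
  proof eventually_elim
    case (elim N)
    have "cmod (of_nat N ^ ?n * mean_inj_traffic_prod M Y ?Ts N / of_nat N ^ (1 + ?g)) =
        real N ^ ?n * cmod (mean_inj_traffic_prod M Y ?Ts N) / real N ^ (1 + ?g)"
      by (simp add: norm_mult norm_divide norm_power)
    also have "\<dots> \<le> real N ^ ?n * (c * real N powr ?s) / real N ^ (1 + ?g)"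
      using elim by (intro divide_right_mono mult_left_mono) auto
    also have "\<dots> \<le> real N ^ ?n * (c * real N powr (real ?g - real ?n)) / real N ^ (1 + ?g)"
      using elim s c(1) by (intro divide_right_mono mult_left_mono powr_mono) auto
    also have "real N powr (real ?g - real ?n) = real N ^ ?g / real N ^ ?n"
      using elim by (simp add: powr_diff powr_realpow)
    finally show ?case using elim by (simp add: field_simps)
  qed
  have "(\<lambda>N. c * inverse (real N)) \<longlonglongrightarrow> 0"
    by (rule tendsto_mult_right_zero[OF lim_inverse_n])
  then show ?thesis by (rule Lim_null_comparison[OF ev])
qed

theorem mean_isum_limit:
  assumes "grouped_graph G YA key" "\<And>e. e \<in> YA \<Longrightarrow> fst (l e) \<in> V"
  shows "(\<lambda>N. mean_isum G YA l N / of_nat N ^ (1 + card (key ` (arcs G - YA)))) \<longlonglongrightarrow>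
    (if card (gcomps G YA) = card (key ` (arcs G - YA)) + 1
     then \<Prod>C\<in>gcomps G YA. lim (mean_inj_traffic M Y (comp_test G YA l C)) else 0)"
  using assms
proof (induction "card (verts G)" arbitrary: G rule: less_induct)
  case less
  interpret grouped_graph G YA key by fact
  let ?n = "card (gcomps G YA)" and ?g = "card (key ` (arcs G - YA))"
  let ?R = "{r. r \<in> canon (verts G) \<and> (\<forall>C\<in>gcomps G YA. inj_on r C) \<and> r \<noteq> restrict (\<lambda>v. v) (verts G)}"
  let ?L = "if ?n = ?g + 1 then \<Prod>C\<in>gcomps G YA. lim (mean_inj_traffic M Y (comp_test G YA l C)) else 0"
  have sub: "tail G ` YA \<union> head G ` YA \<subseteq> verts G" by (rule wf_ends_subset[OF wf_digraph_axioms YA])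
  obtain Cs where Cs: "set Cs = gcomps G YA" "distinct Cs"
    using finite_distinct_list[OF finite_comps[OF finite_verts]] by blast
  let ?Ts = "map (comp_test G YA l) Cs"
  \<comment> \<open>A proper quotient has strictly fewer components, hence at most as many as there
    are keys, and so it falls in the case with limit 0.\<close>
  have quotients: "(\<lambda>N. mean_isum (quot G r) YA l N / of_nat N ^ (1 + ?g)) \<longlonglongrightarrow> 0" if r: "r \<in> ?R" for r
  proof -
    have "card (gcomps (quot G r) YA) < ?n"
      using r by (intro card_comps_quot_less[OF finite_verts sub]) auto
    then have "card (gcomps (quot G r) YA) \<noteq> card (key ` (arcs (quot G r) - YA)) + 1"
      using card_comps_YA_le by (simp add: XA_def)
    moreover have "card (verts (quot G r)) < card (verts G)"
      using canon_card_less[OF finite_verts, of r] r by simp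
    ultimately show ?thesis
      using less.hyps[OF _ grouped_graph_quot[OF less.prems(1)] less.prems(2), of r] by simp
  qed
  have main: "(\<lambda>N. of_nat N ^ ?n * mean_inj_traffic_prod M Y ?Ts N / of_nat N ^ (1 + ?g)) \<longlonglongrightarrow> ?L"
  proof (cases "?n = ?g + 1")
    case True
    have "\<forall>T\<in>set ?Ts. cyclic_in V T"
      using cyclic_in_YA_comp[OF less.prems(1) _ less.prems(2) True] Cs(1) by (auto simp: comp_test_def)
    then have "mean_inj_traffic_prod M Y ?Ts \<longlonglongrightarrow> (\<Prod>T\<leftarrow>?Ts. lim (mean_inj_traffic M Y T))"
      by (rule mean_prod_tree)
    also have "(\<Prod>T\<leftarrow>?Ts. lim (mean_inj_traffic M Y T)) = ?L"
      using prod_list_map_distinct[OF Cs(2), of "\<lambda>C. lim (mean_inj_traffic M Y (comp_test G YA l C))"] Cs(1) True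
      by (simp add: comp_def)
    finally have "mean_inj_traffic_prod M Y ?Ts \<longlonglongrightarrow> ?L" .
    moreover have "eventually (\<lambda>N. mean_inj_traffic_prod M Y ?Ts N =
        of_nat N ^ ?n * mean_inj_traffic_prod M Y ?Ts N / of_nat N ^ (1 + ?g)) at_top"
      using eventually_gt_at_top[of 0] by eventually_elim (simp add: True)
    ultimately show ?thesis by (rule Lim_transform_eventually)
  next
    case False
    then show ?thesis using mean_prod_nontree[OF less.prems Cs False] by simp
  qed
  have "(\<lambda>N. of_nat N ^ ?n * mean_inj_traffic_prod M Y ?Ts N / of_nat N ^ (1 + ?g) -
      (\<Sum>r\<in>?R. mean_isum (quot G r) YA l N / of_nat N ^ (1 + ?g))) \<longlonglongrightarrow> ?L - (\<Sum>r\<in>?R. 0)"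
    by (intro tendsto_diff tendsto_sum main quotients)
  then have "(\<lambda>N. of_nat N ^ ?n * mean_inj_traffic_prod M Y ?Ts N / of_nat N ^ (1 + ?g) -
      (\<Sum>r\<in>?R. mean_isum (quot G r) YA l N / of_nat N ^ (1 + ?g))) \<longlonglongrightarrow> ?L" by simp
  moreover have "eventually (\<lambda>N. of_nat N ^ ?n * mean_inj_traffic_prod M Y ?Ts N / of_nat N ^ (1 + ?g) -
      (\<Sum>r\<in>?R. mean_isum (quot G r) YA l N / of_nat N ^ (1 + ?g)) =
      mean_isum G YA l N / of_nat N ^ (1 + ?g)) at_top"
    using eventually_gt_at_top[of 0]
  proof eventually_elim
    case (elim N)
    have "of_nat N ^ ?n * mean_inj_traffic_prod M Y ?Ts N =
        mean_isum G YA l N + (\<Sum>r\<in>?R. mean_isum (quot G r) YA l N)"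
      by (rule mean_prod_comps[OF less.prems elim Cs])
    then show ?case
      by (simp only: add_divide_distrib sum_divide_distrib add_diff_cancel_right')
  qed
  ultimately show ?case by (rule Lim_transform_eventually)
qed

end

section \<open>Moments of heavy Wigner matrices\<close>

text \<open>
  The entries \<open>(1, 0)\<close> and \<open>(0, 0)\<close> stand for all off-diagonal and diagonal ones; for \<open>N \<le> 1\<close>
  the former is junk, which does not affect limits.
\<close>

definition offm :: "(nat \<Rightarrow> 'w measure) \<Rightarrow> 'w rmat \<Rightarrow> nat \<Rightarrow> nat \<Rightarrow> nat \<Rightarrow> complex" where
  "offm M X N m n = (\<integral>\<omega>. X N \<omega> $$ (1, 0) ^ m * cnj (X N \<omega> $$ (1, 0)) ^ n \<partial>M N)"

definition diagm :: "(nat \<Rightarrow> 'w measure) \<Rightarrow> 'w rmat \<Rightarrow> nat \<Rightarrow> nat \<Rightarrow> complex" where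
  "diagm M X N m = (\<integral>\<omega>. X N \<omega> $$ (0, 0) ^ m \<partial>M N)"

text \<open>The hypotheses describe the laws of the scaled entries, so moments of an entry are
  pulled back to the law of its multiple by \<open>c\<close>.\<close>

lemma integral_scaled:
  fixes f :: "complex \<Rightarrow> 'c::{banach, second_countable_topology}"
  assumes "X \<in> borel_measurable M" "c \<noteq> 0" "f \<in> borel_measurable borel"
  shows "(\<integral>\<omega>. f (X \<omega>) \<partial>M) = (\<integral>z. f (z / c) \<partial>(distr M borel (\<lambda>\<omega>. c * X \<omega>)))"
proof -
  have "(\<lambda>z. z / c) \<in> borel_measurable borel"
    using assms(2) by (intro borel_measurable_continuous_onI continuous_intros) auto
  then have "(\<lambda>z. f (z / c)) \<in> borel_measurable borel"
    using measurable_compose assms(3) by blast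
  then have "(\<integral>z. f (z / c) \<partial>(distr M borel (\<lambda>\<omega>. c * X \<omega>))) = (\<integral>\<omega>. f (c * X \<omega> / c) \<partial>M)"
    using assms(1) by (subst integral_distr) auto
  then show ?thesis using assms(2) by simp
qed

lemma measurable_mixed_power: "(\<lambda>z::complex. z ^ m * cnj z ^ n) \<in> borel_measurable borel"
  by (intro borel_measurable_continuous_onI continuous_intros)

lemma
  assumes "heavy_wigner M X a" "N > 0"
  shows hw_measurable: "i < N \<Longrightarrow> j < N \<Longrightarrow> (\<lambda>\<omega>. X N \<omega> $$ (i, j)) \<in> borel_measurable (M N)"
    and hw_has_moments: "i < N \<Longrightarrow> j < N \<Longrightarrow> has_moments (M N) (\<lambda>\<omega>. X N \<omega> $$ (i, j))"
  using assms by (auto simp: heavy_wigner_def random_matrix_def has_moments_def)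

lemma heavy_wignerE:
  assumes "heavy_wigner M X a"
  obtains \<mu> :: "nat \<Rightarrow> complex measure" and \<nu> :: "nat \<Rightarrow> real measure" where
    "\<And>N. N > 0 \<Longrightarrow> sets (\<mu> N) = sets borel" "\<And>N. N > 0 \<Longrightarrow> sets (\<nu> N) = sets borel"
    "\<And>N. N > 0 \<Longrightarrow> distr (\<mu> N) borel cnj = \<mu> N"
    "\<And>N i. i < N \<Longrightarrow> distr (M N) borel (\<lambda>\<omega>. complex_of_real (sqrt (real N)) * X N \<omega> $$ (i, i)) =
      distr (\<nu> N) borel complex_of_real"
    "\<And>N i j. i < N \<Longrightarrow> j < i \<Longrightarrow>
      distr (M N) borel (\<lambda>\<omega>. complex_of_real (sqrt (real N)) * X N \<omega> $$ (i, j)) = \<mu> N"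
    "\<And>k. k \<ge> 1 \<Longrightarrow> (\<lambda>N. (\<integral>z. cmod z ^ (2 * k) \<partial>\<mu> N) / real N ^ (k - 1)) \<longlonglongrightarrow> a k"
    "\<And>k. k \<ge> 1 \<Longrightarrow> (\<lambda>N. (\<integral>t. t ^ (2 * k) \<partial>\<nu> N) / real N ^ (k - 1)) \<in> O(\<lambda>_. 1)"
  using assms unfolding heavy_wigner_def
proof (elim conjE exE, goal_cases)
  case (1 \<mu> \<nu>)
  show ?case
  proof (rule 1(1)[of \<mu> \<nu>])
    show "sets (\<mu> N) = sets borel" "sets (\<nu> N) = sets borel" "distr (\<mu> N) borel cnj = \<mu> N"
      if "N > 0" for N using 1(6) that by blast+
    show "distr (M N) borel (\<lambda>\<omega>. complex_of_real (sqrt (real N)) * X N \<omega> $$ (i, i)) =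
      distr (\<nu> N) borel complex_of_real" if "i < N" for N i
      using 1(7) that by force
    show "distr (M N) borel (\<lambda>\<omega>. complex_of_real (sqrt (real N)) * X N \<omega> $$ (i, j)) = \<mu> N"
      if "i < N" "j < i" for N i j
      using 1(8) that by force
  qed (use 1(9,10) in blast)+
qed

lemma hw_centered: "heavy_wigner M X a \<Longrightarrow> i < N \<Longrightarrow> j \<le> i \<Longrightarrow> (\<integral>\<omega>. X N \<omega> $$ (i, j) \<partial>M N) = 0"
  unfolding heavy_wigner_def by auto

lemma offm_eq:
  assumes "heavy_wigner M X a" "i < N" "j < i"
  shows "(\<integral>\<omega>. X N \<omega> $$ (i, j) ^ m * cnj (X N \<omega> $$ (i, j)) ^ n \<partial>M N) = offm M X N m n"
proof -
  let ?c = "complex_of_real (sqrt (real N))"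
  have N: "N > 0" "1 < N" using assms by auto
  obtain \<mu> where \<mu>: "\<And>i j. i < N \<Longrightarrow> j < i \<Longrightarrow> distr (M N) borel (\<lambda>\<omega>. ?c * X N \<omega> $$ (i, j)) = \<mu> N"
  proof (rule heavy_wignerE[OF assms(1)], goal_cases)
    case (1 \<mu> \<nu>)
    show ?case by (rule 1(1)[of \<mu>]) (rule 1(6))
  qed
  have *: "(\<integral>\<omega>. X N \<omega> $$ (i, j) ^ m * cnj (X N \<omega> $$ (i, j)) ^ n \<partial>M N) =
      (\<integral>z. (z / ?c) ^ m * cnj (z / ?c) ^ n \<partial>\<mu> N)" if "i < N" "j < i" for i j
    using integral_scaled[OF hw_measurable[OF assms(1) N(1), of i j], of ?c, OF _ _ _ measurable_mixed_power[of m n]]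
      \<mu>[OF that] that N by simp
  show ?thesis unfolding offm_def using *[OF assms(2,3)] *[of 1 0] N by simp
qed

lemma diagm_eq:
  assumes "heavy_wigner M X a" "i < N"
  shows "(\<integral>\<omega>. X N \<omega> $$ (i, i) ^ m \<partial>M N) = diagm M X N m"
proof -
  let ?c = "complex_of_real (sqrt (real N))"
  have N: "N > 0" using assms by auto
  obtain \<nu> where \<nu>: "\<And>i. i < N \<Longrightarrow> distr (M N) borel (\<lambda>\<omega>. ?c * X N \<omega> $$ (i, i)) = distr (\<nu> N) borel complex_of_real"
    by (rule heavy_wignerE[OF assms(1)]) blast
  have *: "(\<integral>\<omega>. X N \<omega> $$ (i, i) ^ m \<partial>M N) = (\<integral>z. (z / ?c) ^ m \<partial>distr (\<nu> N) borel complex_of_real)"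
    if "i < N" for i
    using integral_scaled[OF hw_measurable[OF assms(1) N, of i i], of ?c "\<lambda>z. z ^ m"] \<nu>[OF that] that N
    by simp
  show ?thesis unfolding diagm_def using *[OF assms(2)] *[of 0] N by simp
qed

text \<open>Invariance of the law under conjugation exchanges the two exponents. This is what makes
  the moment of a group independent of which of its ends receives the larger index.\<close>

lemma offm_commute:
  assumes "heavy_wigner M X a" "N > 1"
  shows "offm M X N m n = offm M X N n m"
proof -
  let ?c = "complex_of_real (sqrt (real N))"
  have N: "N > 0" using assms by auto
  obtain \<mu> where \<mu>: "distr (M N) borel (\<lambda>\<omega>. ?c * X N \<omega> $$ (1, 0)) = \<mu> N" "distr (\<mu> N) borel cnj = \<mu> N"
    "sets (\<mu> N) = sets borel"
  proof (rule heavy_wignerE[OF assms(1)], goal_cases)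
    case (1 \<mu> \<nu>)
    show ?case by (rule 1(1)[of \<mu>]) (use 1(2,4,6) N assms(2) in auto)
  qed
  have *: "offm M X N m n = (\<integral>z. (z / ?c) ^ m * cnj (z / ?c) ^ n \<partial>\<mu> N)" for m n
    unfolding offm_def
    using integral_scaled[OF hw_measurable[OF assms(1) N, of 1 0], of ?c, OF _ _ _ measurable_mixed_power[of m n]]
      \<mu>(1) assms(2) by simp
  have "(\<lambda>z. (z / ?c) ^ m * cnj (z / ?c) ^ n) \<in> borel_measurable borel"
    using N by (intro borel_measurable_continuous_onI continuous_intros) auto
  moreover have "cnj \<in> measurable (\<mu> N) borel"
    unfolding measurable_cong_sets[OF \<mu>(3) refl]
    by (intro borel_measurable_continuous_onI continuous_intros)
  ultimately have "(\<integral>z. (z / ?c) ^ m * cnj (z / ?c) ^ n \<partial>distr (\<mu> N) borel cnj) =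
      (\<integral>z. (cnj z / ?c) ^ m * cnj (cnj z / ?c) ^ n \<partial>\<mu> N)"
    by (intro integral_distr)
  then show ?thesis unfolding * \<mu>(2) by (simp add: mult.commute)
qed

lemma abs_power_odd_le:
  assumes "(x::real) \<ge> 0"
  shows "x ^ (2 * k + 1) \<le> x ^ (2 * k) + x ^ (2 * (k + 1))"
proof -
  have "x \<le> 1 + x ^ 2" using sum_squares_bound[of x 1] assms by (simp add: power2_eq_square)
  then have "x ^ (2 * k) * x \<le> x ^ (2 * k) * (1 + x ^ 2)" using assms by (intro mult_left_mono) auto
  then show ?thesis by (simp add: algebra_simps power_add power2_eq_square)
qed

text \<open>The hypotheses on the laws control even moments only. An odd absolute moment of order at
  least 3 lies below the sum of the two neighbouring even ones; for order 1 one neighbour would have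
  order 0, and \<open>N\<close> times that moment is unbounded.\<close>

lemma bounded_moments:
  fixes f :: "nat \<Rightarrow> 'w \<Rightarrow> complex"
  assumes mom: "\<And>N. N > 1 \<Longrightarrow> has_moments (M N) (f N)"
    and even: "\<And>k. k \<ge> 1 \<Longrightarrow> (\<lambda>N. real N * (\<integral>\<omega>. cmod (f N \<omega>) ^ (2 * k) \<partial>M N)) \<in> O(\<lambda>_. 1)"
    and "m \<ge> 2"
  shows "(\<lambda>N. real N * (\<integral>\<omega>. cmod (f N \<omega>) ^ m \<partial>M N)) \<in> O(\<lambda>_. 1)"
proof (cases "even m")
  case True
  then obtain k where "m = 2 * k" by (elim evenE)
  then show ?thesis using even[of k] assms(3) by auto
next
  case False
  then obtain k where k: "m = 2 * k + 1" by (elim oddE)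
  then have k1: "k \<ge> 1" using assms(3) by auto
  have "(\<lambda>N. real N * (\<integral>\<omega>. cmod (f N \<omega>) ^ m \<partial>M N)) \<in>
      O(\<lambda>N. real N * (\<integral>\<omega>. cmod (f N \<omega>) ^ (2 * k) \<partial>M N) + real N * (\<integral>\<omega>. cmod (f N \<omega>) ^ (2 * (k + 1)) \<partial>M N))"
  proof (rule bigoI[of _ 1], rule eventually_mono[OF eventually_gt_at_top[of 1]])
    fix N :: nat assume N: "N > 1"
    have int: "integrable (M N) (\<lambda>\<omega>. cmod (f N \<omega>) ^ n)" for n
      using mom[OF N] by (simp add: has_moments_def)
    have "(\<integral>\<omega>. cmod (f N \<omega>) ^ m \<partial>M N) \<le> (\<integral>\<omega>. cmod (f N \<omega>) ^ (2 * k) + cmod (f N \<omega>) ^ (2 * (k + 1)) \<partial>M N)"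
      unfolding k by (intro integral_mono int Bochner_Integration.integrable_add abs_power_odd_le norm_ge_zero)
    also have "\<dots> = (\<integral>\<omega>. cmod (f N \<omega>) ^ (2 * k) \<partial>M N) + (\<integral>\<omega>. cmod (f N \<omega>) ^ (2 * (k + 1)) \<partial>M N)"
      by (intro Bochner_Integration.integral_add int)
    finally have le: "real N * (\<integral>\<omega>. cmod (f N \<omega>) ^ m \<partial>M N) \<le>
        real N * (\<integral>\<omega>. cmod (f N \<omega>) ^ (2 * k) \<partial>M N) + real N * (\<integral>\<omega>. cmod (f N \<omega>) ^ (2 * (k + 1)) \<partial>M N)"
      unfolding distrib_left[symmetric] by (rule mult_left_mono) simp
    have "0 \<le> real N * (\<integral>\<omega>. cmod (f N \<omega>) ^ m \<partial>M N)" by simp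
    with le show "norm (real N * (\<integral>\<omega>. cmod (f N \<omega>) ^ m \<partial>M N)) \<le> 1 *
        norm (real N * (\<integral>\<omega>. cmod (f N \<omega>) ^ (2 * k) \<partial>M N) + real N * (\<integral>\<omega>. cmod (f N \<omega>) ^ (2 * (k + 1)) \<partial>M N))"
      by simp
  qed
  also have "\<dots> \<subseteq> O(\<lambda>_. 1)"
    using k1 by (intro landau_o.big_subsetI sum_in_bigo even) auto
  finally show ?thesis .
qed

text \<open>Scaling by the square root of \<open>N\<close> produces \<open>N ^ k\<close>, and the
  factor \<open>N\<close> on the left lowers the exponent to \<open>k - 1\<close>.\<close>

lemma even_moment_scaled:
  assumes "X \<in> borel_measurable M" "N > 0" "k \<ge> 1"
  shows "real N * (\<integral>\<omega>. cmod (X \<omega>) ^ (2 * k) \<partial>M) =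
    (\<integral>z. cmod z ^ (2 * k) \<partial>distr M borel (\<lambda>\<omega>. complex_of_real (sqrt (real N)) * X \<omega>)) / real N ^ (k - 1)"
proof -
  let ?c = "complex_of_real (sqrt (real N))"
  have "(\<integral>z. cmod z ^ (2 * k) \<partial>distr M borel (\<lambda>\<omega>. ?c * X \<omega>)) = (\<integral>\<omega>. cmod (?c * X \<omega>) ^ (2 * k) \<partial>M)"
    using assms(1) by (intro integral_distr) auto
  also have "\<dots> = (\<integral>\<omega>. real N ^ k * cmod (X \<omega>) ^ (2 * k) \<partial>M)"
    by (intro Bochner_Integration.integral_cong refl) (simp add: norm_mult power_mult_distrib power_mult)
  also have "\<dots> = real N ^ k * (\<integral>\<omega>. cmod (X \<omega>) ^ (2 * k) \<partial>M)" by simp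
  finally show ?thesis using assms(2,3) by (cases k) (auto simp: field_simps)
qed

lemma offdiag_even_limit:
  assumes "heavy_wigner M X a" "k \<ge> 1"
  shows "(\<lambda>N. real N * (\<integral>\<omega>. cmod (X N \<omega> $$ (1, 0)) ^ (2 * k) \<partial>M N)) \<longlonglongrightarrow> a k"
proof -
  obtain \<mu> where \<mu>: "\<forall>N>0. \<forall>i<N. \<forall>j<i.
      distr (M N) borel (\<lambda>\<omega>. complex_of_real (sqrt (real N)) * X N \<omega> $$ (i, j)) = \<mu> N"
    "\<forall>k\<ge>1. (\<lambda>N. (\<integral>z. cmod z ^ (2 * k) \<partial>\<mu> N) / real N ^ (k - 1)) \<longlonglongrightarrow> a k"
    by (rule heavy_wignerE[OF assms(1)]) auto
  have "eventually (\<lambda>N. (\<integral>z. cmod z ^ (2 * k) \<partial>\<mu> N) / real N ^ (k - 1) =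
      real N * (\<integral>\<omega>. cmod (X N \<omega> $$ (1, 0)) ^ (2 * k) \<partial>M N)) at_top"
    using eventually_gt_at_top[of 1]
  proof eventually_elim
    case (elim N)
    then have N: "0 < N" "0 < (1::nat)" by auto
    have "distr (M N) borel (\<lambda>\<omega>. complex_of_real (sqrt (real N)) * X N \<omega> $$ (1, 0)) = \<mu> N"
      using \<mu>(1) elim N by blast
    then show ?case
      using even_moment_scaled[OF hw_measurable[OF assms(1) N(1), of 1 0] N(1) assms(2)] elim by simp
  qed
  moreover have "(\<lambda>N. (\<integral>z. cmod z ^ (2 * k) \<partial>\<mu> N) / real N ^ (k - 1)) \<longlonglongrightarrow> a k" using \<mu>(2) assms(2) by blast
  ultimately show ?thesis by (rule Lim_transform_eventually[rotated])
qed

lemma diag_even_bounded: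
  assumes "heavy_wigner M X a" "k \<ge> 1"
  shows "(\<lambda>N. real N * (\<integral>\<omega>. cmod (X N \<omega> $$ (0, 0)) ^ (2 * k) \<partial>M N)) \<in> O(\<lambda>_. 1)"
proof -
  obtain \<nu> :: "nat \<Rightarrow> real measure" where \<nu>: "\<forall>N>0. \<forall>i<N.
      distr (M N) borel (\<lambda>\<omega>. complex_of_real (sqrt (real N)) * X N \<omega> $$ (i, i)) = distr (\<nu> N) borel complex_of_real"
    "\<forall>k\<ge>1. (\<lambda>N. (\<integral>t. t ^ (2 * k) \<partial>\<nu> N) / real N ^ (k - 1)) \<in> O(\<lambda>_. 1)"
    "\<forall>N>0. sets (\<nu> N) = sets borel"
    by (rule heavy_wignerE[OF assms(1)]) auto
  have "eventually (\<lambda>N. (\<integral>t. t ^ (2 * k) \<partial>\<nu> N) / real N ^ (k - 1) =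
      real N * (\<integral>\<omega>. cmod (X N \<omega> $$ (0, 0)) ^ (2 * k) \<partial>M N)) at_top"
    using eventually_gt_at_top[of 0]
  proof eventually_elim
    case (elim N)
    have m: "complex_of_real \<in> measurable (\<nu> N) borel"
      using \<nu>(3) elim measurable_cong_sets[of "\<nu> N" borel borel borel] by auto
    have "(\<integral>z. cmod z ^ (2 * k) \<partial>distr (\<nu> N) borel complex_of_real) = (\<integral>t. cmod (complex_of_real t) ^ (2 * k) \<partial>\<nu> N)"
      by (intro integral_distr m) measurable
    also have "\<dots> = (\<integral>t. t ^ (2 * k) \<partial>\<nu> N)" by (simp add: power_mult)
    finally show ?case
      using even_moment_scaled[OF hw_measurable[OF assms(1) elim, of 0 0] elim assms(2)] \<nu>(1) elim by simp
  qed
  moreover have "(\<lambda>N. (\<integral>t. t ^ (2 * k) \<partial>\<nu> N) / real N ^ (k - 1)) \<in> O(\<lambda>_. 1)" using \<nu>(2) assms(2) by blast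
  ultimately show ?thesis by (simp add: landau_o.big.in_cong)
qed

lemma offm_bounded:
  assumes "heavy_wigner M X a" "m + n \<ge> 1"
  shows "(\<lambda>N. cmod (of_nat N * offm M X N m n)) \<in> O(\<lambda>_. 1)"
\<comment> \<open>The first absolute moment need not be \<open>O(1 / N)\<close>; here centering
  makes the moment itself vanish.\<close>
proof (cases "m + n = 1")
  case True
  have "eventually (\<lambda>N. norm (cmod (of_nat N * offm M X N m n)) \<le> 1 * norm (1 :: real)) at_top"
    using eventually_gt_at_top[of 1]
  proof eventually_elim
    case (elim N)
    then have z: "(\<integral>\<omega>. X N \<omega> $$ (1, 0) \<partial>M N) = 0"
      by (intro hw_centered[OF assms(1)]) auto
    then have "(\<integral>\<omega>. cnj (X N \<omega> $$ (1, 0)) \<partial>M N) = 0" by simp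
    with z True show ?case by (cases m; cases n) (auto simp: offm_def)
  qed
  then show ?thesis by (rule bigoI)
next
  case False
  have "(\<lambda>N. cmod (of_nat N * offm M X N m n)) \<in> O(\<lambda>N. real N * (\<integral>\<omega>. cmod (X N \<omega> $$ (1, 0)) ^ (m + n) \<partial>M N))"
  proof (rule bigoI[of _ 1], rule eventually_mono[OF eventually_gt_at_top[of 1]])
    fix N :: nat assume N: "N > 1"
    have "cmod (offm M X N m n) \<le> (\<integral>\<omega>. cmod (X N \<omega> $$ (1, 0) ^ m * cnj (X N \<omega> $$ (1, 0)) ^ n) \<partial>M N)"
      unfolding offm_def by (rule integral_norm_bound)
    also have "\<dots> = (\<integral>\<omega>. cmod (X N \<omega> $$ (1, 0)) ^ (m + n) \<partial>M N)"
      by (simp add: norm_mult norm_power power_add)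
    finally show "norm (cmod (of_nat N * offm M X N m n)) \<le> 1 * norm (real N * (\<integral>\<omega>. cmod (X N \<omega> $$ (1, 0)) ^ (m + n) \<partial>M N))"
      by (simp add: norm_mult mult_left_mono)
  qed
  also have "(\<lambda>N. real N * (\<integral>\<omega>. cmod (X N \<omega> $$ (1, 0)) ^ (m + n) \<partial>M N)) \<in> O(\<lambda>_. 1)"
  proof (rule bounded_moments)
    show "has_moments (M N) (\<lambda>\<omega>. X N \<omega> $$ (1, 0))" if "N > 1" for N
      using that by (intro hw_has_moments[OF assms(1)]) auto
    show "(\<lambda>N. real N * (\<integral>\<omega>. cmod (X N \<omega> $$ (1, 0)) ^ (2 * k) \<partial>M N)) \<in> O(\<lambda>_. 1)" if "k \<ge> 1" for k
      using offdiag_even_limit[OF assms(1) that] by (intro bigoI_tendsto[where c = "a k"]) auto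
  qed (use False assms(2) in auto)
  finally show ?thesis .
qed

lemma offm_balanced_limit:
  assumes "heavy_wigner M X a" "k \<ge> 1"
  shows "(\<lambda>N. of_nat N * offm M X N k k) \<longlonglongrightarrow> of_real (a k)"
proof -
  have "offm M X N k k = of_real (\<integral>\<omega>. cmod (X N \<omega> $$ (1, 0)) ^ (2 * k) \<partial>M N)" for N
  proof -
    have "X N \<omega> $$ (1, 0) ^ k * cnj (X N \<omega> $$ (1, 0)) ^ k = complex_of_real (cmod (X N \<omega> $$ (1, 0)) ^ (2 * k))" for \<omega>
      by (simp add: power_mult flip: power_mult_distrib complex_norm_square)
    then show ?thesis unfolding offm_def by (simp only: integral_complex_of_real)
  qed
  then have "of_nat N * offm M X N k k = of_real (real N * (\<integral>\<omega>. cmod (X N \<omega> $$ (1, 0)) ^ (2 * k) \<partial>M N))" for N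
    by simp
  then show ?thesis using tendsto_of_real[OF offdiag_even_limit[OF assms], where ?'a = complex] by (simp only:)
qed

lemma diagm_bounded:
  assumes "heavy_wigner M X a" "m \<ge> 1"
  shows "(\<lambda>N. cmod (of_nat N * diagm M X N m)) \<in> O(\<lambda>_. 1)"
proof (cases "m = 1")
  case True
  have "eventually (\<lambda>N. norm (cmod (of_nat N * diagm M X N m)) \<le> 1 * norm (1 :: real)) at_top"
    using eventually_gt_at_top[of 0]
  proof eventually_elim
    case (elim N)
    then have "(\<integral>\<omega>. X N \<omega> $$ (0, 0) \<partial>M N) = 0"
      by (intro hw_centered[OF assms(1)]) auto
    then show ?case using True by (simp add: diagm_def)
  qed
  then show ?thesis by (rule bigoI)
next
  case False
  have "(\<lambda>N. cmod (of_nat N * diagm M X N m)) \<in> O(\<lambda>N. real N * (\<integral>\<omega>. cmod (X N \<omega> $$ (0, 0)) ^ m \<partial>M N))"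
  proof (rule bigoI[of _ 1], rule eventually_mono[OF eventually_gt_at_top[of 1]])
    fix N :: nat assume N: "N > 1"
    have "cmod (diagm M X N m) \<le> (\<integral>\<omega>. cmod (X N \<omega> $$ (0, 0) ^ m) \<partial>M N)"
      unfolding diagm_def by (rule integral_norm_bound)
    also have "\<dots> = (\<integral>\<omega>. cmod (X N \<omega> $$ (0, 0)) ^ m \<partial>M N)"
      by (simp add: norm_power)
    finally show "norm (cmod (of_nat N * diagm M X N m)) \<le> 1 * norm (real N * (\<integral>\<omega>. cmod (X N \<omega> $$ (0, 0)) ^ m \<partial>M N))"
      by (simp add: norm_mult mult_left_mono)
  qed
  also have "(\<lambda>N. real N * (\<integral>\<omega>. cmod (X N \<omega> $$ (0, 0)) ^ m \<partial>M N)) \<in> O(\<lambda>_. 1)"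
  proof (rule bounded_moments)
    show "has_moments (M N) (\<lambda>\<omega>. X N \<omega> $$ (0, 0))" if "N > 1" for N
      using that by (intro hw_has_moments[OF assms(1)]) auto
  qed (use False assms in \<open>auto intro: diag_even_bounded\<close>)
  finally show ?thesis .
qed

section \<open>Integrating out the heavy Wigner matrices\<close>

text \<open>Two functions on \<open>B\<close> with the same fibres have corresponding images. Used
  to pass from positions in the matrix to keys.\<close>

lemma prod_image_eq:
  assumes "finite B" "\<And>e e'. e \<in> B \<Longrightarrow> e' \<in> B \<Longrightarrow> f e = f e' \<longleftrightarrow> g e = g e'"
    and "\<And>e. e \<in> B \<Longrightarrow> C (f e) = D (g e)"
  shows "prod C (f ` B) = (prod D (g ` B) :: 'c :: comm_monoid_mult)"
proof (rule prod.reindex_bij_witness[where i = "\<lambda>y. f (inv_into B g y)" and j = "\<lambda>x. g (inv_into B f x)"])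
  fix x assume "x \<in> f ` B"
  then have i: "inv_into B f x \<in> B" "f (inv_into B f x) = x" by (simp_all add: inv_into_into f_inv_into_f)
  then have j: "inv_into B g (g (inv_into B f x)) \<in> B"
    "g (inv_into B g (g (inv_into B f x))) = g (inv_into B f x)" by (simp_all add: inv_into_into f_inv_into_f)
  then show "f (inv_into B g (g (inv_into B f x))) = x" using assms(2)[OF j(1) i(1)] i by simp
  show "g (inv_into B f x) \<in> g ` B" using i by simp
  show "D (g (inv_into B f x)) = C x" using assms(3)[OF i(1)] i(2) by simp
next
  fix y assume "y \<in> g ` B"
  then have i: "inv_into B g y \<in> B" "g (inv_into B g y) = y" by (simp_all add: inv_into_into f_inv_into_f)
  then have j: "inv_into B f (f (inv_into B g y)) \<in> B"
    "f (inv_into B f (f (inv_into B g y))) = f (inv_into B g y)" by (simp_all add: inv_into_into f_inv_into_f)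
  then show "g (inv_into B f (f (inv_into B g y))) = y" using assms(2)[OF j(1) i(1)] i by simp
  show "f (inv_into B g y) \<in> f ` B" using i by simp
qed

lemma hw_selfadjoint_entry:
  assumes "heavy_wigner M X a" "N > 0" "i < N" "j < N" "\<omega> \<in> space (M N)" "mat_adjoint (X N \<omega>) = X N \<omega>"
  shows "X N \<omega> $$ (i, j) = cnj (X N \<omega> $$ (j, i))"
proof -
  have "X N \<omega> \<in> carrier_mat N N"
    using assms(1,2,5) by (auto simp: heavy_wigner_def random_matrix_def)
  from mat_adjoint_entry[OF this assms(3,4)] assms(6) show ?thesis by simp
qed

text \<open>An unordered pair of indices, encoded as the position on or below the diagonal that
  holds the independent entry.\<close>

definition upair :: "nat \<Rightarrow> nat \<Rightarrow> nat \<times> nat" where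
  "upair i j = (max i j, min i j)"

lemma upair_eq_iff: "upair i j = upair k l \<longleftrightarrow> {i, j} = {k, l}"
  by (auto simp: upair_def doubleton_eq_iff max_def min_def split: if_splits)

text \<open>Off the diagonal \<open>u\<close> plays the row index: an arc leaving \<open>u\<close>
  contributes the entry, an arc in the other direction its conjugate. Diagonal entries are almost
  surely real, so for loops only the number of arcs counts.\<close>

definition group_moment ::
    "(nat \<Rightarrow> 'w measure) \<Rightarrow> 'w rmat \<Rightarrow> nat \<Rightarrow> ('e \<Rightarrow> nat) \<Rightarrow> ('e \<Rightarrow> nat) \<Rightarrow> 'e set \<Rightarrow> nat \<Rightarrow> complex" where
  "group_moment M X u s d B N =
    (if \<forall>e\<in>B. s e = d e then diagm M X N (card B)
     else offm M X N (card {e \<in> B. s e = u}) (card {e \<in> B. s e \<noteq> u}))"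

text \<open>Self-adjointness, which holds almost surely, expresses each entry by one on or below the
  diagonal. The latter are independent, so the expectation factorizes over positions.\<close>

lemma hw_expectation:
  assumes hw: "heavy_wigner M X a" and P: "prob_space (M N)" and N: "N > 1"
    and B: "finite B" "\<And>e. e \<in> B \<Longrightarrow> s e < N \<and> d e < N"
  shows "(\<integral>\<omega>. (\<Prod>e\<in>B. X N \<omega> $$ (s e, d e)) \<partial>M N) =
    (\<Prod>\<pi>\<in>(\<lambda>e. upair (s e) (d e)) ` B. group_moment M X (fst \<pi>) s d {e \<in> B. upair (s e) (d e) = \<pi>} N)"
proof -
  interpret prob_space "M N" by fact
  let ?pr = "\<lambda>e. upair (s e) (d e)"
  let ?Z = "\<lambda>\<pi> z. \<Prod>e\<in>{e \<in> B. ?pr e = \<pi>}. if d e \<le> s e then z else cnj z"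
  have N0: "N > 0" using N by simp
  have idx: "?pr ` B \<subseteq> {(i, j). j \<le> i \<and> i < N}"
    using B(2) by (auto simp: upair_def)
  have mom: "has_moments (M N) (\<lambda>\<omega>. X N \<omega> $$ \<pi>)" if \<pi>: "\<pi> \<in> ?pr ` B" for \<pi>
  proof -
    obtain e where "e \<in> B" "\<pi> = ?pr e" using \<pi> by blast
    then show ?thesis using B(2)[of e] unfolding upair_def
      by (auto intro!: hw_has_moments[OF hw N0])
  qed
  have momZ: "has_moments (M N) (\<lambda>\<omega>. ?Z \<pi> (X N \<omega> $$ \<pi>))" if "\<pi> \<in> ?pr ` B" for \<pi>
  proof (intro has_moments_prod finite_measure_axioms)
    show "has_moments (M N) (\<lambda>\<omega>. if d e \<le> s e then X N \<omega> $$ \<pi> else cnj (X N \<omega> $$ \<pi>))" for e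
      using mom[OF that] has_moments_cnj[OF mom[OF that]] by (cases "d e \<le> s e") simp_all
  qed
  have "AE \<omega> in M N. mat_adjoint (X N \<omega>) = X N \<omega>"
    using hw N0 by (simp add: heavy_wigner_def)
  then have AE: "AE \<omega> in M N. (\<Prod>e\<in>B. X N \<omega> $$ (s e, d e)) = (\<Prod>\<pi>\<in>?pr ` B. ?Z \<pi> (X N \<omega> $$ \<pi>))"
  proof (rule AE_mp, intro AE_I2 impI)
    fix \<omega> assume \<omega>: "\<omega> \<in> space (M N)" "mat_adjoint (X N \<omega>) = X N \<omega>"
    have "(\<Prod>e\<in>B. X N \<omega> $$ (s e, d e)) = (\<Prod>e\<in>B. if d e \<le> s e then X N \<omega> $$ ?pr e else cnj (X N \<omega> $$ ?pr e))"
      using B(2) by (intro prod.cong refl)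
        (auto simp: upair_def max_def min_def intro: hw_selfadjoint_entry[OF hw N0 _ _ \<omega>])
    also have "\<dots> = (\<Prod>\<pi>\<in>?pr ` B. \<Prod>e\<in>{e \<in> B. ?pr e = \<pi>}. if d e \<le> s e then X N \<omega> $$ ?pr e else cnj (X N \<omega> $$ ?pr e))"
      by (rule prod.image_gen[OF B(1)])
    also have "\<dots> = (\<Prod>\<pi>\<in>?pr ` B. ?Z \<pi> (X N \<omega> $$ \<pi>))"
      by (intro prod.cong refl) auto
    finally show "(\<Prod>e\<in>B. X N \<omega> $$ (s e, d e)) = (\<Prod>\<pi>\<in>?pr ` B. ?Z \<pi> (X N \<omega> $$ \<pi>))" .
  qed
  have "(\<integral>\<omega>. (\<Prod>e\<in>B. X N \<omega> $$ (s e, d e)) \<partial>M N) = (\<integral>\<omega>. (\<Prod>\<pi>\<in>?pr ` B. ?Z \<pi> (X N \<omega> $$ \<pi>)) \<partial>M N)"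
  proof (rule integral_cong_AE)
    have "has_moments (M N) (\<lambda>\<omega>. \<Prod>e\<in>B. X N \<omega> $$ (s e, d e))"
      using B(2) by (intro has_moments_prod finite_measure_axioms hw_has_moments[OF hw N0]) auto
    then show "(\<lambda>\<omega>. \<Prod>e\<in>B. X N \<omega> $$ (s e, d e)) \<in> borel_measurable (M N)"
      unfolding has_moments_def by (rule conjunct1)
    have "has_moments (M N) (\<lambda>\<omega>. \<Prod>\<pi>\<in>?pr ` B. ?Z \<pi> (X N \<omega> $$ \<pi>))"
      by (intro has_moments_prod[OF finite_measure_axioms] momZ)
    then show "(\<lambda>\<omega>. \<Prod>\<pi>\<in>?pr ` B. ?Z \<pi> (X N \<omega> $$ \<pi>)) \<in> borel_measurable (M N)"
      unfolding has_moments_def by (rule conjunct1)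
  qed (rule AE)
  also have "\<dots> = (\<Prod>\<pi>\<in>?pr ` B. \<integral>\<omega>. ?Z \<pi> (X N \<omega> $$ \<pi>) \<partial>M N)"
  proof (rule indep_vars_lebesgue_integral)
    show "finite (?pr ` B)" using B(1) by simp
    have "indep_vars (\<lambda>_. borel) (\<lambda>(i, j) \<omega>. X N \<omega> $$ (i, j)) {(i, j). j \<le> i \<and> i < N}"
      using hw[unfolded heavy_wigner_def, THEN conjunct2, THEN conjunct2, THEN conjunct1] N0 by blast
    then have "indep_vars (\<lambda>_. borel) (\<lambda>\<pi> \<omega>. X N \<omega> $$ \<pi>) (?pr ` B)"
      using idx by (auto simp: case_prod_beta' intro: indep_vars_subset)
    then show "indep_vars (\<lambda>_. borel) (\<lambda>\<pi> \<omega>. ?Z \<pi> (X N \<omega> $$ \<pi>)) (?pr ` B)"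
    proof (rule indep_vars_compose2)
      show "?Z \<pi> \<in> borel_measurable borel" for \<pi>
      proof (intro borel_measurable_prod)
        show "(\<lambda>z. if d e \<le> s e then z else cnj z) \<in> borel_measurable borel" for e
          by (cases "d e \<le> s e") (auto intro!: borel_measurable_continuous_onI continuous_intros)
      qed
    qed
    show "integrable (M N) (\<lambda>\<omega>. ?Z \<pi> (X N \<omega> $$ \<pi>))" if "\<pi> \<in> ?pr ` B" for \<pi>
      by (rule has_moments_integrable[OF momZ[OF that]])
  qed
  also have "\<dots> = (\<Prod>\<pi>\<in>?pr ` B. group_moment M X (fst \<pi>) s d {e \<in> B. ?pr e = \<pi>} N)"
  proof (rule prod.cong[OF refl])
    fix \<pi> assume \<pi>: "\<pi> \<in> ?pr ` B"
    then obtain e0 where e0: "e0 \<in> B" "\<pi> = ?pr e0" by blast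
    let ?g = "{e \<in> B. ?pr e = \<pi>}"
    obtain i j where ij: "\<pi> = (i, j)" "j \<le> i" "i < N" using \<pi> idx by (cases \<pi>) auto
    have fin: "finite ?g" using B(1) by simp
    show "(\<integral>\<omega>. ?Z \<pi> (X N \<omega> $$ \<pi>) \<partial>M N) = group_moment M X (fst \<pi>) s d ?g N"
    proof (cases "i = j")
      case True
      then have "s e = d e" if "e \<in> ?g" for e
        using that ij(1) by (auto simp: upair_def max_def min_def split: if_splits)
      then have loops: "\<forall>e\<in>?g. s e = d e" by blast
      have "?Z \<pi> z = z ^ card ?g" for z
      proof -
        have "?Z \<pi> z = (\<Prod>e\<in>?g. z)" using loops by (intro prod.cong refl) auto
        then show ?thesis by (simp only: prod_constant)
      qed
      then have "(\<integral>\<omega>. ?Z \<pi> (X N \<omega> $$ \<pi>) \<partial>M N) = diagm M X N (card ?g)"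
        using diagm_eq[OF hw ij(3)] ij(1) True by simp
      also have "\<dots> = group_moment M X (fst \<pi>) s d ?g N"
        unfolding group_moment_def by (rule if_P[OF loops, symmetric])
      finally show ?thesis .
    next
      case False
      have sd: "s e = i \<and> d e = j \<or> s e = j \<and> d e = i" if "e \<in> ?g" for e
        using that ij(1) by (auto simp: upair_def max_def min_def split: if_splits)
      then have le: "d e \<le> s e \<longleftrightarrow> s e = i" if "e \<in> ?g" for e
        using sd[OF that] ij(2) False by auto
      have "?Z \<pi> z = z ^ card {e \<in> ?g. s e = i} * cnj z ^ card {e \<in> ?g. s e \<noteq> i}" for z
      proof -
        have "?Z \<pi> z = (\<Prod>e\<in>?g. if s e = i then z else cnj z)"
          using le by (intro prod.cong refl) auto
        also have "\<dots> = z ^ card (?g \<inter> {e. s e = i}) * cnj z ^ card (?g \<inter> - {e. s e = i})"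
          using fin by (subst prod.If_cases) simp_all
        also have "?g \<inter> {e. s e = i} = {e \<in> ?g. s e = i}" by blast
        also have "?g \<inter> - {e. s e = i} = {e \<in> ?g. s e \<noteq> i}" by blast
        finally show ?thesis .
      qed
      moreover have "\<not> (\<forall>e\<in>?g. s e = d e)" using sd[of e0] e0 False by auto
      moreover have "j < i" using ij(2) False by simp
      ultimately show ?thesis
        using offm_eq[OF hw ij(3), of j] by (simp only: group_moment_def if_False ij(1) fst_conv)
    qed
  qed
  finally show ?thesis .
qed

text \<open>A labelling that is injective on the ends preserves loops and at most exchanges the
  roles of the two ends. This swaps the exponents, and \<open>offm_commute\<close> absorbs
  it.\<close>

lemma group_moment_inj:
  assumes hw: "heavy_wigner M X a" and N: "N > 1" and B: "finite B" "B \<noteq> {}"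
    and S: "\<And>e. e \<in> B \<Longrightarrow> {t e, h e} = S" and inj: "inj_on \<phi> S"
    and u: "u \<in> S" and v: "v \<in> \<phi> ` S"
  shows "group_moment M X v (\<lambda>e. \<phi> (t e)) (\<lambda>e. \<phi> (h e)) B N = group_moment M X u t h B N"
proof -
  obtain e0 where e0: "e0 \<in> B" using B(2) by blast
  obtain w where w: "w \<in> S" "v = \<phi> w" using v by blast
  have eq: "\<phi> x = \<phi> y \<longleftrightarrow> x = y" if "x \<in> S" "y \<in> S" for x y
    using inj that by (auto dest: inj_onD)
  have th: "t e \<in> S" "h e \<in> S" if "e \<in> B" for e using S[OF that] by auto
  have loop: "(\<forall>e\<in>B. \<phi> (t e) = \<phi> (h e)) \<longleftrightarrow> (\<forall>e\<in>B. t e = h e)"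
    using eq th by auto
  have cw: "{e \<in> B. \<phi> (t e) = v} = {e \<in> B. t e = w}" "{e \<in> B. \<phi> (t e) \<noteq> v} = {e \<in> B. t e \<noteq> w}"
    using eq th w by auto
  show ?thesis
  proof (cases "\<forall>e\<in>B. t e = h e")
    case True
    then show ?thesis using loop by (simp add: group_moment_def)
  next
    case False
    then obtain e1 where e1: "e1 \<in> B" "t e1 \<noteq> h e1" by blast
    have two: "x = t e1 \<or> x = h e1" if "x \<in> S" for x using S[OF e1(1)] that by blast
    show ?thesis
    proof (cases "w = u")
      case True
      then show ?thesis using cw loop by (simp add: group_moment_def)
    next
      case wu: False
      have "t e = u \<longleftrightarrow> t e \<noteq> w" if "e \<in> B" for e
        using two[OF th(1)[OF that]] two[OF u] two[OF w(1)] wu by auto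
      then have "{e \<in> B. t e = u} = {e \<in> B. t e \<noteq> w}" "{e \<in> B. t e \<noteq> u} = {e \<in> B. t e = w}" by blast+
      moreover have "\<not> (\<forall>e\<in>B. \<phi> (t e) = \<phi> (h e))" using False loop by blast
      ultimately show ?thesis
        using offm_commute[OF hw N] by (simp only: group_moment_def cw if_not_P[OF False] if_False)
    qed
  qed
qed

section \<open>Splitting expectations by independence\<close>

locale heavy_wigner_joint =
  fixes p q :: nat and a :: "nat \<Rightarrow> nat \<Rightarrow> real" and M :: "nat \<Rightarrow> 'w measure" and X Y :: "nat \<Rightarrow> 'w rmat"
  assumes model: "heavy_wigner_model p q a M X Y"
begin

lemma prob: "N > 0 \<Longrightarrow> prob_space (M N)"
  using model[unfolded heavy_wigner_model_def, THEN conjunct1] by blast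

lemma hw: "j < p \<Longrightarrow> heavy_wigner M (X j) (a j)"
  using model[unfolded heavy_wigner_model_def, THEN conjunct2, THEN conjunct1] by blast

lemma rmY: "l < q \<Longrightarrow> random_matrix M (Y l)"
  using model[unfolded heavy_wigner_model_def, THEN conjunct2, THEN conjunct2, THEN conjunct2, THEN conjunct1]
  by blast

lemma rmX: "j < p \<Longrightarrow> random_matrix M (X j)"
  using hw[unfolded heavy_wigner_def, THEN conjunct1] .

sublocale traffic_family M Y "{..<q}"
proof (rule traffic_family.intro)
  note m = model[unfolded heavy_wigner_model_def, THEN conjunct2, THEN conjunct2, THEN conjunct2, THEN conjunct2, THEN conjunct2]
  show "traffic_convergence M Y {..<q}" by (rule m[THEN conjunct1])
  show "traffic_concentration M Y {..<q}" by (rule m[THEN conjunct2, THEN conjunct1])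
  show "traffic_tightness M Y {..<q}" by (rule m[THEN conjunct2, THEN conjunct2])
  show "prob_space (M N)" if "N > 0" for N using that by (rule prob)
  show "random_matrix M (Y y)" if "y \<in> {..<q}" for y using that by (intro rmY) simp
qed

lemma indep_integral:
  assumes N: "N > 0" and B: "finite B" "\<And>e. e \<in> B \<Longrightarrow> jj e < p \<and> s e < N \<and> d e < N"
    and Y: "finite YA" "\<And>e. e \<in> YA \<Longrightarrow> fst (l e) < q \<and> s e < N \<and> d e < N"
  shows "(\<integral>\<omega>. (\<Prod>e\<in>B. X (jj e) N \<omega> $$ (s e, d e)) * (\<Prod>e\<in>YA. ew (\<lambda>y. Y y N \<omega>) l e (s e) (d e)) \<partial>M N) =
    (\<Prod>j<p. \<integral>\<omega>. (\<Prod>e\<in>{e \<in> B. jj e = j}. X j N \<omega> $$ (s e, d e)) \<partial>M N) *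
    (\<integral>\<omega>. (\<Prod>e\<in>YA. ew (\<lambda>y. Y y N \<omega>) l e (s e) (d e)) \<partial>M N)"
proof -
  interpret prob_space "M N" using prob N by blast
  let ?P = "\<lambda>\<omega>. \<Prod>e\<in>B. X (jj e) N \<omega> $$ (s e, d e)"
  let ?Q = "\<lambda>\<omega>. \<Prod>e\<in>YA. ew (\<lambda>y. Y y N \<omega>) l e (s e) (d e)"
  \<comment> \<open>\<open>?Q\<close> with the adjoints written out by entries. In this form it is a
    function of \<open>family_entries\<close>, to which independence applies. The two agree on the
    space, where the matrices have size \<open>N\<close>.\<close>
  let ?Q' = "\<lambda>\<omega>. \<Prod>e\<in>YA. if snd (l e) then cnj (Y (fst (l e)) N \<omega> $$ (d e, s e)) else Y (fst (l e)) N \<omega> $$ (s e, d e)"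
  have mX: "has_moments (M N) (\<lambda>\<omega>. X j N \<omega> $$ (s e, d e))" if "e \<in> B" "j < p" for e j
    using hw_has_moments[OF hw N] that B(2)[OF that(1)] by blast
  have mP: "has_moments (M N) ?P"
    by (intro has_moments_prod finite_measure_axioms mX) (use B(2) in auto)
  have mQ: "has_moments (M N) ?Q"
    using Y(2) by (intro has_moments_prod finite_measure_axioms has_moments_ew rmY N) auto
  have QQ': "?Q \<omega> = ?Q' \<omega>" if "\<omega> \<in> space (M N)" for \<omega>
  proof (intro prod.cong refl)
    fix e assume e: "e \<in> YA"
    then have "Y (fst (l e)) N \<omega> \<in> carrier_mat N N"
      using rmY Y(2)[OF e] N that by (auto simp: random_matrix_def)
    then show "ew (\<lambda>y. Y y N \<omega>) l e (s e) (d e) =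
        (if snd (l e) then cnj (Y (fst (l e)) N \<omega> $$ (d e, s e)) else Y (fst (l e)) N \<omega> $$ (s e, d e))"
      using mat_adjoint_entry Y(2)[OF e] by (cases "l e") (auto simp: ew_def)
  qed
  then have mQ': "has_moments (M N) ?Q'" using mQ has_moments_cong[of "M N" ?Q ?Q'] by blast
  have iPQ: "indep_var borel ?P borel ?Q'"
  proof -
    let ?IX = "{..<p} \<times> {..<N} \<times> {..<N}" and ?IY = "{..<q} \<times> {..<N} \<times> {..<N}"
    let ?f = "\<lambda>x. \<Prod>e\<in>B. x (jj e, s e, d e) :: complex"
    let ?g = "\<lambda>y. \<Prod>e\<in>YA. if snd (l e) then cnj (y (fst (l e), d e, s e)) else y (fst (l e), s e, d e) :: complex"
    have "indep_var (PiM ?IX (\<lambda>_. borel)) (\<lambda>\<omega>. family_entries p N (\<lambda>j. X j N \<omega>))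
        (PiM ?IY (\<lambda>_. borel)) (\<lambda>\<omega>. family_entries q N (\<lambda>l. Y l N \<omega>))"
      using model N by (auto simp: heavy_wigner_model_def)
    moreover have "?f \<in> borel_measurable (PiM ?IX (\<lambda>_. borel))"
      using B(2) by (intro borel_measurable_prod measurable_component_singleton) auto
    moreover have "?g \<in> borel_measurable (PiM ?IY (\<lambda>_. borel))"
    proof (intro borel_measurable_prod)
      fix e assume e: "e \<in> YA"
      have c: "(\<lambda>y. y (fst (l e), s e, d e)) \<in> borel_measurable (PiM ?IY (\<lambda>_. borel :: complex measure))"
        "(\<lambda>y. y (fst (l e), d e, s e)) \<in> borel_measurable (PiM ?IY (\<lambda>_. borel :: complex measure))"
        using Y(2)[OF e] by (auto intro!: measurable_component_singleton)
      have "(\<lambda>y. cnj (y (fst (l e), d e, s e))) \<in> borel_measurable (PiM ?IY (\<lambda>_. borel))"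
        using measurable_compose[OF c(2) borel_measurable_continuous_onI[OF continuous_on_cnj[OF continuous_on_id]]] .
      then show "(\<lambda>y. if snd (l e) then cnj (y (fst (l e), d e, s e)) else y (fst (l e), s e, d e))
          \<in> borel_measurable (PiM ?IY (\<lambda>_. borel))"
        using c(1) by (cases "snd (l e)") simp_all
    qed
    ultimately have "indep_var borel (?f \<circ> (\<lambda>\<omega>. family_entries p N (\<lambda>j. X j N \<omega>)))
        borel (?g \<circ> (\<lambda>\<omega>. family_entries q N (\<lambda>l. Y l N \<omega>)))"
      by (rule indep_var_compose)
    moreover have "?f \<circ> (\<lambda>\<omega>. family_entries p N (\<lambda>j. X j N \<omega>)) = ?P"
      using B(2) by (auto simp: family_entries_def fun_eq_iff intro!: prod.cong)
    moreover have "?g \<circ> (\<lambda>\<omega>. family_entries q N (\<lambda>l. Y l N \<omega>)) = ?Q'"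
      using Y(2) by (auto simp: family_entries_def fun_eq_iff intro!: prod.cong)
    ultimately show ?thesis by simp
  qed
  have "(\<integral>\<omega>. ?P \<omega> * ?Q \<omega> \<partial>M N) = (\<integral>\<omega>. ?P \<omega> * ?Q' \<omega> \<partial>M N)"
    using QQ' by (intro Bochner_Integration.integral_cong) simp_all
  also have "\<dots> = (\<integral>\<omega>. ?P \<omega> \<partial>M N) * (\<integral>\<omega>. ?Q' \<omega> \<partial>M N)"
    by (rule indep_var_lebesgue_integral[OF iPQ has_moments_integrable[OF mP] has_moments_integrable[OF mQ']])
  also have "(\<integral>\<omega>. ?Q' \<omega> \<partial>M N) = (\<integral>\<omega>. ?Q \<omega> \<partial>M N)"
    using QQ' by (intro Bochner_Integration.integral_cong) simp_all
  also have "(\<integral>\<omega>. ?P \<omega> \<partial>M N) = (\<integral>\<omega>. (\<Prod>j<p. \<Prod>e\<in>{e \<in> B. jj e = j}. X j N \<omega> $$ (s e, d e)) \<partial>M N)"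
  proof (intro Bochner_Integration.integral_cong refl)
    fix \<omega>
    have "?P \<omega> = (\<Prod>j<p. \<Prod>e\<in>{e \<in> B. jj e = j}. X (jj e) N \<omega> $$ (s e, d e))"
      using B by (intro prod.group[symmetric]) auto
    also have "\<dots> = (\<Prod>j<p. \<Prod>e\<in>{e \<in> B. jj e = j}. X j N \<omega> $$ (s e, d e))"
      by (intro prod.cong refl) auto
    finally show "?P \<omega> = \<dots>" .
  qed
  also have "\<dots> = (\<Prod>j<p. \<integral>\<omega>. (\<Prod>e\<in>{e \<in> B. jj e = j}. X j N \<omega> $$ (s e, d e)) \<partial>M N)"
  proof (rule indep_vars_lebesgue_integral)
    have "indep_vars (\<lambda>_. PiM ({..<N} \<times> {..<N}) (\<lambda>_. borel)) (\<lambda>j \<omega>. matrix_entries N (X j N \<omega>)) {..<p}"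
      using model N by (auto simp: heavy_wigner_model_def)
    then have "indep_vars (\<lambda>_. borel)
        (\<lambda>j \<omega>. (\<lambda>x. \<Prod>e\<in>{e \<in> B. jj e = j}. x (s e, d e)) (matrix_entries N (X j N \<omega>))) {..<p}"
    proof (rule indep_vars_compose2)
      show "(\<lambda>x. \<Prod>e\<in>{e \<in> B. jj e = j}. x (s e, d e)) \<in>
          borel_measurable (PiM ({..<N} \<times> {..<N}) (\<lambda>_. borel :: complex measure))" for j
        using B(2) by (intro borel_measurable_prod measurable_component_singleton) auto
    qed
    moreover have "(\<lambda>x. \<Prod>e\<in>{e \<in> B. jj e = j}. x (s e, d e)) (matrix_entries N (X j N \<omega>)) =
        (\<Prod>e\<in>{e \<in> B. jj e = j}. X j N \<omega> $$ (s e, d e))" for j \<omega>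
      using B(2) by (auto simp: matrix_entries_def intro!: prod.cong)
    ultimately show "indep_vars (\<lambda>_. borel) (\<lambda>j \<omega>. \<Prod>e\<in>{e \<in> B. jj e = j}. X j N \<omega> $$ (s e, d e)) {..<p}"
      by simp
    show "integrable (M N) (\<lambda>\<omega>. \<Prod>e\<in>{e \<in> B. jj e = j}. X j N \<omega> $$ (s e, d e))" if "j \<in> {..<p}" for j
      using that by (intro has_moments_integrable has_moments_prod finite_measure_axioms mX) auto
  qed simp
  finally show ?thesis .
qed

end

section \<open>The limit of the injective traffics\<close>

definition y_arcs :: "(nat + nat) test_graph \<Rightarrow> nat set" where
  "y_arcs T = {e \<in> arcs (shape T). \<not> isl (fst (lbl T e))}"

definition y_lbl :: "(nat + nat) test_graph \<Rightarrow> nat \<Rightarrow> nat letter" where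
  "y_lbl T e = (projr (fst (lbl T e)), snd (lbl T e))"

definition x_key :: "(nat + nat) test_graph \<Rightarrow> nat \<Rightarrow> nat \<times> nat set" where
  "x_key T e = (projl (fst (lbl T e)), {tail (shape T) e, head (shape T) e})"

definition x_group :: "(nat + nat) test_graph \<Rightarrow> nat \<times> nat set \<Rightarrow> nat set" where
  "x_group T k = {e \<in> arcs (shape T) - y_arcs T. x_key T e = k}"

abbreviation x_keys :: "(nat + nat) test_graph \<Rightarrow> (nat \<times> nat set) set" where
  "x_keys T \<equiv> x_key T ` (arcs (shape T) - y_arcs T)"

text \<open>Choosing the smaller end is a convention: for \<open>N > 1\<close> both ends give the
  same value, by \<open>group_moment_inj\<close>.\<close>

definition coef :: "(nat \<Rightarrow> 'w measure) \<Rightarrow> (nat \<Rightarrow> 'w rmat) \<Rightarrow> (nat + nat) test_graph \<Rightarrow>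
    nat \<times> nat set \<Rightarrow> nat \<Rightarrow> complex" where
  "coef M X T k N = group_moment M (X (fst k)) (Min (snd k)) (tail (shape T)) (head (shape T)) (x_group T k) N"

lemma joint_var_cases:
  assumes "test_graph_in (joint_vars p q) T" "e \<in> arcs (shape T)"
  shows "e \<in> y_arcs T \<Longrightarrow> fst (lbl T e) = Inr (fst (y_lbl T e)) \<and> fst (y_lbl T e) < q"
    and "e \<notin> y_arcs T \<Longrightarrow> fst (lbl T e) = Inl (fst (x_key T e)) \<and> fst (x_key T e) < p"
proof -
  have "fst (lbl T e) \<in> {..<p} <+> {..<q}"
    using assms by (auto simp: test_graph_in_def joint_vars_def)
  then show "e \<in> y_arcs T \<Longrightarrow> fst (lbl T e) = Inr (fst (y_lbl T e)) \<and> fst (y_lbl T e) < q"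
    and "e \<notin> y_arcs T \<Longrightarrow> fst (lbl T e) = Inl (fst (x_key T e)) \<and> fst (x_key T e) < p"
    using assms(2) by (auto simp: y_arcs_def y_lbl_def x_key_def)
qed

lemma bigo_prod_one:
  fixes f :: "'k \<Rightarrow> nat \<Rightarrow> complex"
  assumes "\<And>k. k \<in> K \<Longrightarrow> (\<lambda>N. cmod (f k N)) \<in> O(\<lambda>_. 1)"
  shows "(\<lambda>N. cmod (\<Prod>k\<in>K. f k N)) \<in> O(\<lambda>_. 1)"
  using assms
proof (induction K rule: infinite_finite_induct)
  case (insert k K)
  have "(\<lambda>N. cmod (f k N) * cmod (\<Prod>k\<in>K. f k N)) \<in> O(\<lambda>_. 1 * 1)"
    using insert by (intro landau_o.big.mult) auto
  then show ?case using insert.hyps by (simp add: norm_mult)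
qed simp_all

lemma bounded_times_null:
  fixes f g :: "nat \<Rightarrow> complex"
  assumes "(\<lambda>N. cmod (f N)) \<in> O(\<lambda>_. 1)" "g \<longlonglongrightarrow> 0"
  shows "(\<lambda>N. f N * g N) \<longlonglongrightarrow> 0"
proof -
  obtain c where "c > 0" "eventually (\<lambda>N. norm (cmod (f N)) \<le> c * norm (1::real)) at_top"
    using assms(1) by (elim landau_o.bigE)
  then have "eventually (\<lambda>N. norm (f N * g N) \<le> c * norm (g N)) at_top"
    by (auto elim!: eventually_mono simp: norm_mult mult_right_mono)
  moreover have "(\<lambda>N. c * norm (g N)) \<longlonglongrightarrow> 0"
    using tendsto_norm_zero[OF assms(2)] by (rule tendsto_mult_right_zero)
  ultimately show ?thesis by (rule Lim_null_comparison)
qed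

lemma mean_inj_traffic_vertex:
  assumes "\<And>N. N > 0 \<Longrightarrow> prob_space (M N)" "arcs (shape T) = {}" "verts (shape T) = {v}"
  shows "mean_inj_traffic M A T \<longlonglongrightarrow> 1"
proof -
  have "{\<phi> \<in> {v} \<rightarrow>\<^sub>E {..<N}. inj_on \<phi> {v}} = {v} \<rightarrow>\<^sub>E {..<N}" for N by auto
  then have "inj_traffic N B T = 1" if "N > 0" for N B
    using that by (simp add: inj_traffic_def edge_weight_def assms(2,3) card_PiE)
  then have "mean_inj_traffic M A T N = 1" if "N > 0" for N
    using that assms(1)[OF that] by (simp add: mean_inj_traffic_def prob_space.prob_space)
  then show ?thesis
    by (intro Lim_transform_eventually[OF tendsto_const] eventually_mono[OF eventually_gt_at_top[of 0]]) simp
qed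

context heavy_wigner_joint
begin

text \<open>Under an injective labelling, two arcs of one variable meet the same independent entry
  iff they have the same key. So the expectation over the heavy Wigner matrices is the same for all
  labellings and comes out of the sum.\<close>

lemma mean_inj_traffic_factor:
  assumes T: "test_graph_in (joint_vars p q) T" and N: "N > 1"
  shows "mean_inj_traffic M (case_sum X Y) T N =
    1 / of_nat N * (\<Prod>k\<in>x_keys T. coef M X T k N) * mean_isum (shape T) (y_arcs T) (y_lbl T) N"
proof -
  interpret prob_space "M N" using prob N by simp
  interpret fin_digraph "shape T" using T by (simp add: test_graph_in_def)
  let ?V = "verts (shape T)" and ?t = "tail (shape T)" and ?h = "head (shape T)" and ?A = "arcs (shape T)"
  let ?YA = "y_arcs T" and ?l = "y_lbl T" and ?Z = "\<lambda>\<omega> y. case_sum X Y y N \<omega>"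
  define XA where "XA = ?A - ?YA"
  have N0: "N > 0" using N by simp
  have YA: "?YA \<subseteq> ?A" by (auto simp: y_arcs_def)
  have fin: "finite ?YA" "finite XA" using finite_subset[OF YA] by (auto simp: XA_def)
  have sub: "?t ` ?YA \<union> ?h ` ?YA \<subseteq> ?V" using YA by auto
  have rm: "random_matrix M (case_sum X Y (fst (lbl T e)))" if "e \<in> ?A" for e
    using joint_var_cases[OF T that] rmX rmY by (cases "e \<in> ?YA") auto
  have xk: "fst (x_key T e) < p" "lbl T e = (Inl (fst (x_key T e)), snd (lbl T e))" if "e \<in> XA" for e
    using joint_var_cases(2)[OF T, of e] that by (auto simp: XA_def prod_eq_iff)
  have yk: "fst (?l e) < q" "lbl T e = (Inr (fst (?l e)), snd (?l e))" if "e \<in> ?YA" for e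
    using joint_var_cases(1)[OF T, of e] that YA by (auto simp: prod_eq_iff y_lbl_def)
  have sa: "AE \<omega> in M N. \<forall>j\<in>{..<p}. mat_adjoint (X j N \<omega>) = X j N \<omega>"
  proof (rule AE_finite_allI)
    show "AE \<omega> in M N. mat_adjoint (X j N \<omega>) = X j N \<omega>" if "j \<in> {..<p}" for j
      using hw[of j, unfolded heavy_wigner_def, THEN conjunct2, THEN conjunct1] that N0 by blast
  qed simp
  have one: "(\<integral>\<omega>. (\<Prod>e\<in>?A. ew (?Z \<omega>) (lbl T) e (\<phi> (?t e)) (\<phi> (?h e))) \<partial>M N) =
      (\<Prod>k\<in>x_keys T. coef M X T k N) * (\<integral>\<omega>. (\<Prod>e\<in>?YA. ew (\<lambda>y. Y y N \<omega>) ?l e (\<phi> (?t e)) (\<phi> (?h e))) \<partial>M N)"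
    if \<phi>: "\<phi> \<in> injmaps ?V N" for \<phi>
  proof -
    let ?s = "\<lambda>e. \<phi> (?t e)" and ?d = "\<lambda>e. \<phi> (?h e)"
    let ?jj = "\<lambda>e. fst (x_key T e)"
    have lt: "\<phi> v < N" if "v \<in> ?V" for v using \<phi> that by (auto simp: injmaps_def)
    have inj: "inj_on \<phi> ?V" using \<phi> by (simp add: injmaps_def)
    have ltA: "?s e < N" "?d e < N" if "e \<in> ?A" for e using lt that by auto
    have mom: "has_moments (M N) (\<lambda>\<omega>. \<Prod>e\<in>B. ew (?Z \<omega>) (lbl T) e (?s e) (?d e))" if "B \<subseteq> ?A" for B
      using that by (intro has_moments_prod_ew prob_space_axioms N0 rm) (auto intro: ltA)
    have momX: "has_moments (M N) (\<lambda>\<omega>. \<Prod>e\<in>XA. X (?jj e) N \<omega> $$ (?s e, ?d e))"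
      using xk ltA by (intro has_moments_prod finite_measure_axioms hw_has_moments[OF hw N0]) (auto simp: XA_def)
    have momY: "has_moments (M N) (\<lambda>\<omega>. \<Prod>e\<in>?YA. ew (\<lambda>y. Y y N \<omega>) ?l e (?s e) (?d e))"
      using yk YA by (intro has_moments_prod_ew prob_space_axioms N0 rmY) (auto intro: ltA)
    have "(\<integral>\<omega>. (\<Prod>e\<in>?A. ew (?Z \<omega>) (lbl T) e (?s e) (?d e)) \<partial>M N) =
        (\<integral>\<omega>. (\<Prod>e\<in>XA. X (?jj e) N \<omega> $$ (?s e, ?d e)) * (\<Prod>e\<in>?YA. ew (\<lambda>y. Y y N \<omega>) ?l e (?s e) (?d e)) \<partial>M N)"
    proof (rule integral_cong_AE)
      show "(\<lambda>\<omega>. \<Prod>e\<in>?A. ew (?Z \<omega>) (lbl T) e (?s e) (?d e)) \<in> borel_measurable (M N)"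
        by (rule borel_measurable_integrable[OF has_moments_integrable[OF mom]]) simp
      show "(\<lambda>\<omega>. (\<Prod>e\<in>XA. X (?jj e) N \<omega> $$ (?s e, ?d e)) * (\<Prod>e\<in>?YA. ew (\<lambda>y. Y y N \<omega>) ?l e (?s e) (?d e)))
          \<in> borel_measurable (M N)"
        by (rule borel_measurable_integrable[OF has_moments_integrable[OF has_moments_mult[OF momX momY]]])
      from sa show "AE \<omega> in M N. (\<Prod>e\<in>?A. ew (?Z \<omega>) (lbl T) e (?s e) (?d e)) =
          (\<Prod>e\<in>XA. X (?jj e) N \<omega> $$ (?s e, ?d e)) * (\<Prod>e\<in>?YA. ew (\<lambda>y. Y y N \<omega>) ?l e (?s e) (?d e))"
      proof (rule AE_mp, intro AE_I2 impI)
        fix \<omega> assume "\<forall>j\<in>{..<p}. mat_adjoint (X j N \<omega>) = X j N \<omega>"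
        then have "ew (?Z \<omega>) (lbl T) e (?s e) (?d e) = X (?jj e) N \<omega> $$ (?s e, ?d e)" if e: "e \<in> XA" for e
        proof -
          obtain j b where l: "lbl T e = (Inl j, b)" "?jj e = j" "j < p" using xk[OF e] by blast
          show ?thesis
            unfolding ew_def l(1,2) using \<open>\<forall>j\<in>{..<p}. _\<close> l(3) by (cases b) simp_all
        qed
        moreover have "ew (?Z \<omega>) (lbl T) e (?s e) (?d e) = ew (\<lambda>y. Y y N \<omega>) ?l e (?s e) (?d e)" if "e \<in> ?YA" for e
          unfolding ew_def by (subst yk(2)[OF that]) (cases "?l e", simp)
        moreover have "(\<Prod>e\<in>?A. ew (?Z \<omega>) (lbl T) e (?s e) (?d e)) =
            (\<Prod>e\<in>XA. ew (?Z \<omega>) (lbl T) e (?s e) (?d e)) * (\<Prod>e\<in>?YA. ew (?Z \<omega>) (lbl T) e (?s e) (?d e))"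
          unfolding XA_def by (rule prod.subset_diff[OF YA]) simp
        ultimately show "(\<Prod>e\<in>?A. ew (?Z \<omega>) (lbl T) e (?s e) (?d e)) =
            (\<Prod>e\<in>XA. X (?jj e) N \<omega> $$ (?s e, ?d e)) * (\<Prod>e\<in>?YA. ew (\<lambda>y. Y y N \<omega>) ?l e (?s e) (?d e))"
          by simp
      qed
    qed
    also have "\<dots> = (\<Prod>j<p. \<integral>\<omega>. (\<Prod>e\<in>{e \<in> XA. ?jj e = j}. X j N \<omega> $$ (?s e, ?d e)) \<partial>M N) *
        (\<integral>\<omega>. (\<Prod>e\<in>?YA. ew (\<lambda>y. Y y N \<omega>) ?l e (?s e) (?d e)) \<partial>M N)"
      using YA by (intro indep_integral N0 fin) (auto simp: xk yk ltA XA_def intro: ltA)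
    also have "(\<Prod>j<p. \<integral>\<omega>. (\<Prod>e\<in>{e \<in> XA. ?jj e = j}. X j N \<omega> $$ (?s e, ?d e)) \<partial>M N) =
        (\<Prod>j<p. \<Prod>k\<in>x_key T ` {e \<in> XA. ?jj e = j}. coef M X T k N)"
    proof (rule prod.cong[OF refl])
      fix j assume j: "j \<in> {..<p}"
      let ?B = "{e \<in> XA. ?jj e = j}"
      let ?pr = "\<lambda>e. upair (?s e) (?d e)"
      have B: "finite ?B" using fin by simp
      have ends: "?t e \<in> ?V" "?h e \<in> ?V" if "e \<in> ?B" for e using that by (auto simp: XA_def)
      have same: "x_key T e = x_key T e' \<longleftrightarrow> ?pr e = ?pr e'" if "e \<in> ?B" "e' \<in> ?B" for e e'
      proof -
        have "?pr e = ?pr e' \<longleftrightarrow> \<phi> ` {?t e, ?h e} = \<phi> ` {?t e', ?h e'}" by (simp add: upair_eq_iff)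
        also have "\<dots> \<longleftrightarrow> {?t e, ?h e} = {?t e', ?h e'}"
          using ends that by (intro inj_on_image_eq_iff[OF inj]) auto
        finally show ?thesis using that by (simp add: x_key_def)
      qed
      have "(\<integral>\<omega>. (\<Prod>e\<in>?B. X j N \<omega> $$ (?s e, ?d e)) \<partial>M N) =
          (\<Prod>\<pi>\<in>?pr ` ?B. group_moment M (X j) (fst \<pi>) ?s ?d {e \<in> ?B. ?pr e = \<pi>} N)"
        using j by (intro hw_expectation[OF hw prob_space_axioms N B]) (auto simp: XA_def intro: ltA)
      also have "\<dots> = (\<Prod>k\<in>x_key T ` ?B. coef M X T k N)"
      proof (rule prod_image_eq[OF B])
        show "?pr e = ?pr e' \<longleftrightarrow> x_key T e = x_key T e'" if "e \<in> ?B" "e' \<in> ?B" for e e'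
          using same[OF that] by simp
        fix e assume e: "e \<in> ?B"
        have g: "{e' \<in> ?B. ?pr e' = ?pr e} = x_group T (x_key T e)"
        proof (intro Set.set_eqI iffI)
          fix e' assume e': "e' \<in> {e' \<in> ?B. ?pr e' = ?pr e}"
          then have "x_key T e' = x_key T e" using same[of e' e] e by blast
          then show "e' \<in> x_group T (x_key T e)" using e' by (simp add: x_group_def XA_def)
        next
          fix e' assume e': "e' \<in> x_group T (x_key T e)"
          then have k: "e' \<in> XA" "x_key T e' = x_key T e" by (simp_all add: x_group_def XA_def)
          then have "e' \<in> ?B" using e by simp
          then show "e' \<in> {e' \<in> ?B. ?pr e' = ?pr e}" using same[of e' e] e k(2) by blast
        qed
        let ?S = "{?t e, ?h e}"
        have "group_moment M (X j) (fst (?pr e)) ?s ?d (x_group T (x_key T e)) N =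
            group_moment M (X j) (Min ?S) ?t ?h (x_group T (x_key T e)) N"
        proof (rule group_moment_inj[OF hw N, where S = ?S])
          show "j < p" using j by simp
          show "finite (x_group T (x_key T e))" "x_group T (x_key T e) \<noteq> {}"
            using e by (auto simp: x_group_def XA_def)
          show "{?t e', ?h e'} = ?S" if "e' \<in> x_group T (x_key T e)" for e'
            using that by (auto simp: x_group_def x_key_def)
          show "inj_on \<phi> ?S" by (rule inj_on_subset[OF inj]) (use ends[OF e] in auto)
          show "Min ?S \<in> ?S" by (rule Min_in) auto
          show "fst (?pr e) \<in> \<phi> ` ?S" by (auto simp: upair_def max_def)
        qed
        then show "group_moment M (X j) (fst (?pr e)) ?s ?d {e' \<in> ?B. ?pr e' = ?pr e} N = coef M X T (x_key T e) N"
          unfolding g coef_def using e by (simp add: x_key_def)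
      qed
      finally show "(\<integral>\<omega>. (\<Prod>e\<in>?B. X j N \<omega> $$ (?s e, ?d e)) \<partial>M N) = (\<Prod>k\<in>x_key T ` ?B. coef M X T k N)" .
    qed
    also have "\<dots> = (\<Prod>k\<in>(\<Union>j\<in>{..<p}. x_key T ` {e \<in> XA. ?jj e = j}). coef M X T k N)"
      using fin by (intro prod.UNION_disjoint[symmetric]) auto
    also have "(\<Union>j\<in>{..<p}. x_key T ` {e \<in> XA. ?jj e = j}) = x_keys T"
      using xk(1) unfolding XA_def by blast
    finally show ?thesis .
  qed
  have "mean_inj_traffic M (case_sum X Y) T N =
      (\<integral>\<omega>. 1 / of_nat N * (\<Sum>\<phi>\<in>injmaps ?V N. \<Prod>e\<in>?A. ew (?Z \<omega>) (lbl T) e (\<phi> (?t e)) (\<phi> (?h e))) \<partial>M N)"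
    by (simp add: mean_inj_traffic_def inj_traffic_isum isum_def)
  also have "\<dots> = 1 / of_nat N * (\<Sum>\<phi>\<in>injmaps ?V N. \<integral>\<omega>. (\<Prod>e\<in>?A. ew (?Z \<omega>) (lbl T) e (\<phi> (?t e)) (\<phi> (?h e))) \<partial>M N)"
  proof -
    have "integrable (M N) (\<lambda>\<omega>. \<Prod>e\<in>?A. ew (?Z \<omega>) (lbl T) e (\<phi> (?t e)) (\<phi> (?h e)))" if "\<phi> \<in> injmaps ?V N" for \<phi>
      using that by (intro has_moments_integrable has_moments_prod_ew prob_space_axioms N0 rm)
        (auto simp: injmaps_def)
    then show ?thesis by (subst integral_mult_right_zero, subst Bochner_Integration.integral_sum) auto
  qed
  also have "\<dots> = 1 / of_nat N * (\<Prod>k\<in>x_keys T. coef M X T k N) *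
      (\<Sum>\<phi>\<in>injmaps ?V N. \<integral>\<omega>. (\<Prod>e\<in>?YA. ew (\<lambda>y. Y y N \<omega>) ?l e (\<phi> (?t e)) (\<phi> (?h e))) \<partial>M N)"
    using one by (simp add: sum_distrib_left mult.assoc)
  also have "(\<Sum>\<phi>\<in>injmaps ?V N. \<integral>\<omega>. (\<Prod>e\<in>?YA. ew (\<lambda>y. Y y N \<omega>) ?l e (\<phi> (?t e)) (\<phi> (?h e))) \<partial>M N) =
      mean_isum (shape T) ?YA ?l N"
  proof -
    have "integrable (M N) (\<lambda>\<omega>. \<Prod>e\<in>?YA. ew (\<lambda>y. Y y N \<omega>) ?l e (\<phi> (?t e)) (\<phi> (?h e)))" if "\<phi> \<in> injmaps ?V N" for \<phi>
      using that yk sub by (intro has_moments_integrable has_moments_prod_ew prob_space_axioms N0 rmY)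
        (auto simp: injmaps_def)
    then show ?thesis unfolding mean_isum_def isum_def
      by (subst Bochner_Integration.integral_sum) auto
  qed
  finally show ?thesis .
qed

text \<open>The exponent collects the \<open>1 / N\<close> of the normalization and one
  \<open>1 / N\<close> for each key, which is the scaling of \<open>coef_bounded\<close> and
  \<open>mean_isum_limit\<close>.\<close>

lemma mean_inj_traffic_rescaled:
  assumes T: "test_graph_in (joint_vars p q) T"
  shows "eventually (\<lambda>N. (\<Prod>k\<in>x_keys T. of_nat N * coef M X T k N) *
    (mean_isum (shape T) (y_arcs T) (y_lbl T) N / of_nat N ^ (1 + card (x_keys T))) =
    mean_inj_traffic M (case_sum X Y) T N) at_top"
  using eventually_gt_at_top[of 1]
proof eventually_elim
  case (elim N)
  have "(\<Prod>k\<in>x_keys T. of_nat N * coef M X T k N) = of_nat N ^ card (x_keys T) * (\<Prod>k\<in>x_keys T. coef M X T k N)"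
    by (simp add: prod.distrib)
  then show ?case
    unfolding mean_inj_traffic_factor[OF T elim] using elim by (simp add: field_simps)
qed

lemma coef_bounded:
  assumes T: "test_graph_in (joint_vars p q) T" and k: "k \<in> x_keys T"
  shows "(\<lambda>N. cmod (of_nat N * coef M X T k N)) \<in> O(\<lambda>_. 1)"
proof -
  interpret fin_digraph "shape T" using T by (simp add: test_graph_in_def)
  have j: "fst k < p" using k joint_var_cases(2)[OF T] by auto
  have fin: "finite (x_group T k)" by (simp add: x_group_def)
  have "x_group T k \<noteq> {}" using k by (auto simp: x_group_def)
  then have c: "card (x_group T k) \<ge> 1" using fin by (simp add: Suc_le_eq card_gt_0_iff)
  show ?thesis
  proof (cases "\<forall>e\<in>x_group T k. tail (shape T) e = head (shape T) e")
    case True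
    then show ?thesis
      using diagm_bounded[OF hw[OF j] c] by (simp only: coef_def group_moment_def if_P[OF True])
  next
    case False
    let ?u = "Min (snd k)"
    have "card {e \<in> x_group T k. tail (shape T) e = ?u} + card {e \<in> x_group T k. tail (shape T) e \<noteq> ?u} =
        card ({e \<in> x_group T k. tail (shape T) e = ?u} \<union> {e \<in> x_group T k. tail (shape T) e \<noteq> ?u})"
      using fin by (intro card_Un_disjoint[symmetric]) auto
    also have "{e \<in> x_group T k. tail (shape T) e = ?u} \<union> {e \<in> x_group T k. tail (shape T) e \<noteq> ?u} = x_group T k" by blast
    finally show ?thesis
      using offm_bounded[OF hw[OF j], of "card {e \<in> x_group T k. tail (shape T) e = ?u}"
          "card {e \<in> x_group T k. tail (shape T) e \<noteq> ?u}"] c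
      by (simp only: coef_def group_moment_def if_not_P[OF False])
  qed
qed

text \<open>Contracting each component of the \<open>Y\<close> arcs to a point and each group to one
  edge turns a connected graph into a connected graph; this equation says that the latter is a
  tree.\<close>

definition is_tree :: "(nat + nat) test_graph \<Rightarrow> bool" where
  "is_tree T \<longleftrightarrow> card (gcomps (shape T) (y_arcs T)) = card (x_keys T) + 1"

text \<open>In the tree case a group has equally many arcs in both directions, hence the half of its
  size. Only the parameters and limits of \<open>Y\<close> alone occur, which is what yields the
  claim on the dependence of the limit.\<close>

definition limit :: "(nat + nat) test_graph \<Rightarrow> complex" where
  "limit T = (if is_tree T then (\<Prod>k\<in>x_keys T. of_real (a (fst k) (card (x_group T k) div 2))) *
      (\<Prod>C\<in>gcomps (shape T) (y_arcs T). lim (mean_inj_traffic M Y (comp_test (shape T) (y_arcs T) (y_lbl T) C)))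
    else 0)"

lemma grouped_graph_test:
  assumes "cyclic_in W T"
  shows "grouped_graph (shape T) (y_arcs T) (x_key T)"
proof -
  interpret fin_digraph "shape T" using assms by (simp add: cyclic_in_iff test_graph_in_def)
  show ?thesis
    using assms by unfold_locales (auto simp: cyclic_in_iff test_graph_in_def y_arcs_def x_key_def)
qed

text \<open>In the tree case the group is a bridge, so \<open>bridge_group_balanced_at\<close> makes
  the two exponents equal and \<open>offm_balanced_limit\<close> applies.\<close>

lemma coef_limit:
  assumes T: "cyclic_in (joint_vars p q) T" "is_tree T" and k: "k \<in> x_keys T"
  shows "(\<lambda>N. of_nat N * coef M X T k N) \<longlonglongrightarrow> of_real (a (fst k) (card (x_group T k) div 2))"
proof -
  interpret grouped_graph "shape T" "y_arcs T" "x_key T" by (rule grouped_graph_test[OF T(1)])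
  let ?t = "tail (shape T)" and ?h = "head (shape T)"
  have tg: "test_graph_in (joint_vars p q) T" using T(1) by (simp add: cyclic_in_iff)
  obtain e where e: "e \<in> XA" "k = x_key T e" using k by (auto simp: XA_def)
  obtain f where f: "f \<in> F" "x_key T f = k" using rep[OF e(1)] e(2) by blast
  have grp: "grp f = x_group T k" using f(2) by (auto simp: grp_def XA_def x_group_def)
  have j: "fst k < p" using k joint_var_cases(2)[OF tg] by auto
  have "NB = {}" using NB_empty_iff T(2) unfolding is_tree_def XA_def by blast
  then have nb: "f \<in> F - NB" using f by simp
  let ?u = "Min (snd k)"
  have S: "snd k = {?t f, ?h f}" using f(2) by (auto simp: x_key_def)
  have u: "?u \<in> {?t f, ?h f}" unfolding S by (rule Min_in) auto
  have ends: "{?t e, ?h e} = {?t f, ?h f}" if "e \<in> x_group T k" for e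
  proof -
    have "x_key T e = k" using that by (simp add: x_group_def)
    then have "snd k = {?t e, ?h e}" by (auto simp: x_key_def)
    then show ?thesis using S by (rule trans[OF sym])
  qed
  have ne: "?t f \<noteq> ?h f" by (rule bridge_group(1)[OF nb])
  have hu: "?t e \<noteq> ?u \<longleftrightarrow> ?h e = ?u" if "e \<in> x_group T k" for e
    using ends[OF that] u ne by (auto simp: doubleton_eq_iff)
  let ?c = "card {e \<in> x_group T k. ?t e = ?u}"
  have "{e \<in> x_group T k. ?t e \<noteq> ?u} = {e \<in> x_group T k. ?h e = ?u}" using hu by blast
  then have c: "card {e \<in> x_group T k. ?t e \<noteq> ?u} = ?c"
    using bridge_group_balanced_at[OF nb, of ?u] grp by simp
  have fin: "finite (x_group T k)" by (simp add: x_group_def)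
  have "card (x_group T k) = card ({e \<in> x_group T k. ?t e = ?u} \<union> {e \<in> x_group T k. ?t e \<noteq> ?u})"
    by (rule arg_cong[where f = card]) blast
  also have "\<dots> = ?c + card {e \<in> x_group T k. ?t e \<noteq> ?u}"
    using fin by (intro card_Un_disjoint) auto
  finally have card: "card (x_group T k) = 2 * ?c" using c by simp
  have fk: "f \<in> x_group T k" using f F(1) by (auto simp: x_group_def XA_def)
  then have "card (x_group T k) \<ge> 1" using fin by (simp add: Suc_le_eq card_gt_0_iff) blast
  then have "?c \<ge> 1" using card by linarith
  moreover have "\<not> (\<forall>e\<in>x_group T k. ?t e = ?h e)" using fk ne by blast
  moreover have "?c = card (x_group T k) div 2" using card by simp
  ultimately show ?thesis
    using offm_balanced_limit[OF hw[OF j], of ?c] by (simp only: coef_def group_moment_def if_False c)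
qed

theorem mean_inj_traffic_limit:
  assumes T: "cyclic_in (joint_vars p q) T"
  shows "mean_inj_traffic M (case_sum X Y) T \<longlonglongrightarrow> limit T"
proof -
  interpret grouped_graph "shape T" "y_arcs T" "x_key T" by (rule grouped_graph_test[OF T])
  have tg: "test_graph_in (joint_vars p q) T" using T by (simp add: cyclic_in_iff)
  have Yl: "fst (y_lbl T e) \<in> {..<q}" if "e \<in> y_arcs T" for e
    using joint_var_cases(1)[OF tg, of e] that YA by auto
  note Y = mean_isum_limit[OF grouped_graph_axioms, of "y_lbl T", OF Yl]
  have "(\<lambda>N. (\<Prod>k\<in>x_keys T. of_nat N * coef M X T k N) *
    (mean_isum (shape T) (y_arcs T) (y_lbl T) N / of_nat N ^ (1 + card (x_keys T)))) \<longlonglongrightarrow> limit T"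
  proof (cases "is_tree T")
    case True
    have "(\<lambda>N. mean_isum (shape T) (y_arcs T) (y_lbl T) N / of_nat N ^ (1 + card (x_keys T))) \<longlonglongrightarrow>
        (\<Prod>C\<in>gcomps (shape T) (y_arcs T). lim (mean_inj_traffic M Y (comp_test (shape T) (y_arcs T) (y_lbl T) C)))"
      using Y unfolding if_P[OF True[unfolded is_tree_def]] .
    then show ?thesis
      unfolding limit_def if_P[OF True] by (intro tendsto_mult tendsto_prod coef_limit[OF T True])
  next
    case False
    have "(\<lambda>N. mean_isum (shape T) (y_arcs T) (y_lbl T) N / of_nat N ^ (1 + card (x_keys T))) \<longlonglongrightarrow> 0"
      using Y False by (simp add: is_tree_def)
    then show ?thesis
      unfolding limit_def if_not_P[OF False]
      by (intro bounded_times_null bigo_prod_one coef_bounded[OF tg])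
  qed
  then show ?thesis by (rule Lim_transform_eventually) (rule mean_inj_traffic_rescaled[OF tg])
qed

text \<open>Meant for heavy Wigner components whose cyclicity has not been established. Without
  \<open>Y\<close> arcs the sum counts labellings, at most \<open>N ^ card (verts (shape T))\<close>
  many, which is below the scaling by at least a factor \<open>N\<close>.\<close>

lemma mean_inj_traffic_overfull:
  assumes T: "test_graph_in (joint_vars p q) T" "y_arcs T = {}" and le: "card (verts (shape T)) \<le> card (x_keys T)"
  shows "mean_inj_traffic M (case_sum X Y) T \<longlonglongrightarrow> 0"
proof -
  interpret fin_digraph "shape T" using T by (simp add: test_graph_in_def)
  let ?V = "verts (shape T)" and ?g = "card (x_keys T)"
  have ev: "eventually (\<lambda>N. norm (mean_isum (shape T) {} (y_lbl T) N / of_nat N ^ (1 + ?g)) \<le> inverse (real N)) at_top"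
    using eventually_gt_at_top[of 0]
  proof eventually_elim
    case (elim N)
    interpret prob_space "M N" using prob elim by simp
    have "card (injmaps ?V N) \<le> card (?V \<rightarrow>\<^sub>E {..<N})"
      by (rule card_mono) (auto simp: injmaps_def finite_PiE)
    then have c: "card (injmaps ?V N) \<le> N ^ card ?V" by (simp add: card_PiE)
    also have "\<dots> \<le> N ^ ?g" using elim le by (intro power_increasing) auto
    finally have "real (card (injmaps ?V N)) \<le> real N ^ ?g" by (metis of_nat_le_iff of_nat_power)
    moreover have "mean_isum (shape T) {} (y_lbl T) N = of_nat (card (injmaps ?V N))"
      by (simp add: mean_isum_def isum_def prob_space)
    ultimately show ?case using elim by (simp add: norm_divide norm_power field_simps norm_mult)
  qed
  have "(\<lambda>N. mean_isum (shape T) {} (y_lbl T) N / of_nat N ^ (1 + ?g)) \<longlonglongrightarrow> 0"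
    by (rule Lim_null_comparison[OF ev lim_inverse_n])
  then have "(\<lambda>N. (\<Prod>k\<in>x_keys T. of_nat N * coef M X T k N) *
    (mean_isum (shape T) (y_arcs T) (y_lbl T) N / of_nat N ^ (1 + card (x_keys T)))) \<longlonglongrightarrow> 0"
    unfolding T(2) by (intro bounded_times_null bigo_prod_one coef_bounded[OF T(1)]) (simp_all add: T(2))
  then show ?thesis by (rule Lim_transform_eventually) (rule mean_inj_traffic_rescaled[OF T(1)])
qed

end

section \<open>Trees and the reduced graph\<close>

text \<open>With \<open>E\<close> disjoint from its converse, each undirected edge is listed once in
  \<open>E\<close>, so that \<open>card E\<close> counts the edges.\<close>

definition und :: "'a set \<Rightarrow> ('a \<times> 'a) set \<Rightarrow> 'a pair_pre_digraph" where
  "und U E = \<lparr>pverts = U, parcs = E \<union> E\<inverse>\<rparr>"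

lemma conn_und: "conn fst snd (E \<union> E\<inverse>) = conn fst snd E"
  unfolding conn_def by (rule arg_cong[where f = rtrancl]) auto

lemma wf_und: "E \<subseteq> U \<times> U \<Longrightarrow> wf_digraph (with_proj (und U E))"
  by unfold_locales (auto simp: und_def)

lemma connected_und_iff:
  assumes "E \<subseteq> U \<times> U"
  shows "Digraph_Component.connected (with_proj (und U E)) \<longleftrightarrow>
    U \<noteq> {} \<and> (\<forall>x\<in>U. \<forall>y\<in>U. (x, y) \<in> conn fst snd E)"
  using connected_iff_conn[OF wf_und[OF assms]] by (simp add: und_def conn_und)

lemma cas_conn:
  assumes "pre_digraph.cas (with_proj G) x p y" "set p \<subseteq> F \<union> F\<inverse>"
  shows "(x, y) \<in> conn fst snd F"
  using assms
proof (induction p arbitrary: x)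
  case Nil
  then show ?case by (simp add: pre_digraph.cas.simps)
next
  case (Cons e p)
  then have "fst e = x" "pre_digraph.cas (with_proj G) (snd e) p y"
    by (simp_all add: pre_digraph.cas.simps)
  moreover have "(fst e, snd e) \<in> conn fst snd F"
    using conn_arc[of e "F \<union> F\<inverse>" fst snd] Cons.prems(2) by (simp add: conn_und)
  ultimately show ?case using Cons.IH[of "snd e"] Cons.prems(2) conn_trans[of x "snd e" fst snd F y] by simp
qed

lemma cas_verts: "pre_digraph.cas (with_proj G) x p y \<Longrightarrow> pre_digraph.awalk_verts (with_proj G) x p = x # map snd p"
  by (induction p arbitrary: x) (auto simp: pre_digraph.cas.simps pre_digraph.awalk_verts.simps)

lemma cas_last: "pre_digraph.cas (with_proj G) x p y \<Longrightarrow> p \<noteq> [] \<Longrightarrow> snd (last p) = y"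
  by (induction p arbitrary: x) (auto simp: pre_digraph.cas.simps)

text \<open>
  A cycle of length at least three does not run back along its first edge, so the rest of it joins
  the ends of that edge.
\<close>

lemma und_cycle_iff:
  assumes E: "E \<subseteq> U \<times> U" "E \<inter> E\<inverse> = {}"
  shows "(\<exists>p. pre_digraph.cycle (with_proj (und U E)) p \<and> 3 \<le> length p) \<longleftrightarrow>
    (\<exists>e\<in>E. (fst e, snd e) \<in> conn fst snd (E - {e}))"
proof
  let ?G = "with_proj (und U E)"
  assume "\<exists>p. pre_digraph.cycle ?G p \<and> 3 \<le> length p"
  then obtain x p where p: "pre_digraph.awalk ?G x p x" "distinct (tl (pre_digraph.awalk_verts ?G x p))" "3 \<le> length p"
    by (auto simp: pre_digraph.cycle_def)
  then have cas: "pre_digraph.cas ?G x p x" and arcs: "set p \<subseteq> E \<union> E\<inverse>"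
    by (auto simp: pre_digraph.awalk_def und_def)
  have dist: "distinct (map snd p)" using p(2) cas_verts[OF cas] by simp
  obtain e0 p' where p': "p = e0 # p'" using p(3) by (cases p) auto
  then have e0: "fst e0 = x" "pre_digraph.cas ?G (snd e0) p' x" using cas by (simp_all add: pre_digraph.cas.simps)
  obtain e where e: "e \<in> E" "e = e0 \<or> e = (snd e0, fst e0)" using arcs p' by (cases e0) auto
  \<comment> \<open>The rest of the cycle does not use the first edge again. The reverse arc would
    end in \<open>x\<close>, hence be the last one, and the arc before it would end in
    \<open>snd e0\<close>, a vertex already visited.\<close>
  have "f \<notin> {e0, (snd e0, fst e0)}" if f: "f \<in> set p'" for f
  proof
    assume "f \<in> {e0, (snd e0, fst e0)}"
    moreover have "f \<noteq> e0" using f dist p' by auto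
    ultimately have f': "f = (snd e0, x)" using e0 by auto
    obtain q r where qr: "p' = q @ f # r" using f by (meson split_list)
    have "r = []"
    proof (rule ccontr)
      assume "r \<noteq> []"
      then have "snd (last r) = x" using cas_last[OF e0(2)] qr by simp
      moreover have "snd (last r) \<in> snd ` set r" using \<open>r \<noteq> []\<close> by simp
      ultimately show False using dist qr p' f' by auto
    qed
    then have "q \<noteq> []" using qr p' p(3) by auto
    have "pre_digraph.cas ?G (snd e0) (q @ [f]) x" using e0(2) qr \<open>r = []\<close> by simp
    moreover have "pre_digraph.cas ?G u (q @ [f]) w \<Longrightarrow> q \<noteq> [] \<Longrightarrow> snd (last q) = fst f" for u w
      by (induction q arbitrary: u) (auto simp: pre_digraph.cas.simps split: if_splits)
    ultimately have "snd (last q) = snd e0" using \<open>q \<noteq> []\<close> f' by fastforce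
    moreover have "snd (last q) \<in> snd ` set q" using \<open>q \<noteq> []\<close> by simp
    ultimately show False using dist p' qr by auto
  qed
  then have nb: "f \<noteq> e0" "f \<noteq> (snd e0, fst e0)" if "f \<in> set p'" for f using that by blast+
  have "set p' \<subseteq> (E - {e}) \<union> (E - {e})\<inverse>"
  proof
    fix f assume f: "f \<in> set p'"
    obtain a b where ab: "f = (a, b)" by fastforce
    have "(a, b) \<noteq> e" "(b, a) \<noteq> e" using nb[OF f] e(2) ab by auto
    moreover have "(a, b) \<in> E \<or> (b, a) \<in> E" using arcs p' f ab by auto
    ultimately show "f \<in> (E - {e}) \<union> (E - {e})\<inverse>" using ab by auto
  qed
  then have "(snd e0, x) \<in> conn fst snd (E - {e})" by (rule cas_conn[OF e0(2)])
  then have "(fst e, snd e) \<in> conn fst snd (E - {e})"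
    using e(2) e0(1) conn_sym[of "snd e0" x fst snd "E - {e}"] by auto
  then show "\<exists>e\<in>E. (fst e, snd e) \<in> conn fst snd (E - {e})" using e(1) by blast
next
  let ?G = "with_proj (und U E)"
  assume "\<exists>e\<in>E. (fst e, snd e) \<in> conn fst snd (E - {e})"
  then obtain x y where e: "(x, y) \<in> E" "(x, y) \<in> conn fst snd (E - {(x, y)})" by auto
  let ?E = "E - {(x, y)}"
  let ?H = "with_proj (und U ?E)"
  have E': "?E \<subseteq> U \<times> U" using E by blast
  interpret H: wf_digraph ?H by (rule wf_und[OF E'])
  have U: "x \<in> U" "y \<in> U" using e E by auto
  have "(y, x) \<in> (arcs_ends ?H)\<^sup>*"
  proof -
    have "arcs_ends ?H = (\<Union>e\<in>?E. {(fst e, snd e), (snd e, fst e)})"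
      by (auto simp: arcs_ends_def arc_to_ends_def und_def)
    then show ?thesis using conn_sym[OF e(2)] by (simp add: conn_def)
  qed
  moreover have "(y, w) \<in> rtrancl_on (verts ?H) (arcs_ends ?H)" if "(y, w) \<in> (arcs_ends ?H)\<^sup>*" for w
    using that
  proof (induction rule: rtrancl_induct)
    case base
    show ?case using U by (intro rtrancl_on_refl) (simp add: und_def)
  next
    case (step u v)
    have "v \<in> verts ?H" "u \<in> verts ?H" using step.hyps(2) E' by (auto simp: und_def arcs_ends_def arc_to_ends_def)
    then show ?case using step by (blast intro: rtrancl_on_into_rtrancl_on)
  qed
  ultimately have "y \<rightarrow>\<^sup>*\<^bsub>?H\<^esub> x"
    unfolding reachable_def by blast
  \<comment> \<open>A path without repeated vertices that avoids the edge. As no other edge joins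
    \<open>y\<close> to \<open>x\<close>, it has at least two arcs, and the edge closes it to a
    cycle of length at least three.\<close>
  then obtain p where p: "H.apath y p x" unfolding H.reachable_apath by blast
  then have aw: "H.awalk y p x" "distinct (H.awalk_verts y p)" unfolding H.apath_def by blast+
  then have cas: "pre_digraph.cas ?H y p x" and "set p \<subseteq> arcs ?H" unfolding H.awalk_def by blast+
  then have arcs: "set p \<subseteq> ?E \<union> ?E\<inverse>" by (simp add: und_def)
  have dist: "distinct (y # map snd p)" using aw(2) cas_verts[OF cas] by simp
  have "x \<noteq> y" using e(1) E(2) by auto
  then have "p \<noteq> []" using cas by (auto simp: pre_digraph.cas.simps)
  moreover have "length p \<noteq> 1"
  proof
    assume "length p = 1"
    then obtain f where "p = [f]" by (auto simp: length_Suc_conv)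
    then have "f = (y, x)" using cas by (auto simp: pre_digraph.cas.simps prod_eq_iff)
    then show False using arcs \<open>p = [f]\<close> e(1) E(2) by auto
  qed
  ultimately have len: "3 \<le> length ((x, y) # p)" by (cases p) (auto simp: Suc_le_eq)
  have casG: "pre_digraph.cas ?G u q w \<longleftrightarrow> pre_digraph.cas ?H u q w" for u q w
    by (induction q arbitrary: u) (auto simp: pre_digraph.cas.simps)
  have "pre_digraph.awalk ?G x ((x, y) # p) x"
    using U arcs e(1) cas casG by (auto simp: pre_digraph.awalk_def pre_digraph.cas.simps und_def)
  moreover have "pre_digraph.awalk_verts ?G x ((x, y) # p) = x # y # map snd p"
    using cas_verts[of "und U E" y p x] cas casG by (simp add: pre_digraph.awalk_verts.simps)
  ultimately have "pre_digraph.cycle ?G ((x, y) # p)"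
    using dist by (auto simp: pre_digraph.cycle_def)
  then show "\<exists>p. pre_digraph.cycle ?G p \<and> 3 \<le> length p" using len by blast
qed

text \<open>By \<open>und_cycle_iff\<close>, being a tree means that all edges are bridges, which
  for a connected graph is decided by counting components with and without the edges.\<close>

lemma undirected_tree_iff_card:
  assumes U: "finite U" "E \<subseteq> U \<times> U" "E \<inter> E\<inverse> = {}"
    and con: "Digraph_Component.connected (with_proj (und U E))"
  shows "undirected_tree (und U E) \<longleftrightarrow> card U = card E + 1" and "card U \<le> card E + 1"
proof -
  have fin: "finite E" using U(1,2) by (meson finite_SigmaI finite_subset)
  have ends: "fst ` E \<union> snd ` E \<subseteq> U" using U(2) by auto
  have c: "U \<noteq> {}" "\<And>x y. x \<in> U \<Longrightarrow> y \<in> U \<Longrightarrow> (x, y) \<in> conn fst snd E"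
    using con connected_und_iff[OF U(2)] by auto
  have 1: "card (comps fst snd U ({} \<union> E)) = 1"
    using comps_connected[OF ends c] by simp
  have 0: "card (comps fst snd U {}) = card U" by (simp add: comps_empty card_image)
  show "card U \<le> card E + 1"
    using card_comps_Un_le[OF U(1) fin ends, of "{}"] 0 1 by simp
  have "undirected_tree (und U E) \<longleftrightarrow> (\<forall>e\<in>E. (fst e, snd e) \<notin> conn fst snd (E - {e}))"
    using con und_cycle_iff[OF U(2,3)] by (simp add: undirected_tree_def)
  also have "\<dots> \<longleftrightarrow> card U = card E + 1"
    using card_comps_independent[OF U(1) fin ends, of "{}"] independent_if_card_comps[OF U(1) fin ends, of "{}"] 0 1
    by auto
  finally show "undirected_tree (und U E) \<longleftrightarrow> card U = card E + 1" .
qed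

section \<open>One-coloured components and the incidences of the reduced graph\<close>

locale colored_graph = fin_digraph G for G :: "('a, 'b) pre_digraph" +
  fixes c :: "'b \<Rightarrow> 'f"
  assumes con: "Digraph_Component.connected G" and arcs_ne: "arcs G \<noteq> {}"
begin

definition A where "A f = {e \<in> arcs G. c e = f}"
text \<open>\<open>cl e\<close> and \<open>hc e\<close> are the one-coloured component through the
  arc \<open>e\<close>, as a vertex set and as a graph. Indexing by arcs leaves out vertices without
  an arc of the colour. \<open>K\<close> and \<open>L\<close> become the two kinds of vertices of
  the reduced graph and \<open>R\<close> its edges.\<close>

definition cl where "cl e = gconn G (A (c e)) `` {tail G e}"
definition hc where "hc e = comp_graph G (A (c e)) (cl e)"
definition K where "K = hc ` arcs G"
definition L where "L = {v. \<exists>H\<in>K. \<exists>H'\<in>K. H \<noteq> H' \<and> v \<in> verts H \<and> v \<in> verts H'}"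
definition R :: "(('a, 'b) pre_digraph + 'a) rel" where
  "R = {(Inl H, Inr v) | H v. H \<in> K \<and> v \<in> L \<and> v \<in> verts H}"

lemma A: "A f \<subseteq> arcs G" "finite (A f)"
  by (auto simp: A_def intro: finite_subset[OF _ finite_arcs])

lemma A_ends: "tail G ` A f \<union> head G ` A f \<subseteq> verts G"
  by (rule wf_ends_subset[OF wf_digraph_axioms A(1)])

lemma cl_comps: "e \<in> arcs G \<Longrightarrow> cl e \<in> gcomps G (A (c e))"
  by (auto simp: cl_def comps_def)

lemma cl: "e \<in> arcs G \<Longrightarrow> tail G e \<in> cl e" "e \<in> arcs G \<Longrightarrow> head G e \<in> cl e" "e \<in> arcs G \<Longrightarrow> cl e \<subseteq> verts G"
  using conn_arc[of e "A (c e)" "tail G" "head G"] comps_subset[OF A_ends cl_comps]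
  by (auto simp: cl_def A_def)

lemma hc [simp]: "verts (hc e) = cl e" "arcs (hc e) = {e' \<in> A (c e). tail G e' \<in> cl e}"
  "tail (hc e) = tail G" "head (hc e) = head G"
  by (simp_all add: hc_def)

lemma finite_K: "finite K"
  by (simp add: K_def)

lemma cl_eq:
  assumes "e \<in> arcs G" "e' \<in> arcs G" "c e = c e'" "v \<in> cl e" "v \<in> cl e'"
  shows "cl e = cl e'"
  using comps_eq_class[OF cl_comps[OF assms(1)] assms(4)] comps_eq_class[OF cl_comps[OF assms(2)] assms(5)]
    assms(3) by simp

lemma hc_eq:
  assumes "e \<in> arcs G" "e' \<in> arcs G" "c e = c e'" "v \<in> cl e" "v \<in> cl e'"
  shows "hc e = hc e'"
  using cl_eq[OF assms] assms(3) by (simp add: hc_def)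

lemma hc_arc: "e \<in> arcs G \<Longrightarrow> e' \<in> arcs (hc e) \<Longrightarrow> hc e' = hc e"
  by (rule hc_eq[of _ _ "tail G e'"]) (auto simp: A_def cl)

lemma vertex_arc:
  assumes "v \<in> verts G"
  obtains e where "e \<in> arcs G" "v = tail G e \<or> v = head G e"
proof -
  obtain e0 where e0: "e0 \<in> arcs G" using arcs_ne by blast
  have "\<exists>e\<in>arcs G. v = tail G e \<or> v = head G e"
  proof (rule ccontr)
    assume no: "\<not> ?thesis"
    have "(v, tail G e0) \<in> gconn G (arcs G)"
      using con assms e0 connected_iff_conn[OF wf_digraph_axioms] by auto
    then have "v \<in> {v} \<longleftrightarrow> tail G e0 \<in> {v}"
      by (rule conn_closed[rotated]) (use no in auto)
    then show False using no e0 by auto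
  qed
  then show ?thesis using that by blast
qed

lemma vertex_comp: "v \<in> verts G \<Longrightarrow> \<exists>H\<in>K. v \<in> verts H"
proof (erule vertex_arc)
  fix e assume e: "e \<in> arcs G" "v = tail G e \<or> v = head G e"
  then have "v \<in> verts (hc e)" using cl by auto
  then show ?thesis using e(1) unfolding K_def by blast
qed

lemma K_verts:
  assumes "H \<in> K"
  shows "verts H \<subseteq> verts G" "finite (verts H)" "verts H \<noteq> {}"
proof -
  obtain e where e: "e \<in> arcs G" "H = hc e" using assms by (auto simp: K_def)
  show "verts H \<subseteq> verts G" using cl(3)[OF e(1)] e(2) by simp
  then show "finite (verts H)" using finite_verts by (rule finite_subset)
  show "verts H \<noteq> {}" using cl(1)[OF e(1)] e(2) by auto
qed

lemma L: "L \<subseteq> verts G"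
  using K_verts by (auto simp: L_def)

lemma same_vertex_conn:
  assumes "H \<in> K" "H' \<in> K" "v \<in> verts H" "v \<in> verts H'"
  shows "(Inl H, Inl H') \<in> conn fst snd R"
proof (cases "H = H'")
  case False
  then have "v \<in> L" using assms by (auto simp: L_def)
  then have "(Inl H, Inr v) \<in> R" "(Inl H', Inr v) \<in> R" using assms by (auto simp: R_def)
  then have "(Inl H, Inr v) \<in> conn fst snd R" "(Inl H', Inr v) \<in> conn fst snd R"
    using conn_arc[of _ R fst snd] by fastforce+
  then show ?thesis using conn_trans[of "Inl H" "Inr v" fst snd R] conn_sym[of "Inl H'" "Inr v"] by blast
qed simp

text \<open>The vertices all of whose components are joined to \<open>H\<close> form a set that no
  arc of \<open>G\<close> crosses, because the component of an arc contains both of its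
  ends.\<close>

lemma K_conn:
  assumes "H \<in> K" "H' \<in> K"
  shows "(Inl H, Inl H') \<in> conn fst snd R"
proof -
  obtain u v where uv: "u \<in> verts H" "v \<in> verts H'" using K_verts(3) assms by blast
  let ?S = "{w. \<forall>H'\<in>K. w \<in> verts H' \<longrightarrow> (Inl H, Inl H') \<in> conn fst snd R}"
  have "(u, v) \<in> gconn G (arcs G)"
    using con uv assms K_verts(1) connected_iff_conn[OF wf_digraph_axioms] by blast
  then have "u \<in> ?S \<longleftrightarrow> v \<in> ?S"
  proof (rule conn_closed[rotated])
    fix e assume e: "e \<in> arcs G"
    have K: "hc e \<in> K" "tail G e \<in> verts (hc e)" "head G e \<in> verts (hc e)"
      using e by (auto simp: K_def cl)
    have "y \<in> ?S" if "x \<in> ?S" "x \<in> verts (hc e)" "y \<in> verts (hc e)" for x y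
    proof safe
      fix H' assume H': "H' \<in> K" "y \<in> verts H'"
      have "(Inl H, Inl (hc e)) \<in> conn fst snd R" using that K by blast
      moreover have "(Inl (hc e), Inl H') \<in> conn fst snd R" using same_vertex_conn[OF K(1) H'(1) that(3) H'(2)] .
      ultimately show "(Inl H, Inl H') \<in> conn fst snd R" by (rule conn_trans)
    qed
    then show "tail G e \<in> ?S \<longleftrightarrow> head G e \<in> ?S" using K(2,3) by blast
  qed
  moreover have "u \<in> ?S" using same_vertex_conn[OF assms(1) _ uv(1)] by blast
  ultimately show ?thesis using uv(2) assms(2) by blast
qed

lemma reduced_connected: "Digraph_Component.connected (with_proj (und (Inl ` K \<union> Inr ` L) R))"
proof (rule connected_und_iff[THEN iffD2])
  show sub: "R \<subseteq> (Inl ` K \<union> Inr ` L) \<times> (Inl ` K \<union> Inr ` L)" by (auto simp: R_def)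
  obtain e0 where e0: "e0 \<in> arcs G" using arcs_ne by blast
  have root: "(Inl (hc e0), x) \<in> conn fst snd R" if "x \<in> Inl ` K \<union> Inr ` L" for x
  proof -
    have K0: "hc e0 \<in> K" using e0 by (simp add: K_def)
    consider H where "x = Inl H" "H \<in> K" | v H where "x = Inr v" "v \<in> L" "H \<in> K" "v \<in> verts H"
      using \<open>x \<in> _\<close> unfolding L_def by blast
    then show ?thesis
    proof cases
      case 1
      then show ?thesis using K_conn[OF K0] by simp
    next
      case 2
      then have "(Inl H, Inr v) \<in> R" by (auto simp: R_def)
      then have "(Inl H, Inr v) \<in> conn fst snd R" using conn_arc[of "(Inl H, Inr v)" R fst snd] by simp
      then show ?thesis using conn_trans[OF K_conn[OF K0 2(3)]] 2(1) by blast
    qed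
  qed
  have "(x, y) \<in> conn fst snd R" if "x \<in> Inl ` K \<union> Inr ` L" "y \<in> Inl ` K \<union> Inr ` L" for x y
    using conn_trans[OF conn_sym[OF root[OF that(1)]] root[OF that(2)]] .
  moreover have "Inl ` K \<union> Inr ` L \<noteq> {}" using e0 by (auto simp: K_def)
  ultimately show "Inl ` K \<union> Inr ` L \<noteq> {} \<and>
    (\<forall>x\<in>Inl ` K \<union> Inr ` L. \<forall>y\<in>Inl ` K \<union> Inr ` L. (x, y) \<in> conn fst snd R)" by blast
qed

text \<open>A double count of the pairs of a component and one of its vertices: those with a shared
  vertex are the elements of \<open>R\<close>, and every other vertex lies in exactly one
  component.\<close>

lemma card_R: "int (card R) = (\<Sum>H\<in>K. int (card (verts H))) - int (card (verts G)) + int (card L)"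
proof -
  have fL: "finite L" using L finite_verts by (rule finite_subset)
  let ?I = "Sigma K verts"
  have fI: "finite ?I" using finite_K K_verts by auto
  have "card R = card {x \<in> ?I. snd x \<in> L}"
    by (rule bij_betw_same_card[of "\<lambda>(x, y). (projl x, projr y)"], rule bij_betw_byWitness[where f' = "\<lambda>(H, v). (Inl H, Inr v)"])
      (auto simp: R_def)
  moreover have "card {x \<in> ?I. snd x \<notin> L} = card (verts G - L)"
  proof (rule bij_betw_same_card[of snd])
    show "bij_betw snd {x \<in> ?I. snd x \<notin> L} (verts G - L)"
    proof (rule bij_betw_imageI)
      show "inj_on snd {x \<in> ?I. snd x \<notin> L}"
      proof (rule inj_onI)
        fix x y assume xy: "x \<in> {x \<in> ?I. snd x \<notin> L}" "y \<in> {x \<in> ?I. snd x \<notin> L}" "snd x = snd y"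
        then have "fst x = fst y" unfolding L_def by force
        then show "x = y" using xy(3) by (rule prod_eqI)
      qed
      show "snd ` {x \<in> ?I. snd x \<notin> L} = verts G - L"
      proof (intro Set.set_eqI iffI)
        fix v assume "v \<in> verts G - L"
        then obtain H where "H \<in> K" "v \<in> verts H" using vertex_comp by blast
        then have "(H, v) \<in> {x \<in> ?I. snd x \<notin> L}" using \<open>v \<in> verts G - L\<close> by simp
        then show "v \<in> snd ` {x \<in> ?I. snd x \<notin> L}" by force
      next
        fix v assume "v \<in> snd ` {x \<in> ?I. snd x \<notin> L}"
        then obtain H where "H \<in> K" "v \<in> verts H" "v \<notin> L" by auto
        then show "v \<in> verts G - L" using K_verts(1) by blast
      qed
    qed
  qed
  moreover have "card ?I = card {x \<in> ?I. snd x \<in> L} + card {x \<in> ?I. snd x \<notin> L}"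
    using fI by (subst card_Un_disjoint[symmetric]) (auto intro: arg_cong[where f = card])
  moreover have "card ?I = (\<Sum>H\<in>K. card (verts H))" using finite_K K_verts(2) by simp
  moreover have "card (verts G - L) = card (verts G) - card L" "card L \<le> card (verts G)"
    using L fL by (auto simp: card_Diff_subset card_mono)
  ultimately show ?thesis by (simp flip: of_nat_sum)
qed

text \<open>By \<open>card_R\<close> the shared vertices cancel from the tree equation
  \<open>card K + card L = card R + 1\<close>. The inequality is the corresponding bound for
  connected graphs.\<close>

lemma reduced_tree_iff:
  shows "undirected_tree (und (Inl ` K \<union> Inr ` L) R) \<longleftrightarrow>
      int (card (verts G)) - 1 = (\<Sum>H\<in>K. int (card (verts H)) - 1)"
    and "int (card (verts G)) - 1 \<le> (\<Sum>H\<in>K. int (card (verts H)) - 1)"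
proof -
  have fL: "finite L" using L finite_verts by (rule finite_subset)
  have U: "finite (Inl ` K \<union> Inr ` L)" using finite_K fL by simp
  have sub: "R \<subseteq> (Inl ` K \<union> Inr ` L) \<times> (Inl ` K \<union> Inr ` L)" by (auto simp: R_def)
  have asym: "R \<inter> R\<inverse> = {}" by (auto simp: R_def)
  have "card (Inl ` K \<union> Inr ` L) = card K + card L"
    using finite_K fL by (subst card_Un_disjoint) (auto simp: card_image)
  then have cU: "int (card (Inl ` K \<union> Inr ` L)) = int (card K) + int (card L)" by simp
  have s: "(\<Sum>H\<in>K. int (card (verts H)) - 1) = (\<Sum>H\<in>K. int (card (verts H))) - int (card K)"
    by (simp add: sum_subtractf)
  define u r where "u = card (Inl ` K \<union> Inr ` L)" and "r = card R"
  have t: "undirected_tree (und (Inl ` K \<union> Inr ` L) R) \<longleftrightarrow> u = r + 1"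
    unfolding u_def r_def by (rule undirected_tree_iff_card(1)[OF U sub asym reduced_connected])
  have t2: "u \<le> r + 1"
    unfolding u_def r_def by (rule undirected_tree_iff_card(2)[OF U sub asym reduced_connected])
  have z: "u = r + 1 \<longleftrightarrow> int u - int r - 1 = 0" by linarith
  have "int u = int (card K) + int (card L)" using cU by (simp add: u_def)
  then have "int u - int r - 1 =
      int (card (verts G)) - 1 - (\<Sum>H\<in>K. int (card (verts H)) - 1)"
    unfolding r_def s card_R by simp
  then show "undirected_tree (und (Inl ` K \<union> Inr ` L) R) \<longleftrightarrow>
      int (card (verts G)) - 1 = (\<Sum>H\<in>K. int (card (verts H)) - 1)"
    and "int (card (verts G)) - 1 \<le> (\<Sum>H\<in>K. int (card (verts H)) - 1)"
    using t t2 z by linarith+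
qed

definition KF where "KF f = hc ` A f"

lemma KF_disjoint: "f \<noteq> f' \<Longrightarrow> KF f \<inter> KF f' = {}"
proof (rule ccontr)
  assume "f \<noteq> f'" "KF f \<inter> KF f' \<noteq> {}"
  then obtain e e' where e: "e \<in> A f" "e' \<in> A f'" "hc e = hc e'" by (auto simp: KF_def)
  then have "e \<in> arcs (hc e')" unfolding e(3)[symmetric] by (auto simp: A_def cl)
  then show False using e \<open>f \<noteq> f'\<close> by (auto simp: A_def)
qed

lemma verts_KF: "inj_on verts (KF f)"
proof (rule inj_onI)
  fix H H' assume "H \<in> KF f" "H' \<in> KF f" "verts H = verts H'"
  then obtain e e' where e: "e \<in> A f" "e' \<in> A f" "H = hc e" "H' = hc e'" "cl e = cl e'" by (auto simp: KF_def)
  then show "H = H'" by (simp add: hc_def A_def)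
qed

lemma gcomps_KF:
  shows "verts ` KF f \<subseteq> gcomps G (A f)"
    and "C \<in> gcomps G (A f) - verts ` KF f \<Longrightarrow> \<exists>v. C = {v} \<and> {e \<in> A f. tail G e \<in> C} = {}"
proof -
  show "verts ` KF f \<subseteq> gcomps G (A f)" using cl_comps by (auto simp: KF_def A_def)
  assume C: "C \<in> gcomps G (A f) - verts ` KF f"
  have no: "tail G e \<notin> C" if e: "e \<in> A f" for e
  proof
    assume "tail G e \<in> C"
    then have "C = gconn G (A f) `` {tail G e}" using C by (intro comps_eq_class) auto
    also have "\<dots> = cl e" using e by (simp add: cl_def A_def)
    finally have "C = verts (hc e)" by simp
    then have "C \<in> verts ` KF f" using e unfolding KF_def by blast
    then show False using C by blast
  qed
  obtain v where v: "C = gconn G (A f) `` {v}" using C by (auto simp: comps_def)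
  have "C = {v}"
  proof
    show "C \<subseteq> {v}"
    proof
      fix u assume "u \<in> C"
      then have "(v, u) \<in> gconn G (A f)" using v by simp
      then have "v \<in> {v} \<longleftrightarrow> u \<in> {v}"
      proof (rule conn_closed[rotated])
        fix e assume e: "e \<in> A f"
        have "C \<in> gcomps G (A f)" using C by blast
        then have "tail G e \<notin> C" "head G e \<notin> C" using no[OF e] comps_arc_iff[OF _ e] by blast+
        then show "tail G e \<in> {v} \<longleftrightarrow> head G e \<in> {v}" using v by auto
      qed
      then show "u \<in> {v}" by simp
    qed
  qed (use v in auto)
  then show "\<exists>v. C = {v} \<and> {e \<in> A f. tail G e \<in> C} = {}" using no by blast
qed

text \<open>The components of a colour on all vertices of \<open>G\<close> differ from those in
  \<open>KF f\<close> by isolated vertices only, which contribute 0 to the sum.\<close>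

lemma sum_KF: "(\<Sum>H\<in>KF f. int (card (verts H)) - 1) = int (card (verts G)) - int (card (gcomps G (A f)))"
proof -
  have fin: "finite (gcomps G (A f))" by simp
  have "(\<Sum>H\<in>KF f. int (card (verts H)) - 1) = (\<Sum>C\<in>verts ` KF f. int (card C) - 1)"
    using sum.reindex[OF verts_KF[of f], of "\<lambda>C. int (card C) - 1"] by (simp add: comp_def)
  also have "\<dots> = (\<Sum>C\<in>gcomps G (A f). int (card C) - 1)"
  proof (intro sum.mono_neutral_left fin gcomps_KF(1) ballI)
    fix C assume "C \<in> gcomps G (A f) - verts ` KF f"
    then obtain v where "C = {v}" using gcomps_KF(2) by blast
    then show "int (card C) - 1 = 0" by simp
  qed
  also have "\<dots> = int (\<Sum>C\<in>gcomps G (A f). card C) - int (card (gcomps G (A f)))"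
    by (simp add: sum_subtractf)
  finally show ?thesis using sum_card_comps[OF finite_verts A_ends] by simp
qed

end

section \<open>Asymptotic traffic-freeness\<close>

lemma family_comps_eq:
  assumes "colored_graph (shape T)"
  shows "family_comps fam T = colored_graph.K (shape T) (\<lambda>e. fam (fst (lbl T e)))"
proof -
  interpret colored_graph "shape T" "\<lambda>e. fam (fst (lbl T e))" by fact
  have "{H. pre_digraph.max_subgraph (family_subgraph fam T f) Digraph_Component.connected H} = hc ` A f" for f
  proof -
    let ?S = "family_subgraph fam T f"
    have S: "arcs ?S = A f" "tail ?S = tail (shape T)" "head ?S = head (shape T)"
      "verts ?S = tail (shape T) ` A f \<union> head (shape T) ` A f"
      by (simp_all add: family_subgraph_def Let_def A_def)
    have "wf_digraph ?S" by unfold_locales (auto simp: S)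
    then have "{H. pre_digraph.max_subgraph ?S Digraph_Component.connected H} = comp_graph ?S (A f) ` gcomps ?S (A f)"
      using max_connected_subgraphs S(1) by metis
    also have "comp_graph ?S (A f) = comp_graph (shape T) (A f)"
      by (rule ext) (simp add: comp_graph_def S)
    also have "gcomps ?S (A f) = cl ` A f"
    proof (intro Set.set_eqI iffI)
      fix C assume "C \<in> gcomps ?S (A f)"
      then obtain e v where e: "e \<in> A f" "v = tail (shape T) e \<or> v = head (shape T) e"
        "C = gconn (shape T) (A f) `` {v}"
        unfolding comps_def S by blast
      then have "gconn (shape T) (A f) `` {v} = gconn (shape T) (A f) `` {tail (shape T) e}"
        using conn_arc[OF e(1), of "tail (shape T)" "head (shape T)"] conn_sym
        unfolding conn_class_eq by fastforce
      then show "C \<in> cl ` A f" using e by (auto simp: cl_def A_def)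
    next
      fix C assume "C \<in> cl ` A f"
      then obtain e where e: "e \<in> A f" "C = cl e" by blast
      then have "C = gconn (shape T) (A f) `` {tail (shape T) e}" by (simp add: cl_def A_def)
      then show "C \<in> gcomps ?S (A f)" using e(1) unfolding comps_def S by blast
    qed
    also have "comp_graph (shape T) (A f) ` cl ` A f = hc ` A f"
      unfolding image_image by (intro image_cong refl) (simp add: hc_def A_def)
    finally show ?thesis .
  qed
  moreover have "family_comps fam T =
      (\<Union>f. {H. pre_digraph.max_subgraph (family_subgraph fam T f) Digraph_Component.connected H})"
    by (auto simp: family_comps_def)
  ultimately have "family_comps fam T = (\<Union>f. hc ` A f)" by (simp only:)
  also have "\<dots> = K" by (auto simp: K_def A_def)
  finally show ?thesis .
qed

lemma free_product_iff:
  assumes "colored_graph (shape T)"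
  shows "free_product fam T \<longleftrightarrow> int (card (verts (shape T))) - 1 =
    (\<Sum>H\<in>colored_graph.K (shape T) (\<lambda>e. fam (fst (lbl T e))). int (card (verts H)) - 1)"
proof -
  interpret colored_graph "shape T" "\<lambda>e. fam (fst (lbl T e))" by fact
  have L: "shared_verts fam T = L"
    unfolding shared_verts_def family_comps_eq[OF assms] L_def ..
  have "reduced_graph fam T = und (Inl ` K \<union> Inr ` L) R"
    unfolding reduced_graph_def Let_def L family_comps_eq[OF assms] und_def R_def ..
  then show ?thesis
    using reduced_tree_iff(1) arcs_ne by (simp add: free_product_def)
qed

text \<open>With \<open>YA = {}\<close> the components are the single vertices.\<close>

lemma keyed_card_verts_le:
  assumes "keyed_graph G {} key"
  shows "card (verts G) \<le> card (key ` arcs G) + 1"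
proof -
  interpret keyed_graph G "{}" key by fact
  show ?thesis using card_comps_YA_le by (simp add: comps_empty card_image XA_def)
qed

context heavy_wigner_joint
begin

lemma limit_arcless:
  assumes T: "cyclic_in (joint_vars p q) T" and "arcs (shape T) = {}"
  shows "limit T = 1"
proof -
  have wf: "wf_digraph (shape T)" and con: "Digraph_Component.connected (shape T)"
    using T by (auto simp: cyclic_in_iff test_graph_in_def fin_digraph_def)
  have "verts (shape T) \<noteq> {}" "\<And>u v. u \<in> verts (shape T) \<Longrightarrow> v \<in> verts (shape T) \<Longrightarrow> u = v"
    using con unfolding connected_iff_conn[OF wf] assms(2) by (auto simp: conn_empty)
  then obtain v where v: "verts (shape T) = {v}" by blast
  have "mean_inj_traffic M (case_sum X Y) T \<longlonglongrightarrow> 1"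
    by (rule mean_inj_traffic_vertex[OF prob assms(2) v])
  then show ?thesis using mean_inj_traffic_limit[OF T] LIMSEQ_unique by blast
qed

lemma family_comps_arcless:
  assumes "arcs (shape T) = {}"
  shows "family_comps fam T = {}"
proof -
  have "\<not> pre_digraph.max_subgraph (family_subgraph fam T f) Digraph_Component.connected H" for f H
  proof
    assume m: "pre_digraph.max_subgraph (family_subgraph fam T f) Digraph_Component.connected H"
    then have "wf_digraph H" "verts H \<subseteq> {}" "Digraph_Component.connected H"
      using assms by (auto simp: pre_digraph.max_subgraph_def subgraph_def family_subgraph_def)
    then show False using connected_iff_conn[of H] by blast
  qed
  then show ?thesis by (simp add: family_comps_def)
qed

text \<open>Let \<open>n\<close> be the number of components of the \<open>Y\<close> arcs,
  \<open>g\<close> the number of keys, and \<open>s\<close> the sum of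
  \<open>card (verts H) - 1\<close> over the heavy Wigner components \<open>H\<close>. Then
  \<open>n - 1 \<le> s \<le> g\<close>. The first inequality is \<open>reduced_tree_iff(2)\<close>
  with the \<open>Y\<close> components evaluated by \<open>sum_KF\<close>, and equality means a free
  product. The second adds up \<open>gH\<close>, and equality means that each \<open>H\<close>
  satisfies the tree equality. So \<open>is_tree T\<close> is equality in both.\<close>

lemma limit_family_comps:
  assumes T: "cyclic_in (joint_vars p q) T" and ne: "arcs (shape T) \<noteq> {}"
  shows "limit T = (if free_product (joint_fam p) T
    then \<Prod>H\<in>family_comps (joint_fam p) T. lim (mean_inj_traffic M (case_sum X Y) (T\<lparr>shape := H\<rparr>)) else 0)"
proof -
  let ?c = "\<lambda>e. joint_fam p (fst (lbl T e))"
  let ?G = "shape T" and ?YA = "y_arcs T"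
  let ?T = "\<lambda>H. T\<lparr>shape := H\<rparr>"
  have tg: "test_graph_in (joint_vars p q) T" using T by (simp add: cyclic_in_iff)
  interpret gg: grouped_graph ?G ?YA "x_key T" by (rule grouped_graph_test[OF T])
  interpret cg: colored_graph ?G ?c using gg.con ne by unfold_locales auto
  note K_eq = family_comps_eq[of T "joint_fam p", OF cg.colored_graph_axioms]
  note free_iff = free_product_iff[of T "joint_fam p", OF cg.colored_graph_axioms]
  define KX where "KX = cg.hc ` gg.XA"
  have colX: "?c e = fst (x_key T e)" "?c e < p" if "e \<in> gg.XA" for e
    using joint_var_cases(2)[OF tg, of e] that by (auto simp: gg.XA_def joint_fam_def)
  have colY: "?c e = p" if "e \<in> ?YA" for e
    using joint_var_cases(1)[OF tg, of e] that gg.YA by (auto simp: joint_fam_def)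
  have YA: "cg.A p = ?YA"
  proof (intro Set.set_eqI iffI)
    fix e assume "e \<in> cg.A p"
    then have e: "e \<in> arcs ?G" "?c e = p" by (auto simp: cg.A_def)
    then have "e \<notin> gg.XA" using colX(2)[of e] by auto
    then show "e \<in> ?YA" using e gg.arcs_split(1) by auto
  next
    fix e assume "e \<in> ?YA"
    then show "e \<in> cg.A p" using colY gg.YA by (auto simp: cg.A_def)
  qed
  have K: "cg.K = KX \<union> cg.KF p"
    unfolding cg.K_def KX_def cg.KF_def YA gg.arcs_split(1) by blast
  have disj: "KX \<inter> cg.KF p = {}"
  proof (rule ccontr)
    assume "KX \<inter> cg.KF p \<noteq> {}"
    then obtain e e' where e: "e \<in> gg.XA" "e' \<in> cg.A p" "cg.hc e = cg.hc e'" by (auto simp: KX_def cg.KF_def)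
    have "cg.hc e \<in> cg.KF (?c e)" using e(1) by (auto simp: cg.KF_def cg.A_def gg.XA_def)
    moreover have "cg.hc e \<in> cg.KF p" using e by (auto simp: cg.KF_def)
    ultimately show False using cg.KF_disjoint[of "?c e" p] colX(2)[OF e(1)] by auto
  qed
  have finK: "finite KX" "finite (cg.KF p)"
    using cg.finite_K K by auto
  have KX_arcs: "arcs H \<subseteq> gg.XA" if H: "H \<in> KX" for H
  proof
    fix e' assume e': "e' \<in> arcs H"
    obtain e where e: "e \<in> gg.XA" "H = cg.hc e" using H by (auto simp: KX_def)
    then have "e' \<in> arcs ?G" "?c e' = ?c e" using e' by (auto simp: cg.A_def)
    then show "e' \<in> gg.XA" using colX(2)[OF e(1)] colY[of e'] gg.arcs_split(1) by auto
  qed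
  have K_cases: "\<exists>e. e \<in> arcs ?G \<and> H = cg.hc e" if "H \<in> cg.K" for H
    using that by (auto simp: cg.K_def)
  have tgH: "test_graph_in (joint_vars p q) (?T H)" if H: "H \<in> cg.K" for H
  proof -
    obtain e where e: "e \<in> arcs ?G" "H = cg.hc e" using K_cases[OF H] by blast
    then show ?thesis
      using tg fin_comp_graph[OF gg.fin_digraph_axioms cg.A(1) cg.cl_comps[OF e(1)]]
        connected_comp_graph[OF gg.wf_digraph_axioms cg.A(1) cg.cl_comps[OF e(1)]]
      by (auto simp: test_graph_in_def cg.hc_def cg.A_def)
  qed
  have H_simps: "tail H = tail ?G" "head H = head ?G" if "H \<in> cg.K" for H
    using K_cases[OF that] by auto
  have keyH: "x_key (?T H) = x_key T" if "H \<in> cg.K" for H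
    by (rule ext) (simp add: x_key_def H_simps[OF that])
  have yH: "y_arcs (?T H) = {}" if "H \<in> KX" for H
  proof -
    have "arcs H \<subseteq> arcs ?G - y_arcs T" using KX_arcs[OF that] unfolding gg.XA_def .
    then show ?thesis by (auto simp: y_arcs_def)
  qed
  have keysH: "x_keys (?T H) = x_key T ` arcs H" if "H \<in> KX" for H
    using keyH[of H] yH[OF that] that K by simp
  \<comment> \<open>Arcs with the same key have the same variable and the same ends, so they lie in
    one component. Hence the groups of \<open>T\<close> are distributed over the components in
    \<open>KX\<close> without being split.\<close>
  have sameH: "e' \<in> arcs H" if H: "H \<in> KX" "e \<in> arcs H" "e' \<in> gg.XA" "x_key T e = x_key T e'" for H e e'
  proof -
    obtain e0 where e0: "e0 \<in> gg.XA" "H = cg.hc e0" using H(1) by (auto simp: KX_def)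
    have eX: "e \<in> gg.XA" using KX_arcs[OF H(1)] H(2) by blast
    have he: "cg.hc e = H" using cg.hc_arc[of e0 e] e0 H(2) by (simp add: gg.XA_def)
    have c: "?c e' = ?c e" using colX(1)[OF eX] colX(1)[OF H(3)] H(4) by simp
    have "tail ?G e' \<in> {tail ?G e, head ?G e}"
      using gg.same_ends[OF eX H(3,4)] by blast
    then have t: "tail ?G e' \<in> cg.cl e" using cg.cl eX by (auto simp: gg.XA_def)
    then have "e' \<in> arcs (cg.hc e)" using H(3) c by (simp add: cg.A_def gg.XA_def)
    then show ?thesis using he by simp
  qed
  have groupH: "x_group (?T H) k = x_group T k" if H: "H \<in> KX" and k: "k \<in> x_keys (?T H)" for H k
  proof -
    obtain e where e: "e \<in> arcs H" "k = x_key T e" using k keysH[OF H] by blast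
    have "x_group (?T H) k = {e' \<in> arcs H. x_key T e' = k}"
      using yH[OF H] keyH[of H] H K by (simp add: x_group_def)
    also have "\<dots> = {e' \<in> gg.XA. x_key T e' = k}"
      using sameH[OF H e(1)] KX_arcs[OF H] e(2) by auto
    finally show ?thesis by (simp add: x_group_def gg.XA_def)
  qed
  have keys_union: "x_keys T = (\<Union>H\<in>KX. x_keys (?T H))"
  proof (intro Set.set_eqI iffI)
    fix k assume "k \<in> x_keys T"
    then obtain e where e: "e \<in> gg.XA" "k = x_key T e" by (auto simp: gg.XA_def)
    then have "e \<in> arcs (cg.hc e)" "cg.hc e \<in> KX" using cg.cl(1)[of e] by (auto simp: KX_def cg.A_def gg.XA_def)
    then show "k \<in> (\<Union>H\<in>KX. x_keys (?T H))" using keysH e(2) by blast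
  next
    fix k assume "k \<in> (\<Union>H\<in>KX. x_keys (?T H))"
    then obtain H where "H \<in> KX" "k \<in> x_key T ` arcs H" using keysH by blast
    then show "k \<in> x_keys T" using KX_arcs[of H] by (auto simp: gg.XA_def)
  qed
  have keys_disj: "x_keys (?T H) \<inter> x_keys (?T H') = {}" if H: "H \<in> KX" "H' \<in> KX" "H \<noteq> H'" for H H'
  proof (rule ccontr)
    assume "x_keys (?T H) \<inter> x_keys (?T H') \<noteq> {}"
    then obtain e e' where e: "e \<in> arcs H" "e' \<in> arcs H'" "x_key T e = x_key T e'"
      unfolding keysH[OF H(1)] keysH[OF H(2)] by blast
    then have e'H: "e' \<in> arcs H" using sameH[OF H(1) e(1) _ e(3)] KX_arcs[OF H(2)] by blast
    have "cg.hc e' = H''" if "H'' \<in> KX" "e' \<in> arcs H''" for H''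
      using that cg.hc_arc[of _ e'] by (auto simp: KX_def gg.XA_def)
    then show False using H e(2) e'H by metis
  qed
  have fin_keys: "finite (x_keys (?T H))" if "H \<in> KX" for H
  proof -
    have "finite (arcs H)" by (rule finite_subset[OF KX_arcs[OF that] gg.finite_XA])
    then show ?thesis using keysH[OF that] by simp
  qed
  have g: "card (x_keys T) = (\<Sum>H\<in>KX. card (x_keys (?T H)))"
    unfolding keys_union using finK(1) fin_keys keys_disj by (intro card_UN_disjoint) auto
  have gH: "int (card (verts H)) - 1 \<le> int (card (x_keys (?T H)))" if H: "H \<in> KX" for H
  proof -
    have HK: "H \<in> cg.K" using H K by blast
    interpret H: fin_digraph H using tgH[OF HK] by (simp add: test_graph_in_def)
    have "keyed_graph H {} (x_key T)"
    proof
      show "Digraph_Component.connected H" using tgH[OF HK] by (simp add: test_graph_in_def)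
      fix e e' assume "e \<in> arcs H - {}" "e' \<in> arcs H - {}" "x_key T e = x_key T e'"
      then show "{tail H e, head H e} = {tail H e', head H e'}"
        using gg.same_ends[of e e'] KX_arcs[OF H] H_simps[OF HK] by auto
    qed simp
    from keyed_card_verts_le[OF this] show ?thesis unfolding keysH[OF H] by linarith
  qed
  have sumK: "(\<Sum>H\<in>cg.K. int (card (verts H)) - 1) =
      (\<Sum>H\<in>KX. int (card (verts H)) - 1) + (\<Sum>H\<in>cg.KF p. int (card (verts H)) - 1)"
    unfolding K by (rule sum.union_disjoint[OF finK disj])
  have sumY: "(\<Sum>H\<in>cg.KF p. int (card (verts H)) - 1) = int (card (verts ?G)) - int (card (gcomps ?G ?YA))"
    using cg.sum_KF[of p] by (simp only: YA)
  have sumX: "(\<Sum>H\<in>KX. int (card (verts H)) - 1) \<le> (\<Sum>H\<in>KX. int (card (x_keys (?T H))))"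
    by (rule sum_mono) (rule gH)
  have gint: "int (card (x_keys T)) = (\<Sum>H\<in>KX. int (card (x_keys (?T H))))" unfolding g by simp
  have tree_iff: "is_tree T \<longleftrightarrow> int (card (gcomps ?G ?YA)) = int (card (x_keys T)) + 1"
    unfolding is_tree_def by linarith
  show ?thesis
  proof (cases "is_tree T")
    case True
    have n: "int (card (gcomps ?G ?YA)) = int (card (x_keys T)) + 1" using True tree_iff by blast
    have eqX: "(\<Sum>H\<in>KX. int (card (verts H)) - 1) = (\<Sum>H\<in>KX. int (card (x_keys (?T H))))"
      using n sumK sumY sumX gint cg.reduced_tree_iff(2) by linarith
    have free: "free_product (joint_fam p) T"
      unfolding free_iff using n sumK sumY eqX gint by linarith
    have NB: "gg.NB = {}"
      using gg.NB_empty_iff True unfolding is_tree_def gg.XA_def by blast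
    have X: "lim (mean_inj_traffic M (case_sum X Y) (?T H)) =
        (\<Prod>k\<in>x_keys (?T H). of_real (a (fst k) (card (x_group T k) div 2)))" if H: "H \<in> KX" for H
    proof -
      have HK: "H \<in> cg.K" using H K by blast
      interpret H: fin_digraph H using tgH[OF HK] by (simp add: test_graph_in_def)
      have cyc: "cyclic_in (joint_vars p q) (?T H)"
        unfolding cyclic_in_iff using tgH[OF HK] gg.group_union_balanced[OF NB KX_arcs[OF H] sameH[OF H]]
        by (simp add: H_simps[OF HK])
      have "int (card (verts H)) - 1 = int (card (x_keys (?T H)))"
        using sum_mono_inv[OF eqX gH H finK(1)] .
      then have "card (verts H) = card (x_keys (?T H)) + 1" by linarith
      then have tree: "is_tree (?T H)"
        unfolding is_tree_def by (simp add: yH[OF H] comps_empty card_image)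
      have "lim (mean_inj_traffic M (case_sum X Y) (?T H)) = limit (?T H)"
        using mean_inj_traffic_limit[OF cyc] by (rule limI)
      also have "\<dots> = (\<Prod>k\<in>x_keys (?T H). of_real (a (fst k) (card (x_group (?T H) k) div 2))) *
          (\<Prod>C\<in>gcomps H {}. lim (mean_inj_traffic M Y (comp_test H {} (y_lbl (?T H)) C)))"
        unfolding limit_def if_P[OF tree] by (simp add: yH[OF H])
      also have "(\<Prod>C\<in>gcomps H {}. lim (mean_inj_traffic M Y (comp_test H {} (y_lbl (?T H)) C))) = 1"
      proof (rule prod.neutral, rule ballI)
        fix C assume "C \<in> gcomps H {}"
        then obtain v where "C = {v}" unfolding comps_empty by blast
        then have "mean_inj_traffic M Y (comp_test H {} (y_lbl (?T H)) C) \<longlonglongrightarrow> 1"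
          by (intro mean_inj_traffic_vertex[OF prob, where v = v]) (simp_all add: comp_test_def)
        then show "lim (mean_inj_traffic M Y (comp_test H {} (y_lbl (?T H)) C)) = 1" by (rule limI)
      qed
      finally show ?thesis using groupH[OF H] by simp
    qed
    \<comment> \<open>For a \<open>Y\<close> component only the names of the variables change,
      \<open>Inr l\<close> becoming \<open>l\<close>.\<close>
    have Y: "lim (mean_inj_traffic M (case_sum X Y) (?T H)) =
        lim (mean_inj_traffic M Y (comp_test ?G ?YA (y_lbl T) (verts H)))" if H: "H \<in> cg.KF p" for H
    proof -
      obtain e where e: "e \<in> ?YA" "H = cg.hc e" using H by (auto simp: cg.KF_def YA)
      have Hc: "H = comp_graph ?G ?YA (verts H)"
        using e colY[OF e(1)] by (simp add: cg.hc_def YA)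
      have "letter_mat (\<lambda>y. case_sum X Y y N \<omega>) (lbl T e') = letter_mat (\<lambda>y. Y y N \<omega>) (y_lbl T e')"
        if e': "e' \<in> ?YA" for e' N \<omega>
      proof -
        have "fst (lbl T e') = Inr (fst (y_lbl T e'))"
          using joint_var_cases(1)[OF tg, of e'] e' gg.YA by auto
        then obtain l b where "lbl T e' = (Inr l, b)" by (metis prod.collapse)
        then show ?thesis by (simp add: y_lbl_def)
      qed
      then have "inj_traffic N (\<lambda>y. case_sum X Y y N \<omega>) (?T H) =
          inj_traffic N (\<lambda>y. Y y N \<omega>) (comp_test ?G ?YA (y_lbl T) (verts H))" for N \<omega>
        unfolding inj_traffic_def edge_weight_def comp_test_def
        by (subst (1 2 3 4 5 6) Hc) (auto intro!: sum.cong prod.cong arg_cong2[where f = "(*)"])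
      then have "mean_inj_traffic M (case_sum X Y) (?T H) =
          mean_inj_traffic M Y (comp_test ?G ?YA (y_lbl T) (verts H))"
        by (intro ext) (simp add: mean_inj_traffic_def)
      then show ?thesis by simp
    qed
    have "(\<Prod>H\<in>cg.K. lim (mean_inj_traffic M (case_sum X Y) (?T H))) =
        (\<Prod>H\<in>KX. lim (mean_inj_traffic M (case_sum X Y) (?T H))) *
        (\<Prod>H\<in>cg.KF p. lim (mean_inj_traffic M (case_sum X Y) (?T H)))"
      unfolding K by (rule prod.union_disjoint[OF finK disj])
    also have "(\<Prod>H\<in>KX. lim (mean_inj_traffic M (case_sum X Y) (?T H))) =
        (\<Prod>H\<in>KX. \<Prod>k\<in>x_keys (?T H). of_real (a (fst k) (card (x_group T k) div 2)))"
      by (rule prod.cong[OF refl X])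
    also have "\<dots> = (\<Prod>k\<in>x_keys T. of_real (a (fst k) (card (x_group T k) div 2)))"
      unfolding keys_union using finK(1) fin_keys keys_disj by (intro prod.UNION_disjoint[symmetric]) auto
    also have "(\<Prod>H\<in>cg.KF p. lim (mean_inj_traffic M (case_sum X Y) (?T H))) =
        (\<Prod>H\<in>cg.KF p. lim (mean_inj_traffic M Y (comp_test ?G ?YA (y_lbl T) (verts H))))"
      by (rule prod.cong[OF refl Y])
    also have "\<dots> = (\<Prod>C\<in>verts ` cg.KF p. lim (mean_inj_traffic M Y (comp_test ?G ?YA (y_lbl T) C)))"
      using prod.reindex[OF cg.verts_KF[of p], of "\<lambda>C. lim (mean_inj_traffic M Y (comp_test ?G ?YA (y_lbl T) C))"]
      by (simp add: comp_def)
    \<comment> \<open>The remaining components of the \<open>Y\<close> arcs are isolated vertices,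
      which contribute the factor 1.\<close>
    also have "\<dots> = (\<Prod>C\<in>gcomps ?G ?YA. lim (mean_inj_traffic M Y (comp_test ?G ?YA (y_lbl T) C)))"
    proof (rule prod.mono_neutral_left)
      show "finite (gcomps ?G ?YA)" by simp
      show "verts ` cg.KF p \<subseteq> gcomps ?G ?YA" using cg.gcomps_KF(1)[of p] by (simp only: YA)
      show "\<forall>C\<in>gcomps ?G ?YA - verts ` cg.KF p. lim (mean_inj_traffic M Y (comp_test ?G ?YA (y_lbl T) C)) = 1"
      proof
        fix C assume "C \<in> gcomps ?G ?YA - verts ` cg.KF p"
        then obtain v where v: "C = {v}" "{e \<in> ?YA. tail ?G e \<in> C} = {}"
          using cg.gcomps_KF(2)[of C p] by (auto simp only: YA)
        have "mean_inj_traffic M Y (comp_test ?G ?YA (y_lbl T) C) \<longlonglongrightarrow> 1"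
          using v by (intro mean_inj_traffic_vertex[OF prob, where v = v]) (simp_all add: comp_test_def)
        then show "lim (mean_inj_traffic M Y (comp_test ?G ?YA (y_lbl T) C)) = 1" by (rule limI)
      qed
    qed
    finally show ?thesis
      unfolding if_P[OF free] K_eq limit_def if_P[OF True] by simp
  next
    case False
    \<comment> \<open>If the product is free but the tree equality fails for \<open>T\<close>, it
      fails for some heavy Wigner component, and the factor of that component tends to 0.\<close>
    have "(\<Prod>H\<in>cg.K. lim (mean_inj_traffic M (case_sum X Y) (?T H))) = 0" if "free_product (joint_fam p) T"
    proof -
      have "(\<Sum>H\<in>KX. int (card (verts H)) - 1) \<noteq> (\<Sum>H\<in>KX. int (card (x_keys (?T H))))"
        using that False sumK sumY gint unfolding free_iff tree_iff by linarith
      then obtain H where H: "H \<in> KX" "int (card (verts H)) - 1 \<noteq> int (card (x_keys (?T H)))"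
        by (meson sum.cong)
      then have "card (verts H) \<le> card (x_keys (?T H))" using gH[OF H(1)] by linarith
      then have "mean_inj_traffic M (case_sum X Y) (?T H) \<longlonglongrightarrow> 0"
        using H(1) K by (intro mean_inj_traffic_overfull tgH yH) auto
      then have "lim (mean_inj_traffic M (case_sum X Y) (?T H)) = 0" by (rule limI)
      then show ?thesis using H(1) K cg.finite_K by (auto intro: prod_zero)
    qed
    then show ?thesis unfolding K_eq limit_def if_not_P[OF False] by simp
  qed
qed

theorem traffic_free: "asymp_traffic_free M (case_sum X Y) (joint_vars p q) (joint_fam p)"
  unfolding asymp_traffic_free_def
proof (intro allI impI)
  fix T assume T: "cyclic_in (joint_vars p q) T"
  have lim: "lim (mean_inj_traffic M (case_sum X Y) T) = limit T"
    using mean_inj_traffic_limit[OF T] by (rule limI)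
  have "limit T = (if free_product (joint_fam p) T
    then \<Prod>H\<in>family_comps (joint_fam p) T. lim (mean_inj_traffic M (case_sum X Y) (T\<lparr>shape := H\<rparr>)) else 0)"
  proof (cases "arcs (shape T) = {}")
    case True
    then show ?thesis
      using limit_arcless[OF T True] by (simp add: family_comps_arcless free_product_def)
  next
    case False
    then show ?thesis by (rule limit_family_comps[OF T])
  qed
  then show "convergent (mean_inj_traffic M (case_sum X Y) T) \<and>
    lim (mean_inj_traffic M (case_sum X Y) T) = (if free_product (joint_fam p) T
      then \<Prod>H\<in>family_comps (joint_fam p) T. lim (mean_inj_traffic M (case_sum X Y) (T\<lparr>shape := H\<rparr>)) else 0)"
    using mean_inj_traffic_limit[OF T] lim by (auto simp: convergent_def)
qed

end

section \<open>Traces as traffics of cycles\<close>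

definition quot_test :: "'y test_graph \<Rightarrow> (nat \<Rightarrow> nat) \<Rightarrow> 'y test_graph" where
  "quot_test T r = \<lparr>shape = quot (shape T) r, lbl = lbl T\<rparr>"

lemma quot_test_simps [simp]: "shape (quot_test T r) = quot (shape T) r" "lbl (quot_test T r) = lbl T"
  by (simp_all add: quot_test_def)

lemma cyclic_in_quot_test:
  assumes "cyclic_in V T"
  shows "cyclic_in V (quot_test T r)"
proof -
  have fin: "fin_digraph (shape T)" and con: "Digraph_Component.connected (shape T)"
    and lbl: "\<And>e. e \<in> arcs (shape T) \<Longrightarrow> fst (lbl T e) \<in> V"
    and bal: "\<And>v. v \<in> verts (shape T) \<Longrightarrow> balanced_at (tail (shape T)) (head (shape T)) (arcs (shape T)) v"
    using assms by (auto simp: cyclic_in_iff test_graph_in_def)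
  have "balanced_at (tail (quot (shape T) r)) (head (quot (shape T) r)) (arcs (quot (shape T) r)) v" for v
    by (rule balanced_quot[OF fin bal])
  then show ?thesis
    using fin_digraph_quot[OF fin] connected_quot[OF fin con] lbl by (simp add: cyclic_in_iff test_graph_in_def)
qed

lemma traffic_by_kernel:
  assumes "fin_digraph (shape T)"
  shows "traffic N A T = (\<Sum>r\<in>canon (verts (shape T)). inj_traffic N A (quot_test T r))"
proof -
  interpret fin_digraph "shape T" by fact
  have "tail (shape T) ` arcs (shape T) \<union> head (shape T) ` arcs (shape T) \<subseteq> verts (shape T)" by auto
  from isum_by_kernel[OF finite_verts this, where P = "\<lambda>_. True" and w = "ew A (lbl T)"]
  have "(\<Sum>\<phi>\<in>verts (shape T) \<rightarrow>\<^sub>E {..<N}. edge_weight A T \<phi>) =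
      (\<Sum>r\<in>canon (verts (shape T)). isum N (r ` verts (shape T)) (r \<circ> tail (shape T))
        (r \<circ> head (shape T)) (arcs (shape T)) (ew A (lbl T)))"
    by (simp add: edge_weight_def ew_def)
  then show ?thesis by (simp add: traffic_def inj_traffic_isum sum_distrib_left)
qed

lemma integrable_inj_traffic:
  assumes "prob_space (M N)" "N > 0" "test_graph_in V T" "\<And>y. y \<in> V \<Longrightarrow> random_matrix M (A y)"
  shows "integrable (M N) (\<lambda>\<omega>. inj_traffic N (\<lambda>y. A y N \<omega>) T)"
proof -
  interpret fin_digraph "shape T" using assms(3) by (simp add: test_graph_in_def)
  show ?thesis
    unfolding inj_traffic_isum
    using assms by (intro integrable_mult_right has_moments_integrable has_moments_isum)
      (auto simp: test_graph_in_def)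
qed

lemma
  assumes "prob_space (M N)" "N > 0" "cyclic_in V T" "\<And>y. y \<in> V \<Longrightarrow> random_matrix M (A y)"
  shows integrable_traffic: "integrable (M N) (\<lambda>\<omega>. traffic N (\<lambda>y. A y N \<omega>) T)"
    and mean_traffic_by_kernel: "mean_traffic M A T N =
      (\<Sum>r\<in>canon (verts (shape T)). mean_inj_traffic M A (quot_test T r) N)"
proof -
  have fin: "fin_digraph (shape T)" using assms(3) by (simp add: cyclic_in_iff test_graph_in_def)
  have int: "integrable (M N) (\<lambda>\<omega>. inj_traffic N (\<lambda>y. A y N \<omega>) (quot_test T r))" for r
  proof (rule integrable_inj_traffic[where V = V and A = A])
    show "test_graph_in V (quot_test T r)" using cyclic_in_quot_test[OF assms(3)] by (simp add: cyclic_in_iff)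
  qed (use assms in auto)
  show "integrable (M N) (\<lambda>\<omega>. traffic N (\<lambda>y. A y N \<omega>) T)"
    unfolding traffic_by_kernel[OF fin] by (intro Bochner_Integration.integrable_sum int)
  show "mean_traffic M A T N = (\<Sum>r\<in>canon (verts (shape T)). mean_inj_traffic M A (quot_test T r) N)"
    unfolding mean_traffic_def mean_inj_traffic_def traffic_by_kernel[OF fin]
    by (intro Bochner_Integration.integral_sum int)
qed

lemma mean_traffic_limit:
  assumes "\<And>N. N > 0 \<Longrightarrow> prob_space (M N)" "cyclic_in V T" "\<And>y. y \<in> V \<Longrightarrow> random_matrix M (A y)"
    and "\<And>T. cyclic_in V T \<Longrightarrow> mean_inj_traffic M A T \<longlonglongrightarrow> f T"
  shows "mean_traffic M A T \<longlonglongrightarrow> (\<Sum>r\<in>canon (verts (shape T)). f (quot_test T r))"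
proof -
  have "(\<lambda>N. \<Sum>r\<in>canon (verts (shape T)). mean_inj_traffic M A (quot_test T r) N) \<longlonglongrightarrow>
      (\<Sum>r\<in>canon (verts (shape T)). f (quot_test T r))"
    by (intro tendsto_sum assms(4) cyclic_in_quot_test assms(2))
  moreover have "eventually (\<lambda>N. (\<Sum>r\<in>canon (verts (shape T)). mean_inj_traffic M A (quot_test T r) N) =
      mean_traffic M A T N) at_top"
    using eventually_gt_at_top[of 0]
  proof eventually_elim
    case (elim N)
    show ?case
      by (rule mean_traffic_by_kernel[where V = V and A = A, symmetric]) (assumption | rule assms elim)+
  qed
  ultimately show ?thesis by (rule Lim_transform_eventually)
qed

section \<open>Words as cycles\<close>

definition cycle_test :: "'y letter list \<Rightarrow> 'y test_graph" where
  "cycle_test w = \<lparr>shape = \<lparr>verts = {..<length w}, arcs = {..<length w}, tail = (\<lambda>e. e),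
     head = (\<lambda>e. if Suc e < length w then Suc e else 0)\<rparr>, lbl = (\<lambda>e. w ! e)\<rparr>"

lemma cycle_test_cyclic:
  assumes "w \<noteq> []" "fst ` set w \<subseteq> V"
  shows "cyclic_in V (cycle_test w)"
proof -
  let ?G = "shape (cycle_test w)"
  have G: "verts ?G = {..<length w}" "arcs ?G = {..<length w}" "tail ?G = (\<lambda>e. e)"
    "head ?G = (\<lambda>e. if Suc e < length w then Suc e else 0)" "lbl (cycle_test w) = (\<lambda>e. w ! e)"
    by (simp_all add: cycle_test_def)
  have len: "length w > 0" using assms(1) by simp
  interpret fin_digraph ?G using len by unfold_locales (auto simp: G)
  have root: "(0, v) \<in> gconn ?G (arcs ?G)" if "v < length w" for v
    using that
  proof (induction v)
    case (Suc v)
    have "(tail ?G v, head ?G v) \<in> gconn ?G (arcs ?G)" by (rule conn_arc) (use Suc.prems in \<open>simp add: G\<close>)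
    then have "(v, Suc v) \<in> gconn ?G (arcs ?G)" using Suc.prems by (simp add: G)
    then show ?case using Suc conn_trans[of 0 v "tail ?G" "head ?G" "arcs ?G" "Suc v"] by simp
  qed simp
  have "(u, v) \<in> gconn ?G (arcs ?G)" if "u < length w" "v < length w" for u v
    by (rule conn_trans[OF conn_sym]) (rule root[OF that(1)], rule root[OF that(2)])
  then have con: "Digraph_Component.connected ?G"
    unfolding connected_iff_conn[OF wf_digraph_axioms] using len by (auto simp: G(1))
  have "balanced_at (tail ?G) (head ?G) (arcs ?G) v" if v: "v < length w" for v
  proof -
    have "{e \<in> arcs ?G. tail ?G e = v} = {v}" using v by (auto simp: G)
    moreover have "{e \<in> arcs ?G. head ?G e = v} = {if v = 0 then length w - 1 else v - 1}"
      using v len by (auto simp: G)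
    ultimately show ?thesis by (simp add: balanced_at_def)
  qed
  moreover have "fst (w ! e) \<in> V" if "e < length w" for e
    using assms(2) nth_mem[OF that] by blast
  ultimately show ?thesis
    using con fin_digraph_axioms by (simp add: cyclic_in_iff test_graph_in_def G)
qed

lemma letter_mat_carrier: "A (fst l) \<in> carrier_mat N N \<Longrightarrow> letter_mat A l \<in> carrier_mat N N"
  by (cases l) (auto simp: mat_adjoint_def mat_of_rows_def)

lemma word_mat_carrier:
  "(\<And>l. l \<in> set w \<Longrightarrow> A (fst l) \<in> carrier_mat N N) \<Longrightarrow> word_mat N A w \<in> carrier_mat N N"
  unfolding word_mat_def by (induction w) (auto intro: mult_carrier_mat letter_mat_carrier)

lemma word_mat_snoc:
  assumes "\<And>k. k \<in> set (w @ [l]) \<Longrightarrow> A (fst k) \<in> carrier_mat N N"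
  shows "word_mat N A (w @ [l]) = word_mat N A w * letter_mat A l"
  using assms
proof (induction w)
  case Nil
  then have "letter_mat A l \<in> carrier_mat N N" by (intro letter_mat_carrier) simp
  then show ?case by (simp add: word_mat_def)
next
  case (Cons k w)
  have c: "letter_mat A k \<in> carrier_mat N N" "word_mat N A w \<in> carrier_mat N N" "letter_mat A l \<in> carrier_mat N N"
    by (intro letter_mat_carrier word_mat_carrier Cons.prems; simp)+
  have "word_mat N A ((k # w) @ [l]) = letter_mat A k * word_mat N A (w @ [l])" by (simp add: word_mat_def)
  also have "\<dots> = letter_mat A k * (word_mat N A w * letter_mat A l)" using Cons by simp
  also have "\<dots> = (letter_mat A k * word_mat N A w) * letter_mat A l" using c by (simp add: assoc_mult_mat)
  finally show ?case by (simp add: word_mat_def)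
qed

text \<open>\<open>\<phi> e\<close> is the row index at letter \<open>e\<close>, hence also the
  column index of the letter before it. The last column index is the free \<open>j\<close>; the
  trace closes the path by taking \<open>j = \<phi> 0\<close>.\<close>

lemma word_mat_entry:
  assumes "w \<noteq> []" "\<And>l. l \<in> set w \<Longrightarrow> A (fst l) \<in> carrier_mat N N" "i < N" "j < N"
  shows "word_mat N A w $$ (i, j) =
    (\<Sum>\<phi> | \<phi> \<in> {..<length w} \<rightarrow>\<^sub>E {..<N} \<and> \<phi> 0 = i.
      \<Prod>e<length w. letter_mat A (w ! e) $$ (\<phi> e, if Suc e < length w then \<phi> (Suc e) else j))"
  using assms
proof (induction w arbitrary: j rule: rev_induct)
  case (snoc l w)
  let ?n = "length w"
  have c: "letter_mat A l \<in> carrier_mat N N" "word_mat N A w \<in> carrier_mat N N"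
    by (intro letter_mat_carrier word_mat_carrier snoc.prems(2); simp)+
  have eq: "word_mat N A (w @ [l]) = word_mat N A w * letter_mat A l"
    by (rule word_mat_snoc) (rule snoc.prems(2))
  show ?case
  proof (cases "w = []")
    case True
    have "{\<phi>. \<phi> \<in> {..<Suc 0} \<rightarrow>\<^sub>E {..<N} \<and> \<phi> 0 = i} = {\<lambda>x. if x = 0 then i else undefined}"
      using snoc.prems(3) by (auto simp: PiE_def extensional_def fun_eq_iff)
    then show ?thesis using True c snoc.prems(3,4) by (simp add: word_mat_def)
  next
    case False
    let ?S = "{\<phi>. \<phi> \<in> {..<?n} \<rightarrow>\<^sub>E {..<N} \<and> \<phi> 0 = i}"
    let ?S' = "{\<phi>. \<phi> \<in> {..<Suc ?n} \<rightarrow>\<^sub>E {..<N} \<and> \<phi> 0 = i}"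
    let ?f = "\<lambda>\<phi> k. \<Prod>e<?n. letter_mat A (w ! e) $$ (\<phi> e, if Suc e < ?n then \<phi> (Suc e) else k)"
    have n0: "?n > 0" using False by simp
    have fin: "finite ?S" by (rule finite_subset[of _ "{..<?n} \<rightarrow>\<^sub>E {..<N}"]) (auto intro: finite_PiE)
    have "word_mat N A (w @ [l]) $$ (i, j) = (\<Sum>k<N. word_mat N A w $$ (i, k) * letter_mat A l $$ (k, j))"
      using c snoc.prems(3,4) by (simp add: eq times_mat_def scalar_prod_def lessThan_atLeast0)
    also have "\<dots> = (\<Sum>k<N. \<Sum>\<phi>\<in>?S. ?f \<phi> k * letter_mat A l $$ (k, j))"
      using snoc False by (intro sum.cong refl) (simp add: sum_distrib_right)
    also have "\<dots> = (\<Sum>(\<phi>, k)\<in>?S \<times> {..<N}. ?f \<phi> k * letter_mat A l $$ (k, j))"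
      using fin by (subst sum.swap) (simp add: sum.cartesian_product)
    also have "\<dots> = (\<Sum>\<psi>\<in>?S'. \<Prod>e<Suc ?n. letter_mat A ((w @ [l]) ! e) $$ (\<psi> e, if Suc e < Suc ?n then \<psi> (Suc e) else j))"
    proof (rule sum.reindex_bij_witness[where i = "\<lambda>\<psi>. (restrict \<psi> {..<?n}, \<psi> ?n)" and j = "\<lambda>(\<phi>, k). \<phi>(?n := k)"])
      fix x assume "x \<in> ?S \<times> {..<N}"
      then obtain \<phi> k where x: "x = (\<phi>, k)" "\<phi> \<in> {..<?n} \<rightarrow>\<^sub>E {..<N}" "\<phi> 0 = i" "k < N" by auto
      have "restrict (\<phi>(?n := k)) {..<?n} = \<phi>"
        using x(2) by (intro ext) (auto simp: PiE_def extensional_def)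
      then show "(\<lambda>\<psi>. (restrict \<psi> {..<?n}, \<psi> ?n)) ((\<lambda>(\<phi>, k). \<phi>(?n := k)) x) = x" using x by simp
      show "(\<lambda>(\<phi>, k). \<phi>(?n := k)) x \<in> ?S'"
        using x n0 by (auto simp: PiE_def extensional_def less_Suc_eq)
      let ?\<psi> = "\<phi>(?n := k)"
      have a: "(\<Prod>e<?n. letter_mat A ((w @ [l]) ! e) $$ (?\<psi> e, if Suc e < Suc ?n then ?\<psi> (Suc e) else j)) = ?f \<phi> k"
        by (intro prod.cong refl) (auto simp: nth_append)
      have b: "letter_mat A ((w @ [l]) ! ?n) $$ (?\<psi> ?n, if Suc ?n < Suc ?n then ?\<psi> (Suc ?n) else j) =
          letter_mat A l $$ (k, j)" by simp
      show "(\<Prod>e<Suc ?n. letter_mat A ((w @ [l]) ! e) $$ (((\<lambda>(\<phi>, k). \<phi>(?n := k)) x) e,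
          if Suc e < Suc ?n then ((\<lambda>(\<phi>, k). \<phi>(?n := k)) x) (Suc e) else j)) =
          (case x of (\<phi>, k) \<Rightarrow> ?f \<phi> k * letter_mat A l $$ (k, j))"
        by (simp only: x(1) prod.case prod.lessThan_Suc a b)
    next
      fix \<psi> assume \<psi>: "\<psi> \<in> ?S'"
      show "(\<lambda>(\<phi>, k). \<phi>(?n := k)) (restrict \<psi> {..<?n}, \<psi> ?n) = \<psi>"
        using \<psi> by (intro ext) (auto simp: PiE_def extensional_def less_Suc_eq)
      show "(restrict \<psi> {..<?n}, \<psi> ?n) \<in> ?S \<times> {..<N}"
      proof (intro SigmaI CollectI conjI)
        have lt: "\<psi> e < N" if "e < Suc ?n" for e using PiE_mem[of \<psi> "{..<Suc ?n}" "\<lambda>_. {..<N}" e] \<psi> that by simp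
        show "restrict \<psi> {..<?n} \<in> {..<?n} \<rightarrow>\<^sub>E {..<N}"
          by (intro restrict_PiE_iff[THEN iffD2]) (simp add: lt)
        show "\<psi> ?n \<in> {..<N}" by (simp add: lt)
        show "restrict \<psi> {..<?n} 0 = i" using \<psi> n0 by simp
      qed
    qed
    finally show ?thesis by simp
  qed
qed simp

lemma trace_word:
  assumes "w \<noteq> []" "\<And>l. l \<in> set w \<Longrightarrow> A (fst l) \<in> carrier_mat N N"
  shows "1 / of_nat N * (\<Sum>i<N. word_mat N A w $$ (i, i)) = traffic N A (cycle_test w)"
proof -
  let ?n = "length w"
  let ?P = "{..<?n} \<rightarrow>\<^sub>E {..<N}"
  let ?f = "\<lambda>\<phi>. \<Prod>e<?n. letter_mat A (w ! e) $$ (\<phi> e, if Suc e < ?n then \<phi> (Suc e) else \<phi> 0)"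
  have n0: "?n > 0" using assms(1) by simp
  have fin: "finite ?P" by (auto intro: finite_PiE)
  have "(\<Sum>i<N. word_mat N A w $$ (i, i)) = (\<Sum>i<N. \<Sum>\<phi> | \<phi> \<in> ?P \<and> \<phi> 0 = i. ?f \<phi>)"
  proof (rule sum.cong[OF refl])
    fix i assume "i \<in> {..<N}"
    then have "word_mat N A w $$ (i, i) = (\<Sum>\<phi> | \<phi> \<in> ?P \<and> \<phi> 0 = i.
        \<Prod>e<?n. letter_mat A (w ! e) $$ (\<phi> e, if Suc e < ?n then \<phi> (Suc e) else i))"
      by (intro word_mat_entry assms) simp_all
    also have "\<dots> = (\<Sum>\<phi> | \<phi> \<in> ?P \<and> \<phi> 0 = i. ?f \<phi>)"
      by (rule sum.cong) auto
    finally show "word_mat N A w $$ (i, i) = (\<Sum>\<phi> | \<phi> \<in> ?P \<and> \<phi> 0 = i. ?f \<phi>)" .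
  qed
  also have "\<dots> = (\<Sum>\<phi>\<in>?P. ?f \<phi>)"
    using fin n0 by (intro sum.group[of ?P "{..<N}" "\<lambda>\<phi>. \<phi> 0"]) auto
  finally show ?thesis
    by (simp add: traffic_def edge_weight_def cycle_test_def if_distrib cong: if_cong)
qed

section \<open>Limits of the mean traces\<close>

context heavy_wigner_joint
begin

lemma rm_joint: "y \<in> joint_vars p q \<Longrightarrow> random_matrix M (case_sum X Y y)"
  using rmX rmY by (auto simp: joint_vars_def)

text \<open>The empty word is set apart: its normalized trace is that of the identity matrix, while
  its cycle would have no vertex and so not be connected.\<close>

definition word_limit :: "(nat + nat) letter list \<Rightarrow> complex" where
  "word_limit w = (if w = [] then 1
    else \<Sum>r\<in>canon (verts (shape (cycle_test w))). limit (quot_test (cycle_test w) r))"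

definition poly_limit :: "(nat + nat) star_poly \<Rightarrow> complex" where
  "poly_limit P = (\<Sum>w\<in>Poly_Mapping.keys P. Poly_Mapping.lookup P w * word_limit w)"

lemma mean_trace_limit:
  assumes P: "star_poly_in (joint_vars p q) P"
  shows "mean_trace M (case_sum X Y) P \<longlonglongrightarrow> poly_limit P"
proof -
  let ?tr = "\<lambda>w N. if w = [] then 1 else mean_traffic M (case_sum X Y) (cycle_test w) N"
  have w: "fst ` set w \<subseteq> joint_vars p q" if "w \<in> Poly_Mapping.keys P" for w
    using P that by (auto simp: star_poly_in_def)
  have cyc: "cyclic_in (joint_vars p q) (cycle_test w)" if "w \<in> Poly_Mapping.keys P" "w \<noteq> []" for w
    using cycle_test_cyclic[OF that(2) w[OF that(1)]] .
  have "?tr w \<longlonglongrightarrow> word_limit w" if "w \<in> Poly_Mapping.keys P" for w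
  proof (cases "w = []")
    case False
    then show ?thesis
      unfolding word_limit_def
      using mean_traffic_limit[OF prob cyc[OF that False] rm_joint mean_inj_traffic_limit] by simp
  qed (simp add: word_limit_def)
  then have "(\<lambda>N. \<Sum>w\<in>Poly_Mapping.keys P. Poly_Mapping.lookup P w * ?tr w N) \<longlonglongrightarrow> poly_limit P"
    unfolding poly_limit_def by (intro tendsto_sum tendsto_mult tendsto_const)
  moreover have "eventually (\<lambda>N. (\<Sum>w\<in>Poly_Mapping.keys P. Poly_Mapping.lookup P w * ?tr w N) =
      mean_trace M (case_sum X Y) P N) at_top"
    using eventually_gt_at_top[of 0]
  proof eventually_elim
    case (elim N)
    interpret prob_space "M N" using prob elim by simp
    let ?Z = "\<lambda>\<omega> y. case_sum X Y y N \<omega>"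
    let ?t = "\<lambda>w \<omega>. if w = [] then 1 else traffic N (?Z \<omega>) (cycle_test w)"
    have tr: "1 / of_nat N * Tr (star_poly_mat N (?Z \<omega>) P) =
        (\<Sum>w\<in>Poly_Mapping.keys P. Poly_Mapping.lookup P w * ?t w \<omega>)" if \<omega>: "\<omega> \<in> space (M N)" for \<omega>
    proof -
      have "Tr (star_poly_mat N (?Z \<omega>) P) =
          (\<Sum>w\<in>Poly_Mapping.keys P. Poly_Mapping.lookup P w * (\<Sum>i<N. word_mat N (?Z \<omega>) w $$ (i, i)))"
        unfolding Tr_def star_poly_mat_def by (simp add: sum_distrib_left) (rule sum.swap)
      then have "1 / of_nat N * Tr (star_poly_mat N (?Z \<omega>) P) =
          (\<Sum>w\<in>Poly_Mapping.keys P. Poly_Mapping.lookup P w * (1 / of_nat N * (\<Sum>i<N. word_mat N (?Z \<omega>) w $$ (i, i))))"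
        by (simp add: sum_distrib_left mult.left_commute)
      also have "\<dots> = (\<Sum>w\<in>Poly_Mapping.keys P. Poly_Mapping.lookup P w * ?t w \<omega>)"
      proof (intro sum.cong refl arg_cong2[where f = "(*)"])
        fix u assume u: "u \<in> Poly_Mapping.keys P"
        have "?Z \<omega> (fst l) \<in> carrier_mat N N" if "l \<in> set u" for l
        proof -
          have "fst l \<in> joint_vars p q" using w[OF u] that by auto
          then show ?thesis using rm_joint \<omega> elim by (auto simp: random_matrix_def)
        qed
        then show "1 / of_nat N * (\<Sum>i<N. word_mat N (?Z \<omega>) u $$ (i, i)) = ?t u \<omega>"
          using trace_word[of u "?Z \<omega>" N] elim by (simp add: word_mat_def)
      qed
      finally show ?thesis .
    qed
    have "mean_trace M (case_sum X Y) P N =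
        (\<integral>\<omega>. (\<Sum>w\<in>Poly_Mapping.keys P. Poly_Mapping.lookup P w * ?t w \<omega>) \<partial>M N)"
      unfolding mean_trace_def by (rule Bochner_Integration.integral_cong[OF refl tr])
    also have "\<dots> = (\<Sum>w\<in>Poly_Mapping.keys P. \<integral>\<omega>. Poly_Mapping.lookup P w * ?t w \<omega> \<partial>M N)"
    proof (rule Bochner_Integration.integral_sum)
      fix u assume u: "u \<in> Poly_Mapping.keys P"
      show "integrable (M N) (\<lambda>\<omega>. Poly_Mapping.lookup P u * ?t u \<omega>)"
        using integrable_traffic[OF prob_space_axioms elim cyc[OF u] rm_joint] by (cases "u = []") simp_all
    qed
    also have "\<dots> = (\<Sum>w\<in>Poly_Mapping.keys P. Poly_Mapping.lookup P w * ?tr w N)"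
      by (intro sum.cong refl) (simp add: mean_traffic_def prob_space)
    finally show ?case by simp
  qed
  ultimately show ?thesis by (rule Lim_transform_eventually)
qed

end

text \<open>The quotient by the identity is the graph itself, so the injective limits follow from the others by induction.\<close>

lemma inj_limits_determined:
  assumes "traffic_family M Y V" "traffic_family M' Y' V"
    and eq: "\<And>T. cyclic_in V T \<Longrightarrow> lim (mean_traffic M' Y' T) = lim (mean_traffic M Y T)"
    and "cyclic_in V T"
  shows "lim (mean_inj_traffic M' Y' T) = lim (mean_inj_traffic M Y T)"
  using assms(4)
proof (induction "card (verts (shape T))" arbitrary: T rule: less_induct)
  case less
  interpret Y: traffic_family M Y V by fact
  interpret Y': traffic_family M' Y' V by fact
  interpret fin_digraph "shape T" using less.prems by (simp add: cyclic_in_iff test_graph_in_def)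
  let ?V = "verts (shape T)"
  let ?id = "restrict (\<lambda>v. v) ?V"
  let ?l = "\<lambda>T. lim (mean_inj_traffic M Y T)" and ?l' = "\<lambda>T. lim (mean_inj_traffic M' Y' T)"
  have "(\<Sum>r\<in>canon ?V. ?l' (quot_test T r)) = (\<Sum>r\<in>canon ?V. ?l (quot_test T r))"
    using limI[OF mean_traffic_limit[OF Y'.prob less.prems Y'.rm Y'.mean_inj_traffic_lim]]
      limI[OF mean_traffic_limit[OF Y.prob less.prems Y.rm Y.mean_inj_traffic_lim]] eq[OF less.prems] by simp
  moreover have "?l' (quot_test T r) = ?l (quot_test T r)" if r: "r \<in> canon ?V - {?id}" for r
  proof -
    have "card (r ` ?V) < card ?V" using canon_card_less[OF finite_verts, of r] r by simp
    then show ?thesis using less.hyps[of "quot_test T r"] cyclic_in_quot_test[OF less.prems] by simp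
  qed
  then have "(\<Sum>r\<in>canon ?V - {?id}. ?l' (quot_test T r)) = (\<Sum>r\<in>canon ?V - {?id}. ?l (quot_test T r))"
    by (rule sum.cong[OF refl])
  moreover have "?id \<in> canon ?V" by (auto simp: canon_def)
  ultimately have "?l' (quot_test T ?id) = ?l (quot_test T ?id)"
    by (simp add: sum.remove[OF finite_canon[OF finite_verts] \<open>?id \<in> canon ?V\<close>])
  moreover have id: "inj_traffic N A (quot_test T ?id) = inj_traffic N A T" for N A
    using isum_id[of "tail (shape T)" "arcs (shape T)" "head (shape T)" ?V]
    by (simp add: inj_traffic_isum image_subset_iff)
  then have "mean_inj_traffic M Y (quot_test T ?id) = mean_inj_traffic M Y T"
    "mean_inj_traffic M' Y' (quot_test T ?id) = mean_inj_traffic M' Y' T"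
    by (simp_all only: mean_inj_traffic_def fun_eq_iff simp_thms)
  ultimately show ?case by (simp only:)
qed

text \<open>In the tree case the components of the \<open>Y\<close> arcs are cyclic, so
  \<open>inj_limits_determined\<close> covers all factors of \<open>limit\<close> that involve
  \<open>Y\<close>. Otherwise both sides are 0.\<close>

lemma limit_determined:
  assumes "heavy_wigner_joint p q a M X Y" "heavy_wigner_joint p q a M' X' Y'"
    and eq: "\<And>T. cyclic_in {..<q} T \<Longrightarrow> lim (mean_traffic M' Y' T) = lim (mean_traffic M Y T)"
    and T: "cyclic_in (joint_vars p q) T"
  shows "heavy_wigner_joint.limit a M' Y' T = heavy_wigner_joint.limit a M Y T"
proof -
  interpret H: heavy_wigner_joint p q a M X Y by fact
  interpret H': heavy_wigner_joint p q a M' X' Y' by fact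
  have tg: "test_graph_in (joint_vars p q) T" using T by (simp add: cyclic_in_iff)
  have "lim (mean_inj_traffic M' Y' (comp_test (shape T) (y_arcs T) (y_lbl T) C)) =
      lim (mean_inj_traffic M Y (comp_test (shape T) (y_arcs T) (y_lbl T) C))"
    if "H.is_tree T" "C \<in> gcomps (shape T) (y_arcs T)" for C
  proof (rule inj_limits_determined[OF H.traffic_family_axioms H'.traffic_family_axioms eq])
    show "cyclic_in {..<q} (comp_test (shape T) (y_arcs T) (y_lbl T) C)"
      unfolding comp_test_def
    proof (rule cyclic_in_YA_comp[OF H.grouped_graph_test[OF T] that(2)])
      show "fst (y_lbl T e) \<in> {..<q}" if "e \<in> y_arcs T" for e
        using joint_var_cases(1)[OF tg, of e] that by (auto simp: y_arcs_def)
      show "card (gcomps (shape T) (y_arcs T)) = card (x_keys T) + 1"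
        using that(1) by (simp add: H.is_tree_def)
    qed
  qed
  then show ?thesis by (simp add: H.limit_def H'.limit_def)
qed

theorem theorem2p1:
  fixes M :: "nat \<Rightarrow> 'w measure"
    and X Y :: "nat \<Rightarrow> 'w rmat"
    and a :: "nat \<Rightarrow> nat \<Rightarrow> real"
    and p q :: nat
  assumes "heavy_wigner_model p q a M X Y"
  shows "\<exists>\<Phi> :: (nat + nat) star_poly \<Rightarrow> complex.
    (\<forall>P. star_poly_in (joint_vars p q) P \<longrightarrow> mean_trace M (case_sum X Y) P \<longlonglongrightarrow> \<Phi> P) \<and>
    asymp_traffic_free M (case_sum X Y) (joint_vars p q) (joint_fam p) \<and>
    (\<forall>(M' :: nat \<Rightarrow> 'v measure) (X' :: nat \<Rightarrow> 'v rmat) (Y' :: nat \<Rightarrow> 'v rmat).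
       heavy_wigner_model p q a M' X' Y' \<longrightarrow>
       (\<forall>T. cyclic_in {..<q} T \<longrightarrow> lim (mean_traffic M' Y' T) = lim (mean_traffic M Y T)) \<longrightarrow>
       (\<forall>P. star_poly_in (joint_vars p q) P \<longrightarrow> mean_trace M' (case_sum X' Y') P \<longlonglongrightarrow> \<Phi> P))"
proof -
  interpret H: heavy_wigner_joint p q a M X Y by (rule heavy_wigner_joint.intro[OF assms])
  show ?thesis
  proof (intro exI[of _ H.poly_limit] conjI allI impI)
    show "mean_trace M (case_sum X Y) P \<longlonglongrightarrow> H.poly_limit P" if "star_poly_in (joint_vars p q) P" for P
      using that by (rule H.mean_trace_limit)
    show "asymp_traffic_free M (case_sum X Y) (joint_vars p q) (joint_fam p)" by (rule H.traffic_free)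
    fix M' :: "nat \<Rightarrow> 'v measure" and X' Y' :: "nat \<Rightarrow> 'v rmat" and P
    assume model': "heavy_wigner_model p q a M' X' Y'"
      and eq: "\<forall>T. cyclic_in {..<q} T \<longrightarrow> lim (mean_traffic M' Y' T) = lim (mean_traffic M Y T)"
      and P: "star_poly_in (joint_vars p q) P"
    interpret H': heavy_wigner_joint p q a M' X' Y' by (rule heavy_wigner_joint.intro[OF model'])
    have lim: "H'.limit T = H.limit T" if "cyclic_in (joint_vars p q) T" for T
      using that eq by (intro limit_determined[OF H.heavy_wigner_joint_axioms H'.heavy_wigner_joint_axioms]) blast+
    have "H'.word_limit w = H.word_limit w" if "w \<in> Poly_Mapping.keys P" for w
    proof (cases "w = []")
      case False
      have "cyclic_in (joint_vars p q) (cycle_test w)"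
        using P that by (intro cycle_test_cyclic False) (auto simp: star_poly_in_def)
      then show ?thesis
        using False by (simp add: H.word_limit_def H'.word_limit_def lim cyclic_in_quot_test)
    qed (simp add: H.word_limit_def H'.word_limit_def)
    then have "H'.poly_limit P = H.poly_limit P"
      by (simp add: H.poly_limit_def H'.poly_limit_def)
    then show "mean_trace M' (case_sum X' Y') P \<longlonglongrightarrow> H.poly_limit P"
      using H'.mean_trace_limit[OF P] by simp
  qed
qed

end
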